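(* Let $X$ be a geodesible vector field on a closed manifold $M$ and let $\mathcal{F}=\langle X\rangle$ be the foliation by its flow lines. The Euler class $e_X\in H^2_{\mathrm{B}}(\mathcal{F})$ of $X$ vanishes if and only if $X$ admits a transverse (codimension-$1$) foliation $\mathcal{T}$ on $M$ that is invariant under the flow of $X$.
   Context: All objects are smooth. A nowhere vanishing vector field $X$ on $M$ is geodesible if there is a Riemannian metric on $M$ for which $X$ has unit length and the flow lines of $X$ are geodesics; equivalently, there is a $1$-form $\alpha$ with $\alpha(X)=1$ and $i_X\mathrm{d}\alpha=0$. Any such $\alpha$ is called a characteristic $1$-form of $X$. A differential form $\omega$ on $M$ is basic (for $\mathcal{F}=\langle X\rangle$) if $i_X\omega=0$ and $i_X\mathrm{d}\omega=0$; $H^\bullet_{\mathrm{B}}(\mathcal{F})$ is the cohomology of the complex of basic forms with differential the restriction of $\mathrm{d}$, and the class of a closed basic form $\omega$ is written $[\omega]_{\mathrm{B}}$. The Euler class of $X$ is $e_X:=-[\mathrm{d}\alpha]_{\mathrm{B}}\in H^2_{\mathrm{B}}(\mathcal{F})$ for any characteristic $1$-form $\alpha$ (it does not depend on the choice). *)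

theory Defs
  imports "HOL-Analysis.Analysis" "HOL-Library.Function_Algebras"
begin

section \<open>Smooth maps between Euclidean spaces\<close>

text \<open>Both notions are meant for open \<open>S\<close>.  As the domain is finite-dimensional, a function is
  \<open>C^(n+1)\<close> iff it is differentiable and all its directional derivatives are \<open>C^n\<close>.\<close>

primrec Ck_on :: "nat \<Rightarrow> 'a::euclidean_space set \<Rightarrow> ('a \<Rightarrow> 'b::real_normed_vector) \<Rightarrow> bool" where
  "Ck_on 0 S f \<longleftrightarrow> continuous_on S f"
| "Ck_on (Suc n) S f \<longleftrightarrow> (\<forall>x\<in>S. f differentiable (at x)) \<and>
     (\<forall>v. Ck_on n S (\<lambda>x. frechet_derivative f (at x) v))"

definition smooth_on :: "'a::euclidean_space set \<Rightarrow> ('a \<Rightarrow> 'b::real_normed_vector) \<Rightarrow> bool" where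
  "smooth_on S f \<longleftrightarrow> (\<forall>n. Ck_on n S f)"


section \<open>Manifolds\<close>

text \<open>The manifold is the whole type \<open>'m\<close>; it is modelled on \<open>'e\<close>, so its dimension is
  \<open>DIM('e)\<close>.  A chart is its domain together with a total function that only matters on the domain.\<close>

type_synonym ('m, 'e) chart = "'m set \<times> ('m \<Rightarrow> 'e)"

definition chart :: "('m::topological_space, 'e::euclidean_space) chart \<Rightarrow> bool" where
  "chart c \<longleftrightarrow> open (fst c) \<and> open (snd c ` fst c) \<and>
     (\<exists>g. homeomorphism (fst c) (snd c ` fst c) (snd c) g)"

definition transition :: "('m, 'e) chart \<Rightarrow> ('m, 'e) chart \<Rightarrow> 'e \<Rightarrow> 'e" where
  "transition c c' = snd c' \<circ> inv_into (fst c) (snd c)"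

definition smoothly_compatible ::
    "('m::topological_space, 'e::euclidean_space) chart \<Rightarrow> ('m, 'e) chart \<Rightarrow> bool" where
  "smoothly_compatible c c' \<longleftrightarrow>
     smooth_on (snd c ` (fst c \<inter> fst c')) (transition c c') \<and>
     smooth_on (snd c' ` (fst c \<inter> fst c')) (transition c' c)"

definition smooth_structure :: "('m::topological_space, 'e::euclidean_space) chart set \<Rightarrow> bool" where
  "smooth_structure A \<longleftrightarrow>
     (\<forall>c\<in>A. chart c) \<and> (\<Union>c\<in>A. fst c) = UNIV \<and>
     (\<forall>c\<in>A. \<forall>c'\<in>A. smoothly_compatible c c') \<and>
     (\<forall>c. chart c \<and> (\<forall>c'\<in>A. smoothly_compatible c c') \<longrightarrow> c \<in> A)"

definition closed_manifold ::
    "('m::{t2_space, second_countable_topology}, 'e::euclidean_space) chart set \<Rightarrow> bool" where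
  "closed_manifold A \<longleftrightarrow> smooth_structure A \<and> compact (UNIV :: 'm set)"

text \<open>The differential at \<open>p\<close> of the change of coordinates from \<open>c\<close> to \<open>c'\<close>.\<close>

definition dtransition ::
    "('m, 'e::euclidean_space) chart \<Rightarrow> ('m, 'e) chart \<Rightarrow> 'm \<Rightarrow> 'e \<Rightarrow> 'e" where
  "dtransition c c' p = frechet_derivative (transition c c') (at (snd c p))"


section \<open>Vector fields, tensor fields and differential forms\<close>

text \<open>A field on the manifold is the compatible family of its local representatives in the charts:
  \<open>X c x\<close> and \<open>\<omega> c x\<close> are the values in the chart \<open>c\<close> at the coordinate point \<open>x\<close>.\<close>

type_synonym ('m, 'e) vfield = "('m, 'e) chart \<Rightarrow> 'e \<Rightarrow> 'e"
type_synonym ('m, 'e) tensor = "('m, 'e) chart \<Rightarrow> 'e \<Rightarrow> 'e list \<Rightarrow> real"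

definition vector_field ::
    "('m, 'e::euclidean_space) chart set \<Rightarrow> ('m, 'e) vfield \<Rightarrow> bool" where
  "vector_field A X \<longleftrightarrow>
     (\<forall>c\<in>A. smooth_on (snd c ` fst c) (X c)) \<and>
     (\<forall>c\<in>A. \<forall>c'\<in>A. \<forall>p\<in>fst c \<inter> fst c'.
        X c' (snd c' p) = dtransition c c' p (X c (snd c p)))"

definition nowhere_vanishing ::
    "('m, 'e::euclidean_space) chart set \<Rightarrow> ('m, 'e) vfield \<Rightarrow> bool" where
  "nowhere_vanishing A X \<longleftrightarrow> (\<forall>c\<in>A. \<forall>x\<in>snd c ` fst c. X c x \<noteq> 0)"

text \<open>Smooth covariant \<open>k\<close>-tensor fields.  The last two conditions normalise the values at
  meaningless arguments, so that equality of tensor fields is equality of functions and the pointwise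
  operations of \<open>Function_Algebras\<close> are the vector space operations.\<close>

definition tensor_field ::
    "('m, 'e::euclidean_space) chart set \<Rightarrow> nat \<Rightarrow> ('m, 'e) tensor \<Rightarrow> bool" where
  "tensor_field A k \<omega> \<longleftrightarrow>
     (\<forall>c\<in>A. \<forall>x\<in>snd c ` fst c. \<forall>vs i. length vs = k \<and> i < k \<longrightarrow>
        linear (\<lambda>v. \<omega> c x (vs[i := v]))) \<and>
     (\<forall>c\<in>A. \<forall>vs. length vs = k \<longrightarrow> smooth_on (snd c ` fst c) (\<lambda>x. \<omega> c x vs)) \<and>
     (\<forall>c\<in>A. \<forall>c'\<in>A. \<forall>p\<in>fst c \<inter> fst c'. \<forall>vs. length vs = k \<longrightarrow>
        \<omega> c (snd c p) vs = \<omega> c' (snd c' p) (map (dtransition c c' p) vs)) \<and>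
     (\<forall>c x vs. length vs \<noteq> k \<longrightarrow> \<omega> c x vs = 0) \<and>
     (\<forall>c x vs. c \<notin> A \<or> x \<notin> snd c ` fst c \<longrightarrow> \<omega> c x vs = 0)"

definition diff_form ::
    "('m, 'e::euclidean_space) chart set \<Rightarrow> nat \<Rightarrow> ('m, 'e) tensor \<Rightarrow> bool" where
  "diff_form A k \<omega> \<longleftrightarrow> tensor_field A k \<omega> \<and>
     (\<forall>c x vs i j. i < j \<and> j < length vs \<and> vs ! i = vs ! j \<longrightarrow> \<omega> c x vs = 0)"

text \<open>In a chart \<open>d\<omega>(v\<^sub>0,\<dots>,v\<^sub>k) = \<Sum>\<^sub>i (-1)\<^sup>i D\<omega>(v\<^sub>i)(v\<^sub>0,\<dots>,v\<^sub>k without v\<^sub>i)\<close> for constant \<open>v\<^sub>i\<close>.\<close>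

definition ext_deriv :: "('m, 'e::euclidean_space) tensor \<Rightarrow> ('m, 'e) tensor" where
  "ext_deriv \<omega> = (\<lambda>c x vs. if x \<in> snd c ` fst c
     then \<Sum>i<length vs. (-1) ^ i *
            frechet_derivative (\<lambda>y. \<omega> c y (take i vs @ drop (Suc i) vs)) (at x) (vs ! i)
     else 0)"

text \<open>For a form of degree 0 this is 0, because such a form vanishes on nonempty lists.\<close>

definition int_prod :: "('m, 'e) vfield \<Rightarrow> ('m, 'e) tensor \<Rightarrow> ('m, 'e) tensor" where
  "int_prod X \<omega> = (\<lambda>c x vs. \<omega> c x (X c x # vs))"


section \<open>Flows\<close>

definition integral_curve ::
    "('m::topological_space, 'e::euclidean_space) chart set \<Rightarrow> ('m, 'e) vfield \<Rightarrow> (real \<Rightarrow> 'm) \<Rightarrow> bool"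
  where
  "integral_curve A X \<gamma> \<longleftrightarrow> continuous_on UNIV \<gamma> \<and>
     (\<forall>c\<in>A. \<forall>t. \<gamma> t \<in> fst c \<longrightarrow>
        ((snd c \<circ> \<gamma>) has_vector_derivative X c (snd c (\<gamma> t))) (at t))"

text \<open>On a closed manifold every vector field is complete, so the description is proper for all
  \<open>t\<close> and \<open>p\<close>.\<close>

definition flow ::
    "('m::topological_space, 'e::euclidean_space) chart set \<Rightarrow> ('m, 'e) vfield \<Rightarrow> real \<Rightarrow> 'm \<Rightarrow> 'm" where
  "flow A X t p = (THE q. \<exists>\<gamma>. integral_curve A X \<gamma> \<and> \<gamma> 0 = p \<and> \<gamma> t = q)"


section \<open>Riemannian metrics and geodesible vector fields\<close>

definition riemannian_metric ::
    "('m, 'e::euclidean_space) chart set \<Rightarrow> ('m, 'e) tensor \<Rightarrow> bool" where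
  "riemannian_metric A g \<longleftrightarrow> tensor_field A 2 g \<and>
     (\<forall>c\<in>A. \<forall>x\<in>snd c ` fst c.
        (\<forall>v w. g c x [v, w] = g c x [w, v]) \<and> (\<forall>v. v \<noteq> 0 \<longrightarrow> g c x [v, v] > 0))"

text \<open>The Christoffel symbols of the first kind, that is \<open>g(\<nabla>\<^sub>u v, w)\<close> for the Levi-Civita connection
  and constant \<open>u\<close>, \<open>v\<close>, \<open>w\<close> in the chart.\<close>

definition christoffel ::
    "('m, 'e::euclidean_space) tensor \<Rightarrow> ('m, 'e) chart \<Rightarrow> 'e \<Rightarrow> 'e \<Rightarrow> 'e \<Rightarrow> 'e \<Rightarrow> real" where
  "christoffel g c x u v w =
     (frechet_derivative (\<lambda>y. g c y [v, w]) (at x) u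
      + frechet_derivative (\<lambda>y. g c y [u, w]) (at x) v
      - frechet_derivative (\<lambda>y. g c y [u, v]) (at x) w) / 2"

text \<open>The geodesic equation \<open>\<nabla>\<^bsub>\<gamma>'\<^esub> \<gamma>' = 0\<close> in charts, with the index lowered by \<open>g\<close>; \<open>u\<close> and \<open>a\<close>
  are the coordinate velocity near \<open>t\<close> and the coordinate acceleration at \<open>t\<close>.\<close>

definition geodesic ::
    "('m::topological_space, 'e::euclidean_space) chart set \<Rightarrow> ('m, 'e) tensor \<Rightarrow> (real \<Rightarrow> 'm) \<Rightarrow> bool"
  where
  "geodesic A g \<gamma> \<longleftrightarrow> continuous_on UNIV \<gamma> \<and>
     (\<forall>c\<in>A. \<forall>t. \<gamma> t \<in> fst c \<longrightarrow>
        (\<exists>u a. (\<forall>\<^sub>F s in nhds t. ((snd c \<circ> \<gamma>) has_vector_derivative u s) (at s)) \<and>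
           (u has_vector_derivative a) (at t) \<and>
           (\<forall>w. g c (snd c (\<gamma> t)) [a, w] + christoffel g c (snd c (\<gamma> t)) (u t) (u t) w = 0)))"

definition geodesible ::
    "('m::topological_space, 'e::euclidean_space) chart set \<Rightarrow> ('m, 'e) vfield \<Rightarrow> bool" where
  "geodesible A X \<longleftrightarrow> vector_field A X \<and> nowhere_vanishing A X \<and>
     (\<exists>g. riemannian_metric A g \<and>
        (\<forall>c\<in>A. \<forall>x\<in>snd c ` fst c. sqrt (g c x [X c x, X c x]) = 1) \<and>
        (\<forall>p. geodesic A g (\<lambda>t. flow A X t p)))"

definition characteristic_form ::
    "('m, 'e::euclidean_space) chart set \<Rightarrow> ('m, 'e) vfield \<Rightarrow> ('m, 'e) tensor \<Rightarrow> bool" where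
  "characteristic_form A X \<alpha> \<longleftrightarrow> diff_form A 1 \<alpha> \<and>
     (\<forall>c\<in>A. \<forall>x\<in>snd c ` fst c. \<alpha> c x [X c x] = 1) \<and>
     int_prod X (ext_deriv \<alpha>) = 0"


section \<open>Basic cohomology and the Euler class\<close>

definition basic_forms ::
    "('m, 'e::euclidean_space) chart set \<Rightarrow> ('m, 'e) vfield \<Rightarrow> nat \<Rightarrow> ('m, 'e) tensor set" where
  "basic_forms A X k =
     {\<omega>. diff_form A k \<omega> \<and> int_prod X \<omega> = 0 \<and> int_prod X (ext_deriv \<omega>) = 0}"

definition closed_basic ::
    "('m, 'e::euclidean_space) chart set \<Rightarrow> ('m, 'e) vfield \<Rightarrow> nat \<Rightarrow> ('m, 'e) tensor set" where
  "closed_basic A X k = {\<omega> \<in> basic_forms A X k. ext_deriv \<omega> = 0}"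

text \<open>The case \<open>0\<close> is needed for degree \<open>k = 0\<close> only.\<close>

definition exact_basic ::
    "('m, 'e::euclidean_space) chart set \<Rightarrow> ('m, 'e) vfield \<Rightarrow> nat \<Rightarrow> ('m, 'e) tensor set" where
  "exact_basic A X k = insert 0 {ext_deriv \<eta> | \<eta> j. k = Suc j \<and> \<eta> \<in> basic_forms A X j}"

definition basic_cohomologous ::
    "('m, 'e::euclidean_space) chart set \<Rightarrow> ('m, 'e) vfield \<Rightarrow> nat \<Rightarrow>
     (('m, 'e) tensor \<times> ('m, 'e) tensor) set" where
  "basic_cohomologous A X k =
     {(\<omega>, \<omega>'). \<omega> \<in> closed_basic A X k \<and> \<omega>' \<in> closed_basic A X k \<and> \<omega>' - \<omega> \<in> exact_basic A X k}"

definition basic_cohomology ::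
    "('m, 'e::euclidean_space) chart set \<Rightarrow> ('m, 'e) vfield \<Rightarrow> nat \<Rightarrow> ('m, 'e) tensor set set" where
  "basic_cohomology A X k = closed_basic A X k // basic_cohomologous A X k"

text \<open>The class of \<open>\<omega>\<close> as an element of the quotient above, whose zero is \<open>basic_class A X k 0\<close>.\<close>

definition basic_class ::
    "('m, 'e::euclidean_space) chart set \<Rightarrow> ('m, 'e) vfield \<Rightarrow> nat \<Rightarrow> ('m, 'e) tensor \<Rightarrow>
     ('m, 'e) tensor set" where
  "basic_class A X k \<omega> = basic_cohomologous A X k `` {\<omega>}"

definition euler_class ::
    "('m, 'e::euclidean_space) chart set \<Rightarrow> ('m, 'e) vfield \<Rightarrow> ('m, 'e) tensor set" where
  "euler_class A X = basic_class A X 2 (- ext_deriv (SOME \<alpha>. characteristic_form A X \<alpha>))"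


section \<open>Foliations\<close>

text \<open>A foliation is a maximal foliated atlas.  The set \<open>Q \<subseteq> Basis\<close> singles out the transverse
  coordinates, so the codimension is \<open>card Q\<close> and the plaques of a chart are the sets on which these
  coordinates are constant.  Two charts are compatible if locally they have the same plaques, i.e. if
  both transition maps are locally of the form \<open>(x, y) \<mapsto> (f (x, y), h y)\<close>.\<close>

definition same_plaque :: "'e::euclidean_space set \<Rightarrow> 'e \<Rightarrow> 'e \<Rightarrow> bool" where
  "same_plaque Q u v \<longleftrightarrow> (\<forall>b\<in>Q. u \<bullet> b = v \<bullet> b)"

definition foliated_compatible ::
    "'e::euclidean_space set \<Rightarrow> ('m::topological_space, 'e) chart \<Rightarrow> ('m, 'e) chart \<Rightarrow> bool" where
  "foliated_compatible Q c c' \<longleftrightarrow>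
     (\<forall>p\<in>fst c \<inter> fst c'. \<exists>W. open W \<and> p \<in> W \<and> W \<subseteq> fst c \<inter> fst c' \<and>
        (\<forall>q\<in>W. \<forall>r\<in>W. same_plaque Q (snd c q) (snd c r) \<longleftrightarrow> same_plaque Q (snd c' q) (snd c' r)))"

definition foliation ::
    "('m::topological_space, 'e::euclidean_space) chart set \<Rightarrow> 'e set \<Rightarrow> ('m, 'e) chart set \<Rightarrow> bool" where
  "foliation A Q T \<longleftrightarrow> Q \<subseteq> Basis \<and> T \<subseteq> A \<and> (\<Union>c\<in>T. fst c) = UNIV \<and>
     (\<forall>c\<in>T. \<forall>c'\<in>T. foliated_compatible Q c c') \<and>
     (\<forall>c\<in>A. (\<forall>c'\<in>T. foliated_compatible Q c c') \<longrightarrow> c \<in> T)"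

text \<open>In a foliated chart the tangent spaces of the leaves are all equal to the subspace of vectors
  whose transverse coordinates vanish; transversality means that it and \<open>X\<close> span.\<close>

definition transverse_foliation ::
    "('m, 'e::euclidean_space) vfield \<Rightarrow> 'e set \<Rightarrow> ('m, 'e) chart set \<Rightarrow> bool" where
  "transverse_foliation X Q T \<longleftrightarrow> (\<forall>c\<in>T. \<forall>x\<in>snd c ` fst c.
     span (insert (X c x) {v. \<forall>b\<in>Q. v \<bullet> b = 0}) = UNIV)"

text \<open>A foliation \<open>T\<close> is invariant under a diffeomorphism \<open>f\<close> if its pullback, given by the foliated
  charts \<open>(f\<^sup>-\<^sup>1(U), \<phi> \<circ> f)\<close>, is \<open>T\<close> again.\<close>

definition pullback_chart :: "('m \<Rightarrow> 'm) \<Rightarrow> ('m, 'e) chart \<Rightarrow> ('m, 'e) chart" where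
  "pullback_chart f c = (f -` fst c, snd c \<circ> f)"

definition flow_invariant ::
    "('m::topological_space, 'e::euclidean_space) chart set \<Rightarrow> ('m, 'e) vfield \<Rightarrow> 'e set \<Rightarrow>
     ('m, 'e) chart set \<Rightarrow> bool" where
  "flow_invariant A X Q T \<longleftrightarrow> (\<forall>t. \<forall>c\<in>T. \<forall>c'\<in>T.
     foliated_compatible Q (pullback_chart (flow A X t) c) c')"

end

theory Submission
  imports Defs
begin

text \<open>Two characteristic 1-forms of \<open>X\<close> differ by a basic 1-form, so the class of \<open>- d\<alpha>\<close> vanishes iff some
  characteristic form is closed (\<open>euler_class_zero_iff\<close>).  Characteristic forms exist because the 1-form
  \<open>g(X, \<cdot>)\<close> dual to \<open>X\<close> is one: \<open>i\<^sub>X d\<alpha> = 0\<close> is the geodesic equation for the flow lines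
  (\<open>geodesible_characteristic_form\<close>).  It remains to see that closed characteristic forms and invariant
  transverse foliations determine each other (\<open>closed_characteristic_form_iff_foliation\<close>).

  A closed form \<open>\<alpha>\<close> with \<open>\<alpha>(X) = 1\<close> is locally \<open>df\<close>, and \<open>f\<close> can be taken as a coordinate
  (\<open>closed_form_adapted_chart\<close>).  The level sets of these coordinates are the leaves of a foliation
  tangent to the kernel of \<open>\<alpha>\<close>, hence transverse to \<open>X\<close>.  As \<open>f\<close> grows at unit speed along \<open>X\<close>, the flow
  maps level sets to level sets for a short time.  By compactness this time is uniform, and the group
  law extends the invariance to all times.

  Conversely, let \<open>\<alpha>\<close> be the 1-form that vanishes on the leaves and has value \<open>1\<close> on \<open>X\<close>.  In a foliated
  chart with transverse coordinate \<open>x \<bullet> b\<close> it is \<open>(v \<bullet> b) / (X \<bullet> b)\<close>.  By invariance the points of a plaque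
  move with the same transverse speed, so \<open>X \<bullet> b\<close> depends on \<open>x \<bullet> b\<close> only and \<open>\<alpha>\<close> is closed
  (\<open>transverse_speed_constant_on_plaques\<close>, \<open>foliation_form_closed\<close>).

  Both directions use the flow itself, so its existence for all times, its uniqueness and its
  continuity are derived from the contraction principle, compactness and the Hausdorff property.\<close>

section \<open>Calculus of smooth maps\<close>

abbreviation Dt :: "('a::real_normed_vector \<Rightarrow> 'b::real_normed_vector) \<Rightarrow> 'a \<Rightarrow> 'a \<Rightarrow> 'b" where
  "Dt f x \<equiv> frechet_derivative f (at x)"

lemma Dt_eqI: "(f has_derivative f') (at x) \<Longrightarrow> Dt f x = f'"
  by (metis frechet_derivative_at)

lemma Dt_cong:
  assumes "open S" "x \<in> S" "\<And>y. y \<in> S \<Longrightarrow> f y = g y"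
  shows "Dt f x = Dt g x"
proof -
  have "(f has_derivative f') (at x) \<longleftrightarrow> (g has_derivative f') (at x)" for f'
    using has_derivative_transform_within_open[OF _ assms(1,2)] assms(3) by metis
  then show ?thesis
    unfolding frechet_derivative_def by simp
qed

lemma Ck_on_subset: "Ck_on n T f \<Longrightarrow> S \<subseteq> T \<Longrightarrow> Ck_on n S f"
  by (induction n arbitrary: f) (auto intro: continuous_on_subset)

lemma Ck_on_cong:
  assumes "open S" "\<And>x. x \<in> S \<Longrightarrow> f x = g x" "Ck_on n S f"
  shows "Ck_on n S g"
  using assms(2,3)
proof (induction n arbitrary: f g)
  case 0
  then show ?case using continuous_on_cong by (metis Ck_on.simps(1))
next
  case (Suc n)
  have "g differentiable (at x)" if "x \<in> S" for x
    using Suc.prems that assms(1) has_derivative_transform_within_open[of f _ x UNIV S g]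
    unfolding differentiable_def Ck_on.simps by metis
  moreover have "Ck_on n S (\<lambda>x. Dt g x v)" for v
  proof (rule Suc.IH[of "\<lambda>x. Dt f x v"])
    show "Dt f x v = Dt g x v" if "x \<in> S" for x
      using Dt_cong[OF assms(1) that, of f g] Suc.prems(1) by simp
    show "Ck_on n S (\<lambda>x. Dt f x v)" using Suc.prems by simp
  qed
  ultimately show ?case by simp
qed

lemma Ck_on_local:
  assumes "\<And>x. x \<in> S \<Longrightarrow> \<exists>U. open U \<and> x \<in> U \<and> Ck_on n U f"
  shows "Ck_on n S f"
  using assms
proof (induction n arbitrary: f)
  case 0
  then show ?case
    by (metis Ck_on.simps(1) continuous_at_imp_continuous_on continuous_on_eq_continuous_at)
next
  case (Suc n)
  have "f differentiable (at x)" if "x \<in> S" for x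
    using Suc.prems[OF that] by auto
  moreover have "Ck_on n S (\<lambda>x. Dt f x v)" for v
    by (rule Suc.IH) (use Suc.prems in \<open>auto, blast\<close>)
  ultimately show ?case by simp
qed

lemma Ck_on_SucD: "Ck_on (Suc n) S f \<Longrightarrow> Ck_on n S f"
proof (induction n arbitrary: f)
  case 0
  then show ?case
    by (auto intro!: continuous_at_imp_continuous_on differentiable_imp_continuous_within)
next
  case (Suc n)
  then show ?case by auto
qed

lemma Ck_on_SucI:
  assumes "open S" "\<And>x. x \<in> S \<Longrightarrow> (f has_derivative f' x) (at x)"
    and "\<And>v. Ck_on n S (\<lambda>x. f' x v)"
  shows "Ck_on (Suc n) S f"
proof -
  have "Ck_on n S (\<lambda>x. Dt f x v)" for v
    by (rule Ck_on_cong[OF assms(1) _ assms(3)[of v]]) (metis Dt_eqI assms(2))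
  then show ?thesis using assms(2) by (auto simp: differentiable_def)
qed

lemma Ck_on_const: "Ck_on n S (\<lambda>x. c)"
  by (induction n arbitrary: c) auto

lemma Dt_works: "f differentiable (at x) \<Longrightarrow> (f has_derivative Dt f x) (at x)"
  by (simp add: frechet_derivative_works)

lemma Ck_on_has_derivative:
  "Ck_on (Suc n) S f \<Longrightarrow> x \<in> S \<Longrightarrow> (f has_derivative Dt f x) (at x)"
  by (auto simp: frechet_derivative_works)

lemma Ck_on_add:
  assumes "open S" "Ck_on n S f" "Ck_on n S g"
  shows "Ck_on n S (\<lambda>x. f x + g x)"
  using assms(2,3)
proof (induction n arbitrary: f g)
  case (Suc n)
  show ?case
    by (rule Ck_on_SucI[OF assms(1), where f' = "\<lambda>x v. Dt f x v + Dt g x v"])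
      (use Suc in \<open>auto intro!: has_derivative_add Dt_works\<close>)
qed (auto intro: continuous_intros)

lemma Ck_on_bounded_linear:
  assumes "bounded_linear L" "open S" "Ck_on n S f"
  shows "Ck_on n S (\<lambda>x. L (f x))"
  using assms(3)
proof (induction n arbitrary: f)
  case 0
  then show ?case
    by (auto intro: bounded_linear.continuous_on[OF assms(1)])
next
  case (Suc n)
  show ?case
    by (rule Ck_on_SucI[OF assms(2), where f' = "\<lambda>x v. L (Dt f x v)"])
      (use Suc in \<open>auto intro!: bounded_linear.has_derivative[OF assms(1)] Dt_works\<close>)
qed

lemma Ck_on_bilinear:
  assumes "bounded_bilinear P" "open S" "Ck_on n S f" "Ck_on n S g"
  shows "Ck_on n S (\<lambda>x. P (f x) (g x))"
  using assms(3,4)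
proof (induction n arbitrary: f g)
  case 0
  then show ?case by (auto intro: bounded_bilinear.continuous_on[OF assms(1)])
next
  case (Suc n)
  show ?case
  proof (rule Ck_on_SucI[OF assms(2), where f' = "\<lambda>x v. P (f x) (Dt g x v) + P (Dt f x v) (g x)"])
    show "Ck_on n S (\<lambda>x. P (f x) (Dt g x v) + P (Dt f x v) (g x))" for v
      by (intro Ck_on_add[OF assms(2)] Suc.IH)
        (use Suc.prems Ck_on_SucD[OF Suc.prems(1)] Ck_on_SucD[OF Suc.prems(2)] in auto)
  qed (use Suc.prems in \<open>auto intro!: bounded_bilinear.FDERIV[OF assms(1)] Dt_works\<close>)
qed

lemma Ck_on_sum:
  assumes "open S" "\<And>i. i \<in> I \<Longrightarrow> Ck_on n S (f i)"
  shows "Ck_on n S (\<lambda>x. \<Sum>i\<in>I. f i x)"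
  using assms(2)
  by (induction I rule: infinite_finite_induct) (auto simp: Ck_on_const intro: Ck_on_add[OF assms(1)])

lemma Ck_on_inverse:
  fixes f :: "'a::euclidean_space \<Rightarrow> real"
  assumes "open S" "Ck_on n S f" "\<And>x. x \<in> S \<Longrightarrow> f x \<noteq> 0"
  shows "Ck_on n S (\<lambda>x. inverse (f x))"
  using assms(2)
proof (induction n)
  case 0
  then show ?case using assms(3) by (auto intro!: continuous_intros)
next
  case (Suc n)
  have n: "Ck_on n S f" using Suc.prems by (rule Ck_on_SucD)
  note mult = Ck_on_bilinear[OF bounded_bilinear_mult assms(1)]
  show ?case
  proof (rule Ck_on_SucI[OF assms(1), where f' = "\<lambda>x v. - (inverse (f x) * Dt f x v * inverse (f x))"])
    show "Ck_on n S (\<lambda>x. - (inverse (f x) * Dt f x v * inverse (f x)))" for v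
      by (intro Ck_on_bounded_linear[OF bounded_linear_minus[OF bounded_linear_ident] assms(1)] mult Suc.IH[OF n])
        (use Suc.prems in auto)
  qed (use Suc.prems assms(3) in \<open>auto intro!: Deriv.has_derivative_inverse Dt_works\<close>)
qed

text \<open>By the chain rule and linearity of the derivative, \<open>D(f \<circ> g)(v)\<close> is the sum of the products of the
  components of \<open>Dg(v)\<close> with the partial derivatives of \<open>f\<close> composed with \<open>g\<close>, which is the form that the
  induction on the order can handle.\<close>

lemma Ck_on_compose:
  fixes g :: "'a::euclidean_space \<Rightarrow> 'b::euclidean_space"
    and f :: "'b \<Rightarrow> 'c::real_normed_vector"
  assumes "open S" "open T" "\<And>x. x \<in> S \<Longrightarrow> g x \<in> T" "Ck_on n T f" "Ck_on n S g"
  shows "Ck_on n S (\<lambda>x. f (g x))"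
  using assms(4,5)
proof (induction n arbitrary: f)
  case 0
  then show ?case using assms(3) by (auto intro!: continuous_on_compose2[of T f S g])
next
  case (Suc n)
  have n: "Ck_on n S g" using Suc.prems(2) by (rule Ck_on_SucD)
  show ?case
  proof (rule Ck_on_SucI[OF assms(1), where f' = "\<lambda>x v. \<Sum>b\<in>Basis. (Dt g x v \<bullet> b) *\<^sub>R Dt f (g x) b"])
    fix x assume x: "x \<in> S"
    have f: "(f has_derivative Dt f (g x)) (at (g x))"
      using Suc.prems(1) assms(3)[OF x] by (auto intro: Dt_works)
    have g: "(g has_derivative Dt g x) (at x)"
      using Suc.prems(2) x by (auto intro: Dt_works)
    have lin: "linear (Dt f (g x))"
      using f has_derivative_linear by blast
    have "Dt f (g x) (Dt g x v) = (\<Sum>b\<in>Basis. (Dt g x v \<bullet> b) *\<^sub>R Dt f (g x) b)" for v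
      by (subst euclidean_representation[symmetric, of "Dt g x v"])
        (simp only: linear_sum[OF lin] linear_scale[OF lin])
    with has_derivative_compose[OF g f]
    show "((\<lambda>x. f (g x)) has_derivative (\<lambda>v. \<Sum>b\<in>Basis. (Dt g x v \<bullet> b) *\<^sub>R Dt f (g x) b)) (at x)"
      by simp
  next
    fix v
    show "Ck_on n S (\<lambda>x. \<Sum>b\<in>Basis. (Dt g x v \<bullet> b) *\<^sub>R Dt f (g x) b)"
      by (intro Ck_on_sum[OF assms(1)] Ck_on_bilinear[OF bounded_bilinear_scaleR assms(1)] Suc.IH n
          Ck_on_bounded_linear[OF bounded_linear_inner_left assms(1)]) (use Suc.prems in auto)
  qed
qed

lemma smooth_on_subset: "smooth_on T f \<Longrightarrow> S \<subseteq> T \<Longrightarrow> smooth_on S f"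
  unfolding smooth_on_def using Ck_on_subset by blast

lemma smooth_on_cong: "open S \<Longrightarrow> (\<And>x. x \<in> S \<Longrightarrow> f x = g x) \<Longrightarrow> smooth_on S f \<Longrightarrow> smooth_on S g"
  unfolding smooth_on_def using Ck_on_cong by blast

lemma smooth_on_local:
  assumes "\<And>x. x \<in> S \<Longrightarrow> \<exists>U. open U \<and> x \<in> U \<and> smooth_on U f"
  shows "smooth_on S f"
  unfolding smooth_on_def
proof
  show "Ck_on n S f" for n
    by (rule Ck_on_local) (use assms in \<open>unfold smooth_on_def, blast\<close>)
qed

lemma smooth_on_has_derivative: "smooth_on S f \<Longrightarrow> x \<in> S \<Longrightarrow> (f has_derivative Dt f x) (at x)"
  unfolding smooth_on_def using Ck_on_has_derivative by blast

lemma smooth_on_Dt: "smooth_on S f \<Longrightarrow> smooth_on S (\<lambda>x. Dt f x v)"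
  unfolding smooth_on_def using Ck_on.simps(2) by blast

lemma smooth_on_continuous: "smooth_on S f \<Longrightarrow> continuous_on S f"
  unfolding smooth_on_def using Ck_on.simps(1) by blast

lemma smooth_on_derivI:
  assumes "open S" "\<And>x. x \<in> S \<Longrightarrow> (f has_derivative f' x) (at x)" "\<And>v. smooth_on S (\<lambda>x. f' x v)"
  shows "smooth_on S f"
  unfolding smooth_on_def
proof
  show "Ck_on n S f" for n
    using Ck_on_SucD[OF Ck_on_SucI[OF assms(1,2), of n]] assms(3) unfolding smooth_on_def by blast
qed

lemma smooth_on_const: "smooth_on S (\<lambda>x. c)"
  and smooth_on_add: "open S \<Longrightarrow> smooth_on S f \<Longrightarrow> smooth_on S g \<Longrightarrow> smooth_on S (\<lambda>x. f x + g x)"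
  and smooth_on_bounded_linear: "bounded_linear L \<Longrightarrow> open S \<Longrightarrow> smooth_on S f \<Longrightarrow> smooth_on S (\<lambda>x. L (f x))"
  and smooth_on_bilinear: "bounded_bilinear P \<Longrightarrow> open S \<Longrightarrow> smooth_on S f \<Longrightarrow> smooth_on S h \<Longrightarrow>
    smooth_on S (\<lambda>x. P (f x) (h x))"
  unfolding smooth_on_def
  by (auto intro: Ck_on_const Ck_on_add Ck_on_bounded_linear Ck_on_bilinear)

lemma smooth_on_sum:
  "open S \<Longrightarrow> (\<And>i. i \<in> I \<Longrightarrow> smooth_on S (f i)) \<Longrightarrow> smooth_on S (\<lambda>x. \<Sum>i\<in>I. f i x)"
  unfolding smooth_on_def by (auto intro: Ck_on_sum)

lemma smooth_on_inverse:
  "open S \<Longrightarrow> smooth_on S f \<Longrightarrow> (\<And>x. x \<in> S \<Longrightarrow> f x \<noteq> 0) \<Longrightarrow> smooth_on S (\<lambda>x. inverse (f x :: real))"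
  unfolding smooth_on_def by (auto intro: Ck_on_inverse)

lemma smooth_on_compose:
  fixes g :: "'a::euclidean_space \<Rightarrow> 'b::euclidean_space"
  shows "open S \<Longrightarrow> open T \<Longrightarrow> (\<And>x. x \<in> S \<Longrightarrow> g x \<in> T) \<Longrightarrow> smooth_on T f \<Longrightarrow> smooth_on S g \<Longrightarrow>
    smooth_on S (\<lambda>x. f (g x))"
  unfolding smooth_on_def by (auto intro: Ck_on_compose)

lemma smooth_on_id: "open S \<Longrightarrow> smooth_on S (\<lambda>x. x)"
  by (rule smooth_on_derivI[where f' = "\<lambda>x v. v"]) (auto simp: smooth_on_const)

lemmas smooth_on_mult = smooth_on_bilinear[OF bounded_bilinear_mult]
  and smooth_on_scaleR = smooth_on_bilinear[OF bounded_bilinear_scaleR]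
  and smooth_on_inner_left = smooth_on_bounded_linear[OF bounded_linear_inner_left]
  and smooth_on_uminus = smooth_on_bounded_linear[OF bounded_linear_minus[OF bounded_linear_ident]]

lemma smooth_on_diff:
  "open S \<Longrightarrow> smooth_on S f \<Longrightarrow> smooth_on S g \<Longrightarrow> smooth_on S (\<lambda>x. f x - g x)"
  using smooth_on_add[of S f "\<lambda>x. - g x"] smooth_on_uminus[of S g] by simp

text \<open>Both iterated derivatives are limits of the same second difference quotient: by the mean
  value theorem, applied first in one direction and then in the other, the second difference over a
  small parallelogram is a value of either of them at an intermediate point.\<close>

lemma second_difference_mvt:
  fixes f :: "'a::euclidean_space \<Rightarrow> real"
  assumes "open S" "smooth_on S f" "h > 0"
    and inS: "\<And>s t. 0 \<le> s \<Longrightarrow> s \<le> h \<Longrightarrow> 0 \<le> t \<Longrightarrow> t \<le> h \<Longrightarrow> x + s *\<^sub>R u + t *\<^sub>R v \<in> S"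
  shows "\<exists>s t. 0 \<le> s \<and> s \<le> h \<and> 0 \<le> t \<and> t \<le> h \<and>
    f (x + h *\<^sub>R u + h *\<^sub>R v) - f (x + h *\<^sub>R u) - f (x + h *\<^sub>R v) + f x
      = h * h * Dt (\<lambda>y. Dt f y u) (x + s *\<^sub>R u + t *\<^sub>R v) v"
proof -
  define g where "g s = f (x + s *\<^sub>R u + h *\<^sub>R v) - f (x + s *\<^sub>R u)" for s
  define g' where "g' s = Dt f (x + s *\<^sub>R u + h *\<^sub>R v) u - Dt f (x + s *\<^sub>R u) u" for s
  have fd: "(f has_derivative Dt f y) (at y)" if "y \<in> S" for y
    using smooth_on_has_derivative[OF assms(2) that] .
  have part: "((\<lambda>s. k (a + s *\<^sub>R w)) has_real_derivative Dt k (a + s *\<^sub>R w) w) (at s)"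
    if "(k has_derivative Dt k (a + s *\<^sub>R w)) (at (a + s *\<^sub>R w))"
    for k :: "'a \<Rightarrow> real" and a w s
  proof -
    have "((\<lambda>s. a + s *\<^sub>R w) has_derivative (\<lambda>r. r *\<^sub>R w)) (at s)"
      by (auto intro!: derivative_eq_intros)
    from has_derivative_compose[OF this that]
    show ?thesis
      unfolding has_field_derivative_def
      using linear_scale[OF has_derivative_linear[OF that]] by (simp add: mult_commute_abs)
  qed
  have g: "(g has_real_derivative g' s) (at s)" if "0 \<le> s" "s \<le> h" for s
    unfolding g_def g'_def
    using part[OF fd, of "x + h *\<^sub>R v" s u] part[OF fd, of x s u] inS[OF that, of h] inS[OF that, of 0] \<open>h > 0\<close>
    by (intro DERIV_diff) (auto simp: algebra_simps)
  obtain s where s: "0 < s" "s < h" "g h - g 0 = (h - 0) * g' s"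
    using MVT2[of 0 h g g'] g \<open>h > 0\<close> by auto
  define k where "k = (\<lambda>y. Dt f y u)"
  have kd: "(k has_derivative Dt k y) (at y)" if "y \<in> S" for y
    using smooth_on_has_derivative[OF smooth_on_Dt[OF assms(2)] that] unfolding k_def .
  obtain t where t: "0 < t" "t < h"
    "k (x + s *\<^sub>R u + h *\<^sub>R v) - k (x + s *\<^sub>R u + 0 *\<^sub>R v) = (h - 0) * Dt k (x + s *\<^sub>R u + t *\<^sub>R v) v"
    using MVT2[of 0 h "\<lambda>t. k (x + s *\<^sub>R u + t *\<^sub>R v)" "\<lambda>t. Dt k (x + s *\<^sub>R u + t *\<^sub>R v) v"]
      part[OF kd] inS s \<open>h > 0\<close> by auto
  have "f (x + h *\<^sub>R u + h *\<^sub>R v) - f (x + h *\<^sub>R u) - f (x + h *\<^sub>R v) + f x = g h - g 0"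
    by (simp add: g_def)
  also have "\<dots> = h * h * Dt k (x + s *\<^sub>R u + t *\<^sub>R v) v"
    using s(3) t(3) by (simp add: g'_def k_def)
  finally show ?thesis
    using s t unfolding k_def by (intro exI[of _ s] exI[of _ t]) auto
qed

lemma Dt_Dt_commute_real:
  fixes f :: "'a::euclidean_space \<Rightarrow> real"
  assumes "open S" "smooth_on S f" "x \<in> S"
  shows "Dt (\<lambda>y. Dt f y u) x v = Dt (\<lambda>y. Dt f y v) x u"
proof (rule ccontr)
  define a where "a = (\<lambda>y. Dt (\<lambda>y. Dt f y u) y v)"
  define b where "b = (\<lambda>y. Dt (\<lambda>y. Dt f y v) y u)"
  assume "\<not> ?thesis"
  then have pos: "\<bar>a x - b x\<bar> / 2 > 0" by (simp add: a_def b_def)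
  have "continuous_on S a" "continuous_on S b"
    unfolding a_def b_def using assms(2) smooth_on_continuous smooth_on_Dt by blast+
  then have "isCont a x" "isCont b x"
    using assms continuous_on_eq_continuous_at by blast+
  then obtain d1 d2 where d: "d1 > 0" "d2 > 0"
    "\<And>y. dist y x < d1 \<Longrightarrow> dist (a y) (a x) < \<bar>a x - b x\<bar> / 2"
    "\<And>y. dist y x < d2 \<Longrightarrow> dist (b y) (b x) < \<bar>a x - b x\<bar> / 2"
    using pos unfolding continuous_at_eps_delta by metis
  obtain d3 where d3: "d3 > 0" "ball x d3 \<subseteq> S"
    using assms openE by blast
  define e where "e = min d1 (min d2 d3)"
  \<comment> \<open>The parallelogram with sides \<open>h u\<close> and \<open>h v\<close> then stays in the ball of radius \<open>e\<close>.\<close>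
  define h where "h = e / (2 * (norm u + norm v + 1))"
  have e: "e > 0" using d d3 by (simp add: e_def)
  have h: "h > 0" unfolding h_def using e by (intro divide_pos_pos) (auto intro: add_nonneg_pos)
  have near: "dist (x + s *\<^sub>R p + t *\<^sub>R q) x < e"
    if "0 \<le> s" "s \<le> h" "0 \<le> t" "t \<le> h" "norm p + norm q = norm u + norm v" for s t p q
  proof -
    have "dist (x + s *\<^sub>R p + t *\<^sub>R q) x = norm (s *\<^sub>R p + t *\<^sub>R q)"
      by (simp add: dist_norm)
    also have "\<dots> \<le> s * norm p + t * norm q"
      using norm_triangle_ineq[of "s *\<^sub>R p" "t *\<^sub>R q"] that by simp
    also have "\<dots> \<le> h * norm p + h * norm q"
      using that by (intro add_mono mult_right_mono) auto
    also have "\<dots> = h * (norm u + norm v)"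
      using that(5) by (simp flip: distrib_left)
    also have "\<dots> \<le> h * (norm u + norm v + 1)"
      using h by simp
    also have "\<dots> = e / 2"
      unfolding h_def by (simp add: add_nonneg_pos divide_simps) (smt (verit) norm_ge_zero)
    also have "\<dots> < e" using e by simp
    finally show ?thesis .
  qed
  have nS: "x + s *\<^sub>R p + t *\<^sub>R q \<in> S"
    if "0 \<le> s" "s \<le> h" "0 \<le> t" "t \<le> h" "norm p + norm q = norm u + norm v" for s t p q
    using near[OF that] d3(2) by (auto simp: e_def dist_commute)
  obtain s t where st: "0 \<le> s" "s \<le> h" "0 \<le> t" "t \<le> h"
    "f (x + h *\<^sub>R u + h *\<^sub>R v) - f (x + h *\<^sub>R u) - f (x + h *\<^sub>R v) + f x = h * h * a (x + s *\<^sub>R u + t *\<^sub>R v)"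
    using second_difference_mvt[OF assms(1,2) h, of x u v] nS unfolding a_def by auto
  obtain s' t' where st': "0 \<le> s'" "s' \<le> h" "0 \<le> t'" "t' \<le> h"
    "f (x + h *\<^sub>R v + h *\<^sub>R u) - f (x + h *\<^sub>R v) - f (x + h *\<^sub>R u) + f x = h * h * b (x + s' *\<^sub>R v + t' *\<^sub>R u)"
    using second_difference_mvt[OF assms(1,2) h, of x v u] nS[where p=v and q=u] unfolding b_def by auto
  have comm: "x + h *\<^sub>R v + h *\<^sub>R u = x + h *\<^sub>R u + h *\<^sub>R v" by (simp add: algebra_simps)
  have "h * h * a (x + s *\<^sub>R u + t *\<^sub>R v) = h * h * b (x + s' *\<^sub>R v + t' *\<^sub>R u)"
    using st(5) st'(5) unfolding comm by linarith
  then have "a (x + s *\<^sub>R u + t *\<^sub>R v) = b (x + s' *\<^sub>R v + t' *\<^sub>R u)"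
    using h by simp
  moreover have "dist (a (x + s *\<^sub>R u + t *\<^sub>R v)) (a x) < \<bar>a x - b x\<bar> / 2"
    using d(3) near[OF st(1-4), where p=u and q=v] by (simp add: e_def)
  moreover have "dist (b (x + s' *\<^sub>R v + t' *\<^sub>R u)) (b x) < \<bar>a x - b x\<bar> / 2"
    using d(4) near[OF st'(1-4), where p=v and q=u] by (simp add: e_def)
  ultimately show False
    unfolding dist_real_def by (smt (verit) field_sum_of_halves)
qed

lemma Dt_Dt_commute:
  fixes f :: "'a::euclidean_space \<Rightarrow> 'b::euclidean_space"
  assumes "open S" "smooth_on S f" "x \<in> S"
  shows "Dt (\<lambda>y. Dt f y u) x v = Dt (\<lambda>y. Dt f y v) x u"
proof (rule euclidean_eqI)
  fix b :: 'b assume "b \<in> Basis"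
  have comp: "Dt (\<lambda>y. Dt f y w) x z \<bullet> b = Dt (\<lambda>y. Dt (\<lambda>y. f y \<bullet> b) y w) x z" for w z
  proof -
    have eq: "Dt (\<lambda>y. f y \<bullet> b) y = (\<lambda>w. Dt f y w \<bullet> b)" if "y \<in> S" for y
      by (intro Dt_eqI has_derivative_inner_left smooth_on_has_derivative[OF assms(2) that])
    have "Dt (\<lambda>y. Dt (\<lambda>y. f y \<bullet> b) y w) x = Dt (\<lambda>y. Dt f y w \<bullet> b) x"
      by (rule Dt_cong[OF assms(1,3)]) (simp add: eq)
    also have "\<dots> = (\<lambda>z. Dt (\<lambda>y. Dt f y w) x z \<bullet> b)"
      by (intro Dt_eqI has_derivative_inner_left smooth_on_has_derivative[OF _ assms(3)]
          smooth_on_Dt[OF assms(2)])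
    finally show ?thesis by simp
  qed
  show "Dt (\<lambda>y. Dt f y u) x v \<bullet> b = Dt (\<lambda>y. Dt f y v) x u \<bullet> b"
    unfolding comp
    by (rule Dt_Dt_commute_real[OF assms(1) smooth_on_inner_left[OF assms(1,2)] assms(3)])
qed

text \<open>A tensor field in a chart is, slot by slot, a family of linear functionals.  Expanding them in the
  basis reduces smoothness and the product rule to scalar functions.\<close>

lemma linear_family_sum:
  fixes l :: "'e::euclidean_space \<Rightarrow> real"
  assumes "linear l"
  shows "l v = (\<Sum>b\<in>Basis. (v \<bullet> b) * l b)"
proof -
  have "l (\<Sum>b\<in>Basis. (v \<bullet> b) *\<^sub>R b) = (\<Sum>b\<in>Basis. (v \<bullet> b) *\<^sub>R l b)"
    unfolding linear_sum[OF assms] linear_scale[OF assms] ..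
  then show ?thesis unfolding euclidean_representation real_scaleR_def .
qed

lemma linear_family_Dt:
  fixes l :: "'e::euclidean_space \<Rightarrow> 'e \<Rightarrow> real"
  assumes S: "open S" and lin: "\<And>y. y \<in> S \<Longrightarrow> linear (l y)"
    and sm: "\<And>v. smooth_on S (\<lambda>y. l y v)" and x: "x \<in> S"
  shows "Dt (\<lambda>y. l y w) x u = (\<Sum>b\<in>Basis. (w \<bullet> b) * Dt (\<lambda>y. l y b) x u)"
proof -
  have "Dt (\<lambda>y. l y w) x = Dt (\<lambda>y. \<Sum>b\<in>Basis. (w \<bullet> b) * l y b) x"
    by (rule Dt_cong[OF S x]) (rule linear_family_sum[OF lin])
  also have "\<dots> = (\<lambda>u. \<Sum>b\<in>Basis. (w \<bullet> b) * Dt (\<lambda>y. l y b) x u)"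
    by (intro Dt_eqI has_derivative_sum has_derivative_mult_right smooth_on_has_derivative[OF sm x])
  finally show ?thesis by (rule fun_cong)
qed

lemma linear_family_product_rule:
  fixes l :: "'e::euclidean_space \<Rightarrow> 'e \<Rightarrow> real" and f :: "'e \<Rightarrow> 'e"
  assumes S: "open S" and lin: "\<And>y. y \<in> S \<Longrightarrow> linear (l y)"
    and sm: "\<And>v. smooth_on S (\<lambda>y. l y v)" and f: "smooth_on S f"
  shows "smooth_on S (\<lambda>y. l y (f y))"
    and "x \<in> S \<Longrightarrow> Dt (\<lambda>y. l y (f y)) x u = Dt (\<lambda>y. l y (f x)) x u + l x (Dt f x u)"
proof -
  have eq: "l y (f y) = (\<Sum>b\<in>Basis. (f y \<bullet> b) * l y b)" if "y \<in> S" for y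
    by (rule linear_family_sum[OF lin[OF that]])
  show "smooth_on S (\<lambda>y. l y (f y))"
    by (rule smooth_on_cong[OF S eq[symmetric]])
      (auto intro!: smooth_on_sum[OF S] smooth_on_mult[OF S] smooth_on_inner_left[OF S] sm f)
  assume x: "x \<in> S"
  have "Dt (\<lambda>y. l y (f y)) x = Dt (\<lambda>y. \<Sum>b\<in>Basis. (f y \<bullet> b) * l y b) x"
    by (rule Dt_cong[OF S x eq])
  also have "\<dots> = (\<lambda>u. \<Sum>b\<in>Basis. (f x \<bullet> b) * Dt (\<lambda>y. l y b) x u + (Dt f x u \<bullet> b) * l x b)"
    by (intro Dt_eqI has_derivative_sum has_derivative_mult has_derivative_inner_left
        smooth_on_has_derivative[OF f x] smooth_on_has_derivative[OF sm x])
  finally have "Dt (\<lambda>y. l y (f y)) x u = (\<Sum>b\<in>Basis. (f x \<bullet> b) * Dt (\<lambda>y. l y b) x u)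
      + (\<Sum>b\<in>Basis. (Dt f x u \<bullet> b) * l x b)"
    by (simp only: sum.distrib)
  moreover have "Dt (\<lambda>y. l y (f x)) x u = (\<Sum>b\<in>Basis. (f x \<bullet> b) * Dt (\<lambda>y. l y b) x u)"
    by (rule linear_family_Dt[OF S _ sm x]) (rule lin)
  ultimately show "Dt (\<lambda>y. l y (f y)) x u = Dt (\<lambda>y. l y (f x)) x u + l x (Dt f x u)"
    using linear_family_sum[OF lin[OF x], of "Dt f x u"] by argo
qed

section \<open>Charts\<close>

abbreviation crange :: "('m, 'e) chart \<Rightarrow> 'e set" where
  "crange c \<equiv> snd c ` fst c"

abbreviation cinv :: "('m, 'e) chart \<Rightarrow> 'e \<Rightarrow> 'm" where
  "cinv c \<equiv> inv_into (fst c) (snd c)"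

lemma chartD:
  assumes "chart c"
  shows open_fst_chart: "open (fst c)" and open_crange: "open (crange c)"
    and inj_on_chart: "inj_on (snd c) (fst c)"
    and continuous_on_chart: "continuous_on (fst c) (snd c)"
    and continuous_on_cinv: "continuous_on (crange c) (cinv c)"
proof -
  obtain g where g: "homeomorphism (fst c) (crange c) (snd c) g"
    using assms unfolding chart_def by blast
  show "open (fst c)" "open (crange c)"
    using assms unfolding chart_def by blast+
  show inj: "inj_on (snd c) (fst c)"
    using g unfolding homeomorphism_def by (metis inj_on_inverseI)
  show "continuous_on (fst c) (snd c)"
    using g unfolding homeomorphism_def by blast
  show "continuous_on (crange c) (cinv c)"
  proof (rule continuous_on_eq)
    show "continuous_on (crange c) g" using g unfolding homeomorphism_def by blast
    show "g x = cinv c x" if "x \<in> crange c" for x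
      using that g inj unfolding homeomorphism_def by (metis (no_types, lifting) f_inv_into_f inv_into_into)
  qed
qed

lemma cinv_snd: "chart c \<Longrightarrow> p \<in> fst c \<Longrightarrow> cinv c (snd c p) = p"
  by (simp add: inj_on_chart)

lemma cinv_in: "x \<in> crange c \<Longrightarrow> cinv c x \<in> fst c"
  by (rule inv_into_into)

lemma snd_cinv: "x \<in> crange c \<Longrightarrow> snd c (cinv c x) = x"
  by (rule f_inv_into_f)

lemma open_chart_image:
  assumes "chart c" "open U"
  shows "open (snd c ` (fst c \<inter> U))"
proof -
  have "snd c ` (fst c \<inter> U) = crange c \<inter> cinv c -` U"
    using cinv_snd[OF assms(1)] by (auto simp: image_iff)
  then show ?thesis
    using continuous_open_preimage[OF continuous_on_cinv open_crange assms(2)] assms(1) by simp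
qed

lemma open_chart_preimage:
  assumes "chart c" "open V"
  shows "open (fst c \<inter> snd c -` V)"
  by (rule continuous_open_preimage[OF continuous_on_chart[OF assms(1)] open_fst_chart[OF assms(1)] assms(2)])

lemma transition_apply: "chart c \<Longrightarrow> p \<in> fst c \<Longrightarrow> transition c c' (snd c p) = snd c' p"
  unfolding transition_def by (simp add: cinv_snd)

locale smooth_manifold =
  fixes A :: "('m::topological_space, 'e::euclidean_space) chart set"
  assumes smooth_structure: "smooth_structure A"
begin

lemma chart: "c \<in> A \<Longrightarrow> chart c"
  using smooth_structure unfolding smooth_structure_def by blast

lemma ex_chart: "\<exists>c\<in>A. p \<in> fst c"
  using smooth_structure unfolding smooth_structure_def by blast

lemma open_overlap: "c \<in> A \<Longrightarrow> c' \<in> A \<Longrightarrow> open (snd c ` (fst c \<inter> fst c'))"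
  by (intro open_chart_image open_fst_chart chart)

lemma smooth_transition:
  "c \<in> A \<Longrightarrow> c' \<in> A \<Longrightarrow> smooth_on (snd c ` (fst c \<inter> fst c')) (transition c c')"
  using smooth_structure unfolding smooth_structure_def smoothly_compatible_def by blast

lemma has_derivative_transition:
  assumes "c \<in> A" "c' \<in> A" "p \<in> fst c" "p \<in> fst c'"
  shows "(transition c c' has_derivative dtransition c c' p) (at (snd c p))"
  unfolding dtransition_def
  by (rule smooth_on_has_derivative[OF smooth_transition[OF assms(1,2)]]) (use assms in auto)

lemma linear_dtransition:
  "c \<in> A \<Longrightarrow> c' \<in> A \<Longrightarrow> p \<in> fst c \<Longrightarrow> p \<in> fst c' \<Longrightarrow> linear (dtransition c c' p)"
  using has_derivative_linear has_derivative_transition by blast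

lemma dtransition_cocycle:
  assumes "c \<in> A" "c' \<in> A" "c'' \<in> A" "p \<in> fst c" "p \<in> fst c'" "p \<in> fst c''"
  shows "dtransition c' c'' p (dtransition c c' p v) = dtransition c c'' p v"
proof -
  let ?S = "snd c ` (fst c \<inter> (fst c' \<inter> fst c''))"
  have S: "open ?S" "snd c p \<in> ?S"
    using assms by (auto intro!: open_chart_image open_Int open_fst_chart chart[of c] chart[of c'] chart[of c''])
  have "((\<lambda>x. transition c' c'' (transition c c' x)) has_derivative
      (\<lambda>v. dtransition c' c'' p (dtransition c c' p v))) (at (snd c p))"
    by (rule has_derivative_compose[OF has_derivative_transition])
      (use assms has_derivative_transition transition_apply[OF chart[OF assms(1)]] in auto)
  then have "(transition c c'' has_derivative
      (\<lambda>v. dtransition c' c'' p (dtransition c c' p v))) (at (snd c p))"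
    by (rule has_derivative_transform_within_open[OF _ S])
      (use assms transition_apply[OF chart[OF assms(1)], of _ c']
        transition_apply[OF chart[OF assms(1)], of _ c''] transition_apply[OF chart[OF assms(2)], of _ c''] in auto)
  from Dt_eqI[OF this] show ?thesis
    unfolding dtransition_def by metis
qed

lemma dtransition_self:
  assumes "c \<in> A" "p \<in> fst c"
  shows "dtransition c c p v = v"
proof -
  have "(transition c c has_derivative (\<lambda>v. v)) (at (snd c p))"
    by (rule has_derivative_transform_within_open[OF has_derivative_ident open_crange[OF chart]])
      (use assms transition_apply[OF chart[OF assms(1)], of _ c] in auto)
  from Dt_eqI[OF this] show ?thesis unfolding dtransition_def by simp
qed

lemma dtransition_inverse:
  "c \<in> A \<Longrightarrow> c' \<in> A \<Longrightarrow> p \<in> fst c \<Longrightarrow> p \<in> fst c' \<Longrightarrow> dtransition c' c p (dtransition c c' p v) = v"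
  by (simp add: dtransition_cocycle dtransition_self)

text \<open>New charts arise by composing a chart with a diffeomorphism between open sets of the model space:
  the result is compatible with the atlas, which is maximal.\<close>

lemma change_coordinates:
  fixes \<Phi> \<Psi> :: "'e \<Rightarrow> 'e"
  assumes c: "c \<in> A" and V: "open V" "V \<subseteq> crange c"
    and \<Phi>: "smooth_on V \<Phi>" and \<Psi>: "smooth_on (\<Phi> ` V) \<Psi>" and opn: "open (\<Phi> ` V)"
    and inv: "\<And>x. x \<in> V \<Longrightarrow> \<Psi> (\<Phi> x) = x"
  shows "(fst c \<inter> snd c -` V, \<Phi> \<circ> snd c) \<in> A"
proof -
  define U where "U = fst c \<inter> snd c -` V"
  define c1 where "c1 = (U, \<Phi> \<circ> snd c)"
  note chart_c = chart[OF c]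
  have U: "open U" unfolding U_def by (rule open_chart_preimage[OF chart_c V(1)])
  have UV: "snd c ` U = V" unfolding U_def using V(2) by auto
  then have im: "(\<Phi> \<circ> snd c) ` U = \<Phi> ` V" by (metis image_comp)
  have "homeomorphism U (\<Phi> ` V) (\<Phi> \<circ> snd c) (cinv c \<circ> \<Psi>)"
    unfolding homeomorphism_def
  proof (intro conjI ballI)
    show "(cinv c \<circ> \<Psi>) ((\<Phi> \<circ> snd c) p) = p" if "p \<in> U" for p
      using that inv cinv_snd[OF chart_c] unfolding U_def by auto
    then show "(cinv c \<circ> \<Psi>) ` \<Phi> ` V = U"
      unfolding im[symmetric] by (auto simp: image_iff)
    show "(\<Phi> \<circ> snd c) ((cinv c \<circ> \<Psi>) y) = y" if "y \<in> \<Phi> ` V" for y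
      using that inv snd_cinv[of _ c] V(2) by auto
    show "continuous_on U (\<Phi> \<circ> snd c)"
      by (rule continuous_on_compose)
        (use U_def UV smooth_on_continuous[OF \<Phi>] continuous_on_chart[OF chart_c] in
          \<open>auto intro: continuous_on_subset\<close>)
    have "\<Psi> ` \<Phi> ` V = V" using inv by (auto simp: image_iff)
    then show "continuous_on (\<Phi> ` V) (cinv c \<circ> \<Psi>)"
      by (intro continuous_on_compose smooth_on_continuous[OF \<Psi>])
        (use V(2) continuous_on_cinv[OF chart_c] in \<open>auto intro: continuous_on_subset\<close>)
  qed (use im in auto)
  then have c1: "chart c1"
    unfolding chart_def c1_def using U opn im by auto
  have compat: "smoothly_compatible c1 c'" if c': "c' \<in> A" for c'
    unfolding smoothly_compatible_def
  proof
    note chart_c' = chart[OF c']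
    let ?S = "snd c1 ` (fst c1 \<inter> fst c')" and ?S' = "snd c' ` (fst c1 \<inter> fst c')"
    have S: "open ?S" by (rule open_chart_image[OF c1 open_fst_chart[OF chart_c']])
    have S': "open ?S'"
      using open_chart_image[OF chart_c' U] by (simp add: c1_def Int_commute)
    have "smooth_on ?S (\<lambda>y. transition c c' (\<Psi> y))"
      by (rule smooth_on_compose[OF S open_overlap[OF c c'] _ smooth_transition[OF c c']
          smooth_on_subset[OF \<Psi>]]) (use inv in \<open>auto simp: c1_def U_def\<close>)
    then show "smooth_on ?S (transition c1 c')"
      by (rule smooth_on_cong[OF S, rotated])
        (use inv transition_apply[OF c1, of _ c'] transition_apply[OF chart_c, of _ c'] in
          \<open>auto simp: c1_def U_def\<close>)
    have "smooth_on ?S' (\<lambda>y. \<Phi> (transition c' c y))"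
      by (rule smooth_on_compose[OF S' V(1) _ \<Phi> smooth_on_subset[OF smooth_transition[OF c' c]]])
        (use transition_apply[OF chart_c', of _ c] in \<open>auto simp: c1_def U_def\<close>)
    then show "smooth_on ?S' (transition c' c1)"
      by (rule smooth_on_cong[OF S', rotated])
        (use transition_apply[OF chart_c', of _ c] transition_apply[OF chart_c', of _ c1] in
          \<open>auto simp: c1_def U_def\<close>)
  qed
  show ?thesis
    using smooth_structure c1 compat unfolding smooth_structure_def c1_def U_def by blast
qed

end

lemma vector_field_smooth: "vector_field A X \<Longrightarrow> c \<in> A \<Longrightarrow> smooth_on (crange c) (X c)"
  unfolding vector_field_def by blast

lemma vector_field_transition:
  "vector_field A X \<Longrightarrow> c \<in> A \<Longrightarrow> c' \<in> A \<Longrightarrow> p \<in> fst c \<Longrightarrow> p \<in> fst c' \<Longrightarrow>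
    X c' (snd c' p) = dtransition c c' p (X c (snd c p))"
  unfolding vector_field_def by blast

text \<open>An integral curve satisfies the differential equation in every chart; by the chain rule it is enough
  to check one of them.\<close>

lemma (in smooth_manifold) velocity_change_chart:
  assumes X: "vector_field A X" and cc': "c \<in> A" "c' \<in> A" "\<gamma> t \<in> fst c" "\<gamma> t \<in> fst c'"
    and cont: "isCont \<gamma> t"
    and der: "((snd c \<circ> \<gamma>) has_vector_derivative X c (snd c (\<gamma> t))) (at t)"
  shows "((snd c' \<circ> \<gamma>) has_vector_derivative X c' (snd c' (\<gamma> t))) (at t)"
proof -
  have "((\<lambda>s. transition c c' ((snd c \<circ> \<gamma>) s)) has_derivative
      (\<lambda>r. dtransition c c' (\<gamma> t) (r *\<^sub>R X c (snd c (\<gamma> t))))) (at t)"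
    by (rule has_derivative_compose[OF der[unfolded has_vector_derivative_def]])
      (use has_derivative_transition[OF cc'] in simp)
  moreover have "dtransition c c' (\<gamma> t) (r *\<^sub>R X c (snd c (\<gamma> t))) = r *\<^sub>R X c' (snd c' (\<gamma> t))" for r
    using linear_scale[OF linear_dtransition[OF cc']] vector_field_transition[OF X cc'] by simp
  ultimately have d: "((\<lambda>s. transition c c' ((snd c \<circ> \<gamma>) s)) has_derivative
      (\<lambda>r. r *\<^sub>R X c' (snd c' (\<gamma> t)))) (at t)"
    by simp
  have "\<forall>\<^sub>F s in at t. \<gamma> s \<in> fst c"
    using cont cc'(3) open_fst_chart[OF chart[OF cc'(1)]]
    by (metis isCont_def topological_tendstoD)
  then have "\<forall>\<^sub>F s in at t. transition c c' ((snd c \<circ> \<gamma>) s) = (snd c' \<circ> \<gamma>) s"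
    by eventually_elim (simp add: transition_apply[OF chart[OF cc'(1)]])
  then show ?thesis
    unfolding has_vector_derivative_def
    using has_derivative_transform_eventually[OF d, of "snd c' \<circ> \<gamma>"]
      transition_apply[OF chart[OF cc'(1)] cc'(3), of c'] by simp
qed

section \<open>Ordinary differential equations\<close>

text \<open>Picard iteration on the bounded continuous functions on the whole line.  The integral operator is
  evaluated at the time clamped to \<open>[-\<delta>, \<delta>]\<close>, which makes its values bounded.  To avoid oriented integrals,
  the integral from \<open>0\<close> to \<open>t\<close> is written as a difference of integrals from \<open>-\<delta>\<close>; their intervals have total
  length at most \<open>3 \<delta>\<close>, so the operator is a contraction with constant \<open>3 \<delta> L \<le> 1/2\<close>.\<close>

lemma ode_exists_lipschitz:
  fixes F :: "'e::euclidean_space \<Rightarrow> 'e"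
  assumes lip: "\<And>x y. norm (F x - F y) \<le> L * norm (x - y)" and \<delta>: "\<delta> > 0" "6 * \<delta> * L \<le> 1"
  shows "\<exists>u. u 0 = y \<and> (\<forall>t\<in>{-\<delta><..<\<delta>}. (u has_vector_derivative F (u t)) (at t))"
proof -
  have L: "0 \<le> L * norm (p - q)" for p q :: 'e
    using lip[of p q] norm_ge_zero order_trans by blast
  obtain b :: 'e where "b \<in> Basis" using nonempty_Basis by blast
  then have L0: "L \<ge> 0" using L[of b 0] by simp
  have contF: "continuous_on UNIV F"
  proof -
    have "L-lipschitz_on UNIV F"
      by (rule lipschitz_onI) (use lip L0 in \<open>auto simp: dist_norm\<close>)
    then show ?thesis by (rule lipschitz_on_continuous_on)
  qed
  define I where "I f t = y + (integral {-\<delta>..t} f - integral {-\<delta>..0} f)" for f and t :: real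
  have contI: "continuous_on (cbox (-\<delta>) \<delta>) (I f)" if "continuous_on UNIV f" for f
    unfolding I_def using that continuous_on_subset[OF that subset_UNIV]
    by (intro continuous_intros) (auto intro!: indefinite_integral_continuous_1 integrable_continuous_real)
  have contFu: "continuous_on S (\<lambda>t. F (apply_bcontfun u t))" for u :: "real \<Rightarrow>\<^sub>C 'e" and S
    by (rule continuous_on_compose2[OF contF]) auto
  have "\<exists>g. \<forall>t. apply_bcontfun g t = I (\<lambda>t. F (apply_bcontfun u t)) (clamp (-\<delta>) \<delta> t)" for u
    using continuous_on_cbox_bcontfunE[OF contI[OF contFu]] by metis
  then obtain T where T: "apply_bcontfun (T u) t = I (\<lambda>t. F (apply_bcontfun u t)) (clamp (-\<delta>) \<delta> t)" for u t
    by metis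
  have "dist (T u) (T v) \<le> 1/2 * dist u v" for u v
  proof (rule dist_bound)
    fix t
    define s where "s = clamp (-\<delta>) \<delta> t"
    have s: "-\<delta> \<le> s" "s \<le> \<delta>"
      using clamp_in_interval[of "-\<delta>" \<delta> t] \<delta> unfolding s_def by auto
    define d where "d = (\<lambda>t. F (apply_bcontfun u t) - F (apply_bcontfun v t))"
    have contd: "continuous_on S d" for S
      unfolding d_def by (intro continuous_intros contFu)
    have intg: "(\<lambda>t. F (apply_bcontfun w t)) integrable_on {-\<delta>..r}" for w r
      by (intro integrable_continuous_real contFu)
    have bd: "norm (integral {-\<delta>..r} d) \<le> L * dist u v * (r + \<delta>)" if "-\<delta> \<le> r" for r
    proof -
      have "norm (integral {-\<delta>..r} d) \<le> L * dist u v * Henstock_Kurzweil_Integration.content {-\<delta>..r}"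
      proof (rule has_integral_bound_real[where S = "{}"])
        show "(d has_integral integral {-\<delta>..r} d) {-\<delta>..r}"
          by (intro integrable_integral integrable_continuous_real contd)
        show "norm (d t) \<le> L * dist u v" for t
        proof -
          have "norm (d t) \<le> L * dist (apply_bcontfun u t) (apply_bcontfun v t)"
            using lip unfolding d_def dist_norm .
          also have "\<dots> \<le> L * dist u v" by (intro mult_left_mono dist_bounded L0)
          finally show ?thesis .
        qed
      qed (use L0 in auto)
      then show ?thesis using that by simp
    qed
    have "apply_bcontfun (T u) t - apply_bcontfun (T v) t = integral {-\<delta>..s} d - integral {-\<delta>..0} d"
      unfolding T I_def s_def[symmetric] d_def by (simp add: integral_diff[OF intg intg])
    then have "dist (apply_bcontfun (T u) t) (apply_bcontfun (T v) t)
        \<le> norm (integral {-\<delta>..s} d) + norm (integral {-\<delta>..0} d)"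
      unfolding dist_norm using norm_triangle_ineq4 by metis
    also have "\<dots> \<le> L * dist u v * (s + \<delta>) + L * dist u v * (0 + \<delta>)"
      using bd[of s] bd[of 0] s \<delta> by (intro add_mono) auto
    also have "\<dots> = (L * dist u v) * (s + 2 * \<delta>)" by (simp add: algebra_simps)
    also have "\<dots> \<le> (L * dist u v) * (3 * \<delta>)" using s L0 by (intro mult_left_mono) auto
    also have "\<dots> = (3 * \<delta> * L) * dist u v" by simp
    also have "\<dots> \<le> 1/2 * dist u v" using \<delta> by (intro mult_right_mono) auto
    finally show "dist (apply_bcontfun (T u) t) (apply_bcontfun (T v) t) \<le> 1/2 * dist u v" .
  qed
  then obtain u where u: "T u = u"
    using banach_fix_type[of "1/2" T] by auto
  have ut: "apply_bcontfun u t = I (\<lambda>t. F (apply_bcontfun u t)) t" if "t \<in> {-\<delta>..\<delta>}" for t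
    using T[of u t] u that by simp
  show ?thesis
  proof (intro exI conjI ballI)
    show "apply_bcontfun u 0 = y" using ut[of 0] \<delta> by (simp add: I_def)
    fix t assume t: "t \<in> {-\<delta><..<\<delta>}"
    have "((\<lambda>t. integral {-\<delta>..t} (\<lambda>t. F (apply_bcontfun u t))) has_vector_derivative F (apply_bcontfun u t))
        (at t within {-\<delta>..\<delta>})"
      by (rule integral_has_vector_derivative[OF contFu]) (use t in auto)
    then have "(I (\<lambda>t. F (apply_bcontfun u t)) has_vector_derivative F (apply_bcontfun u t)) (at t within {-\<delta>..\<delta>})"
      unfolding I_def by (auto intro!: derivative_eq_intros)
    then have "(I (\<lambda>t. F (apply_bcontfun u t)) has_vector_derivative F (apply_bcontfun u t)) (at t within {-\<delta><..<\<delta>})"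
      by (rule has_vector_derivative_within_subset) auto
    then have "(apply_bcontfun u has_vector_derivative F (apply_bcontfun u t)) (at t within {-\<delta><..<\<delta>})"
      by (rule has_vector_derivative_transform[rotated 2]) (use t ut in auto)
    then show "(apply_bcontfun u has_vector_derivative F (apply_bcontfun u t)) (at t)"
      using t at_within_open[OF t open_greaterThanLessThan] by simp
  qed
qed

lemma onorm_scaleR_const_le: "norm v \<le> B \<Longrightarrow> onorm (\<lambda>h::real. h *\<^sub>R v) \<le> B"
  by (intro onorm_le) (metis abs_ge_zero mult.commute mult_left_mono norm_scaleR real_norm_def)

text \<open>On an interval so short that \<open>\<epsilon> L \<le> 1/2\<close> the largest distance \<open>M\<close> between two solutions
  satisfies \<open>M \<le> d + \<epsilon> L M\<close> for their initial distance \<open>d\<close>, hence \<open>M \<le> 2 d\<close>.  This yields both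
  uniqueness and continuous dependence on the initial value.\<close>

lemma ode_stability:
  fixes u v :: "real \<Rightarrow> 'e::euclidean_space"
  assumes u: "\<And>t. t \<in> {-\<epsilon>..\<epsilon>} \<Longrightarrow> (u has_vector_derivative u' t) (at t)"
    and v: "\<And>t. t \<in> {-\<epsilon>..\<epsilon>} \<Longrightarrow> (v has_vector_derivative v' t) (at t)"
    and lip: "\<And>t. t \<in> {-\<epsilon>..\<epsilon>} \<Longrightarrow> norm (u' t - v' t) \<le> L * norm (u t - v t)"
    and L: "0 \<le> L" "\<epsilon> * L \<le> 1/2" and t: "t \<in> {-\<epsilon>..\<epsilon>}"
  shows "norm (u t - v t) \<le> 2 * norm (u 0 - v 0)"
proof -
  define w where "w t = u t - v t" for t
  have w: "(w has_vector_derivative u' t - v' t) (at t)" if "t \<in> {-\<epsilon>..\<epsilon>}" for t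
    unfolding w_def using u[OF that] v[OF that] by (auto intro!: derivative_eq_intros)
  have cont: "continuous_on {-\<epsilon>..\<epsilon>} (\<lambda>t. norm (w t))"
    by (intro continuous_intros continuous_at_imp_continuous_on ballI)
      (use w has_vector_derivative_continuous in blast)
  obtain s where s: "s \<in> {-\<epsilon>..\<epsilon>}" "\<And>r. r \<in> {-\<epsilon>..\<epsilon>} \<Longrightarrow> norm (w r) \<le> norm (w s)"
    using continuous_attains_sup[OF compact_Icc _ cont] t by auto
  have "norm (w s - w 0) \<le> (L * norm (w s)) * norm (s - 0)"
  proof (rule differentiable_bound)
    show "convex {-\<epsilon>..\<epsilon>}" by simp
    fix r assume r: "r \<in> {-\<epsilon>..\<epsilon>}"
    show "(w has_derivative (\<lambda>h. h *\<^sub>R (u' r - v' r))) (at r within {-\<epsilon>..\<epsilon>})"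
      using w[OF r] unfolding has_vector_derivative_def by (rule has_derivative_at_withinI)
    have "norm (u' r - v' r) \<le> L * norm (w s)"
      using lip[OF r] mult_left_mono[OF s(2)[OF r] L(1)] unfolding w_def by linarith
    then show "onorm (\<lambda>h. h *\<^sub>R (u' r - v' r)) \<le> L * norm (w s)"
      by (rule onorm_scaleR_const_le)
  qed (use s(1) in auto)
  also have "\<dots> \<le> (L * norm (w s)) * \<epsilon>"
    using s(1) L by (intro mult_left_mono) auto
  also have "\<dots> = (\<epsilon> * L) * norm (w s)" by simp
  also have "\<dots> \<le> 1/2 * norm (w s)" using L by (intro mult_right_mono) auto
  finally have "norm (w s - w 0) \<le> 1/2 * norm (w s)" .
  then have "norm (w s) \<le> 2 * norm (w 0)"
    using norm_triangle_ineq2[of "w s" "w 0"] by linarith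
  then show ?thesis using s(2)[OF t] unfolding w_def by linarith
qed

lemma smooth_on_lipschitz:
  fixes F :: "'e::euclidean_space \<Rightarrow> 'f::real_normed_vector"
  assumes "smooth_on S F" "compact K" "convex K" "K \<subseteq> S"
  obtains L where "0 \<le> L" "\<And>x y. x \<in> K \<Longrightarrow> y \<in> K \<Longrightarrow> norm (F x - F y) \<le> L * norm (x - y)"
proof -
  define B where "B x = (\<Sum>b\<in>Basis. norm (Dt F x b))" for x
  have "continuous_on K B"
    unfolding B_def
    by (intro continuous_intros continuous_on_subset[OF smooth_on_continuous assms(4)] smooth_on_Dt assms(1))
  then have "bounded (B ` K)"
    using assms(2) compact_continuous_image compact_imp_bounded by blast
  then obtain L where L: "L > 0" "\<And>x. x \<in> K \<Longrightarrow> norm (B x) \<le> L"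
    by (metis bounded_pos imageI)
  show thesis
  proof
    show "0 \<le> L" using L by simp
    fix x y assume "x \<in> K" "y \<in> K"
    then show "norm (F x - F y) \<le> L * norm (x - y)"
    proof (rule differentiable_bound[OF assms(3), rotated 2])
      fix z assume z: "z \<in> K"
      have zd: "(F has_derivative Dt F z) (at z)"
        using smooth_on_has_derivative[OF assms(1)] z assms(4) by blast
      then show "(F has_derivative Dt F z) (at z within K)"
        by (rule has_derivative_at_withinI)
      have lin: "linear (Dt F z)" using zd has_derivative_linear by blast
      have "norm (Dt F z v) \<le> B z * norm v" for v
      proof -
        have "Dt F z v = (\<Sum>b\<in>Basis. (v \<bullet> b) *\<^sub>R Dt F z b)"
          by (subst euclidean_representation[symmetric, of v])
            (simp only: linear_sum[OF lin] linear_scale[OF lin])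
        also have "norm \<dots> \<le> (\<Sum>b\<in>Basis. norm ((v \<bullet> b) *\<^sub>R Dt F z b))" by (rule norm_sum)
        also have "\<dots> \<le> (\<Sum>b\<in>Basis. norm (Dt F z b) * norm v)"
          by (intro sum_mono) (auto simp: Basis_le_norm mult.commute intro!: mult_right_mono)
        finally show ?thesis by (simp add: B_def sum_distrib_right)
      qed
      moreover have "B z \<le> L" using L(2)[OF z] by simp
      ultimately show "onorm (Dt F z) \<le> L"
        by (intro onorm_le) (meson mult_right_mono norm_ge_zero order_trans)
    qed
  qed
qed

text \<open>A field in a chart is meaningful only in the range of the chart, so a solution must be known to stay
  inside it.\<close>

definition solution_in_ball :: "('e::euclidean_space \<Rightarrow> 'e) \<Rightarrow> 'e \<Rightarrow> real \<Rightarrow> real \<Rightarrow> (real \<Rightarrow> 'e) \<Rightarrow> bool" where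
  "solution_in_ball F x r \<epsilon> u \<longleftrightarrow>
     (\<forall>t\<in>{-\<epsilon>..\<epsilon>}. u t \<in> ball x r \<and> (u has_vector_derivative F (u t)) (at t))"

lemma local_flow_box:
  fixes F :: "'e::euclidean_space \<Rightarrow> 'e"
  assumes "open S" "smooth_on S F" "x \<in> S"
  obtains r \<delta> :: real where "r > 0" "\<delta> > 0" "ball x r \<subseteq> S"
    "\<And>y. y \<in> ball x (r/2) \<Longrightarrow> \<exists>u. u 0 = y \<and> solution_in_ball F x r \<delta> u"
    "\<And>u v \<epsilon> t. \<epsilon> \<le> \<delta> \<Longrightarrow> solution_in_ball F x r \<epsilon> u \<Longrightarrow> solution_in_ball F x r \<epsilon> v \<Longrightarrow>
      t \<in> {-\<epsilon>..\<epsilon>} \<Longrightarrow> norm (u t - v t) \<le> 2 * norm (u 0 - v 0)"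
proof -
  obtain r where r: "r > 0" "cball x r \<subseteq> S"
    using assms open_contains_cball by blast
  obtain L where L: "0 \<le> L" "\<And>p q. p \<in> cball x r \<Longrightarrow> q \<in> cball x r \<Longrightarrow> norm (F p - F q) \<le> L * norm (p - q)"
    using smooth_on_lipschitz[OF assms(2) compact_cball convex_cball r(2)] by blast
  have "bounded (F ` cball x r)"
    using r(2) smooth_on_continuous[OF assms(2)] compact_cball
    by (meson compact_continuous_image compact_imp_bounded continuous_on_subset)
  then obtain B where B: "B > 0" "\<And>p. p \<in> cball x r \<Longrightarrow> norm (F p) \<le> B"
    by (metis bounded_pos imageI)
  \<comment> \<open>Composing with the 1-Lipschitz projection to the ball makes the field globally Lipschitz; its
    solutions are too slow to leave the ball within the time considered.\<close>
  define G where "G p = F (closest_point (cball x r) p)" for p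
  have cp: "closest_point (cball x r) p \<in> cball x r" for p
    by (rule closest_point_in_set) (use r in auto)
  have G: "norm (G p - G q) \<le> L * norm (p - q)" for p q
  proof -
    have "norm (G p - G q) \<le> L * norm (closest_point (cball x r) p - closest_point (cball x r) q)"
      unfolding G_def by (intro L cp)
    also have "\<dots> \<le> L * norm (p - q)"
      using closest_point_lipschitz[of "cball x r" p q] r L by (intro mult_left_mono) (auto simp: dist_norm)
    finally show ?thesis .
  qed
  define \<delta>0 where "\<delta>0 = 1 / (6 * L + 1)"
  have \<delta>0: "\<delta>0 > 0" "6 * \<delta>0 * L \<le> 1"
    using L(1) by (auto simp: \<delta>0_def divide_simps add_nonneg_pos)
  \<comment> \<open>The second bound keeps a solution with speed at most \<open>B\<close> within \<open>r/2\<close> of its initial point.\<close>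
  define \<delta> where "\<delta> = min (\<delta>0 / 2) (r / (4 * B))"
  have \<delta>: "\<delta> > 0" "\<delta> < \<delta>0" "\<delta> * B < r / 2"
    using \<delta>0 B(1) r(1) by (auto simp: \<delta>_def min_def field_simps)
  show thesis
  proof (rule that[of r \<delta>])
    fix y assume y: "y \<in> ball x (r/2)"
    obtain u where u: "u 0 = y" "\<And>t. t \<in> {-\<delta>0<..<\<delta>0} \<Longrightarrow> (u has_vector_derivative G (u t)) (at t)"
      using ode_exists_lipschitz[OF G \<delta>0] by blast
    have "u t \<in> ball x r \<and> (u has_vector_derivative F (u t)) (at t)" if t: "t \<in> {-\<delta>..\<delta>}" for t
    proof -
      have "norm (u t - u 0) \<le> B * norm (t - 0)"
      proof (rule differentiable_bound)
        show "convex {-\<delta>..\<delta>}" by simp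
        fix s assume s: "s \<in> {-\<delta>..\<delta>}"
        have "(u has_vector_derivative G (u s)) (at s)" using u(2) s \<delta> by auto
        then show "(u has_derivative (\<lambda>h. h *\<^sub>R G (u s))) (at s within {-\<delta>..\<delta>})"
          unfolding has_vector_derivative_def by (rule has_derivative_at_withinI)
        have "norm (G (u s)) \<le> B" unfolding G_def by (intro B cp)
        then show "onorm (\<lambda>h. h *\<^sub>R G (u s)) \<le> B"
          by (rule onorm_scaleR_const_le)
      qed (use t in auto)
      also have "\<dots> \<le> B * \<delta>" using t B by (intro mult_left_mono) auto
      also have "\<dots> < r / 2" using \<delta>(3) by (simp add: mult.commute)
      finally have "norm (u t - y) < r / 2" using u(1) by simp
      then have "dist x (u t) < r"
        using y dist_triangle[of x "u t" y] by (auto simp: dist_norm norm_minus_commute)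
      then have "u t \<in> ball x r" by simp
      moreover from this have "G (u t) = F (u t)"
        unfolding G_def by (subst closest_point_self) auto
      ultimately show ?thesis using u(2)[of t] t \<delta> by auto
    qed
    then show "\<exists>u. u 0 = y \<and> solution_in_ball F x r \<delta> u"
      using u(1) unfolding solution_in_ball_def by blast
  next
    fix u v :: "real \<Rightarrow> 'e" and \<epsilon> t
    assume \<epsilon>: "\<epsilon> \<le> \<delta>"
      and uv: "solution_in_ball F x r \<epsilon> u" "solution_in_ball F x r \<epsilon> v"
      and t: "t \<in> {-\<epsilon>..\<epsilon>}"
    note u = uv(1)[unfolded solution_in_ball_def] and v = uv(2)[unfolded solution_in_ball_def]
    have "\<epsilon> * L \<le> \<delta>0 * L" using \<epsilon> \<delta> L(1) by (intro mult_right_mono) auto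
    then have "\<epsilon> * L \<le> 1/2" using \<delta>0 L(1) by auto
    moreover have "norm (F (u s) - F (v s)) \<le> L * norm (u s - v s)" if "s \<in> {-\<epsilon>..\<epsilon>}" for s
      by (rule L(2)) (use u v that ball_subset_cball in blast)+
    ultimately show "norm (u t - v t) \<le> 2 * norm (u 0 - v 0)"
      using u v t L(1)
      by (intro ode_stability[where u' = "\<lambda>t. F (u t)" and v' = "\<lambda>t. F (v t)" and L = L and \<epsilon> = \<epsilon>]) auto
  qed (use r \<delta> in auto)
qed

section \<open>The flow of a vector field on a closed manifold\<close>

locale closed_manifold_field = smooth_manifold A
  for A :: "('m::{t2_space, second_countable_topology}, 'e::euclidean_space) chart set" +
  fixes X :: "('m, 'e) vfield"
  assumes compact_manifold: "compact (UNIV :: 'm set)" and field: "vector_field A X"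
begin

text \<open>The condition on an integral curve at a single time depends only on the germ of the curve there, so
  that curves defined on intervals can be glued.\<close>

definition icurve_at :: "real \<Rightarrow> (real \<Rightarrow> 'm) \<Rightarrow> bool" where
  "icurve_at t \<gamma> \<longleftrightarrow> isCont \<gamma> t \<and> (\<forall>c\<in>A. \<gamma> t \<in> fst c \<longrightarrow>
     ((snd c \<circ> \<gamma>) has_vector_derivative X c (snd c (\<gamma> t))) (at t))"

lemma integral_curve_iff: "integral_curve A X \<gamma> \<longleftrightarrow> (\<forall>t. icurve_at t \<gamma>)"
  unfolding integral_curve_def icurve_at_def by (auto simp: continuous_on_eq_continuous_at)

lemma icurve_atI:
  assumes "isCont \<gamma> t" "c \<in> A" "\<gamma> t \<in> fst c"
    "((snd c \<circ> \<gamma>) has_vector_derivative X c (snd c (\<gamma> t))) (at t)"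
  shows "icurve_at t \<gamma>"
  unfolding icurve_at_def
  using velocity_change_chart[OF field assms(2) _ assms(3) _ assms(1) assms(4)] assms(1) by blast

lemma icurve_at_cong:
  assumes "\<forall>\<^sub>F s in nhds t. \<gamma> s = \<sigma> s" "icurve_at t \<gamma>"
  shows "icurve_at t \<sigma>"
proof -
  have eq: "\<gamma> t = \<sigma> t" using assms(1) eventually_nhds_x_imp_x by force
  have "isCont \<sigma> t" using assms unfolding icurve_at_def by (metis isCont_cong)
  moreover have "((snd c \<circ> \<sigma>) has_vector_derivative X c (snd c (\<sigma> t))) (at t)"
    if "c \<in> A" "\<sigma> t \<in> fst c" for c
  proof -
    have "((snd c \<circ> \<gamma>) has_vector_derivative X c (snd c (\<sigma> t))) (at t)"
      using assms(2) that unfolding icurve_at_def eq by blast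
    moreover obtain S where "open S" "t \<in> S" "\<And>s. s \<in> S \<Longrightarrow> \<gamma> s = \<sigma> s"
      using assms(1) unfolding eventually_nhds by blast
    ultimately show ?thesis
      using has_derivative_transform_within_open[of "snd c \<circ> \<gamma>" _ t UNIV S "snd c \<circ> \<sigma>"]
      unfolding has_vector_derivative_def by simp
  qed
  ultimately show ?thesis unfolding icurve_at_def by blast
qed

lemma icurve_at_shift:
  assumes "icurve_at (t + s) \<gamma>"
  shows "icurve_at t (\<lambda>r. \<gamma> (r + s))"
proof -
  have shift: "((\<lambda>r. r + s) has_vector_derivative 1) (at t)"
    by (auto intro!: derivative_eq_intros)
  have "isCont (\<lambda>r. \<gamma> (r + s)) t"
    using assms unfolding icurve_at_def by (intro isCont_o2[of t "\<lambda>r. r + s" \<gamma>]) auto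
  moreover have "((snd c \<circ> (\<lambda>r. \<gamma> (r + s))) has_vector_derivative X c (snd c (\<gamma> (t + s)))) (at t)"
    if "c \<in> A" "\<gamma> (t + s) \<in> fst c" for c
    using vector_diff_chain_at[OF shift, of "snd c \<circ> \<gamma>" "X c (snd c (\<gamma> (t + s)))"] assms that
    unfolding icurve_at_def by (simp add: o_def)
  ultimately show ?thesis unfolding icurve_at_def by blast
qed

lemma icurve_in_chart:
  assumes c: "c \<in> A" and u: "u t \<in> crange c" "(u has_vector_derivative X c (u t)) (at t)"
  shows "icurve_at t (\<lambda>s. cinv c (u s))"
proof (rule icurve_atI[OF _ c])
  note ch = chart[OF c]
  have cu: "isCont u t" using u(2) has_vector_derivative_continuous by blast
  have "isCont (cinv c) (u t)"
    using continuous_on_cinv[OF ch] open_crange[OF ch] u(1) continuous_on_eq_continuous_at by blast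
  then show "isCont (\<lambda>s. cinv c (u s)) t" by (rule isCont_o2[OF cu])
  show "cinv c (u t) \<in> fst c" using u(1) by (rule cinv_in)
  have "\<forall>\<^sub>F s in nhds t. u s \<in> crange c"
    using cu u(1) open_crange[OF ch] unfolding isCont_def tendsto_at_iff_tendsto_nhds
    by (metis topological_tendstoD)
  then obtain S where "open S" "t \<in> S" "\<And>s. s \<in> S \<Longrightarrow> u s = (snd c \<circ> (\<lambda>s. cinv c (u s))) s"
    unfolding eventually_nhds using snd_cinv[of _ c] by auto
  then show "((snd c \<circ> (\<lambda>s. cinv c (u s))) has_vector_derivative X c (snd c (cinv c (u t)))) (at t)"
    using has_derivative_transform_within_open[of u _ t UNIV S "snd c \<circ> (\<lambda>s. cinv c (u s))"] u(2)
    unfolding has_vector_derivative_def snd_cinv[OF u(1)] by simp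
qed

lemma icurve_local_unique:
  assumes I: "open I" "t0 \<in> I" and \<gamma>: "\<And>t. t \<in> I \<Longrightarrow> icurve_at t \<gamma>"
    and \<sigma>: "\<And>t. t \<in> I \<Longrightarrow> icurve_at t \<sigma>" and eq: "\<gamma> t0 = \<sigma> t0"
  shows "\<forall>\<^sub>F t in nhds t0. \<gamma> t = \<sigma> t"
proof -
  obtain c where c: "c \<in> A" "\<gamma> t0 \<in> fst c" using ex_chart by blast
  note ch = chart[OF c(1)]
  obtain r \<delta> where r: "r > 0" "\<delta> > 0" "ball (snd c (\<gamma> t0)) r \<subseteq> crange c"
    and stab: "\<And>u v \<epsilon> t. \<epsilon> \<le> \<delta> \<Longrightarrow> solution_in_ball (X c) (snd c (\<gamma> t0)) r \<epsilon> u \<Longrightarrow>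
      solution_in_ball (X c) (snd c (\<gamma> t0)) r \<epsilon> v \<Longrightarrow> t \<in> {-\<epsilon>..\<epsilon>} \<Longrightarrow> norm (u t - v t) \<le> 2 * norm (u 0 - v 0)"
    by (rule local_flow_box[OF open_crange[OF ch] vector_field_smooth[OF field c(1)] imageI[OF c(2)]])
      (rule that)
  define W where "W = fst c \<inter> snd c -` ball (snd c (\<gamma> t0)) r"
  have W: "open W" "\<gamma> t0 \<in> W" unfolding W_def using open_chart_preimage[OF ch] c r by auto
  have "isCont \<gamma> t0" "isCont \<sigma> t0" using \<gamma>[OF I(2)] \<sigma>[OF I(2)] unfolding icurve_at_def by blast+
  then have "\<forall>\<^sub>F t in nhds t0. \<gamma> t \<in> W \<and> \<sigma> t \<in> W \<and> t \<in> I"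
    using W eq I unfolding isCont_def tendsto_at_iff_tendsto_nhds
    by (intro eventually_conj eventually_nhds_in_open topological_tendstoD[OF _ W(1)]) auto
  then obtain d where d: "d > 0" "\<And>t. dist t t0 < d \<Longrightarrow> \<gamma> t \<in> W \<and> \<sigma> t \<in> W \<and> t \<in> I"
    unfolding eventually_nhds_metric by blast
  define \<epsilon> where "\<epsilon> = min (d / 2) \<delta>"
  have \<epsilon>: "\<epsilon> > 0" "\<epsilon> \<le> \<delta>" "\<epsilon> < d" using d r by (auto simp: \<epsilon>_def)
  have coord: "solution_in_ball (X c) (snd c (\<gamma> t0)) r \<epsilon> (snd c \<circ> (\<lambda>t. \<kappa> (t + t0)))"
    if \<kappa>: "\<And>t. dist t t0 < d \<Longrightarrow> \<kappa> t \<in> W" "\<And>t. t \<in> I \<Longrightarrow> icurve_at t \<kappa>" for \<kappa>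
    unfolding solution_in_ball_def
  proof
    fix t assume "t \<in> {-\<epsilon>..\<epsilon>}"
    then have t: "dist (t + t0) t0 < d" using \<epsilon> by (auto simp: dist_real_def)
    then have "icurve_at t (\<lambda>t. \<kappa> (t + t0))"
      using \<kappa>(2) d(2) by (intro icurve_at_shift) auto
    then show "(snd c \<circ> (\<lambda>t. \<kappa> (t + t0))) t \<in> ball (snd c (\<gamma> t0)) r \<and>
      ((snd c \<circ> (\<lambda>t. \<kappa> (t + t0))) has_vector_derivative X c ((snd c \<circ> (\<lambda>t. \<kappa> (t + t0))) t)) (at t)"
      using \<kappa>(1)[OF t] c(1) unfolding icurve_at_def W_def by auto
  qed
  have "\<gamma> t = \<sigma> t" if t: "dist t t0 < \<epsilon>" for t
  proof -
    have *: "dist t t0 < d" using t \<epsilon> by simp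
    have "norm ((snd c \<circ> (\<lambda>t. \<gamma> (t + t0))) (t - t0) - (snd c \<circ> (\<lambda>t. \<sigma> (t + t0))) (t - t0))
      \<le> 2 * norm ((snd c \<circ> (\<lambda>t. \<gamma> (t + t0))) 0 - (snd c \<circ> (\<lambda>t. \<sigma> (t + t0))) 0)"
      by (rule stab[OF \<epsilon>(2) coord coord]) (use d(2) \<gamma> \<sigma> t in \<open>auto simp: dist_real_def\<close>)
    then have "snd c (\<gamma> t) = snd c (\<sigma> t)" by (simp add: eq)
    moreover have "\<gamma> t \<in> fst c" "\<sigma> t \<in> fst c" using d(2)[OF *] unfolding W_def by auto
    ultimately show ?thesis using inj_on_chart[OF ch] by (simp add: inj_on_eq_iff)
  qed
  then show ?thesis unfolding eventually_nhds_metric using \<epsilon>(1) by blast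
qed

text \<open>The set of times at which the curves agree is open by local uniqueness and closed because the
  manifold is Hausdorff.\<close>

lemma icurve_unique:
  assumes I: "open I" "connected I" "t0 \<in> I" "t \<in> I" and \<gamma>: "\<And>t. t \<in> I \<Longrightarrow> icurve_at t \<gamma>"
    and \<sigma>: "\<And>t. t \<in> I \<Longrightarrow> icurve_at t \<sigma>" and eq: "\<gamma> t0 = \<sigma> t0"
  shows "\<gamma> t = \<sigma> t"
proof -
  define E where "E = interior {t. \<gamma> t = \<sigma> t}"
  define N where "N = interior {t. \<gamma> t \<noteq> \<sigma> t}"
  have int: "s \<in> interior {t. P t}" if "\<forall>\<^sub>F t in nhds s. P t" for s :: real and P
    using that unfolding eventually_nhds interior_def by auto
  have inE: "s \<in> E" if "s \<in> I" "\<gamma> s = \<sigma> s" for s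
    unfolding E_def by (rule int, rule icurve_local_unique[OF I(1) that(1)]) (use \<gamma> \<sigma> that in auto)
  have inN: "s \<in> N" if s: "s \<in> I" "\<gamma> s \<noteq> \<sigma> s" for s
    unfolding N_def
  proof (rule int)
    obtain U V where UV: "open U" "open V" "\<gamma> s \<in> U" "\<sigma> s \<in> V" "U \<inter> V = {}"
      using hausdorff[OF s(2)] by blast
    have "isCont \<gamma> s" "isCont \<sigma> s" using \<gamma>[OF s(1)] \<sigma>[OF s(1)] unfolding icurve_at_def by blast+
    then have "\<forall>\<^sub>F t in nhds s. \<gamma> t \<in> U" "\<forall>\<^sub>F t in nhds s. \<sigma> t \<in> V"
      unfolding isCont_def tendsto_at_iff_tendsto_nhds
      using UV by (auto intro: topological_tendstoD)
    then show "\<forall>\<^sub>F t in nhds s. \<gamma> t \<noteq> \<sigma> t"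
      by eventually_elim (use UV(5) in auto)
  qed
  have "E \<inter> I = {} \<or> N \<inter> I = {}"
  proof (rule connectedD[OF I(2)])
    show "open E" "open N" unfolding E_def N_def by auto
    show "E \<inter> N \<inter> I = {}"
      using interior_subset[of "{t. \<gamma> t = \<sigma> t}"] interior_subset[of "{t. \<gamma> t \<noteq> \<sigma> t}"]
      unfolding E_def N_def by blast
    show "I \<subseteq> E \<union> N" using inE inN by blast
  qed
  then have "N \<inter> I = {}" using inE[OF I(3) eq] I(3) by blast
  then show ?thesis using inN[OF I(4)] I(4) by blast
qed

lemma icurve_glue:
  assumes I: "open I" and J: "open J" and conn: "connected (I \<inter> J)" and t0: "t0 \<in> I \<inter> J"
    and \<gamma>: "\<And>t. t \<in> I \<Longrightarrow> icurve_at t \<gamma>" and \<sigma>: "\<And>t. t \<in> J \<Longrightarrow> icurve_at t \<sigma>"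
    and eq: "\<gamma> t0 = \<sigma> t0" and t: "t \<in> I \<union> J"
  shows "icurve_at t (\<lambda>t. if t \<in> I then \<gamma> t else \<sigma> t)"
proof (cases "t \<in> I")
  case True
  have "\<forall>\<^sub>F s in nhds t. \<gamma> s = (if s \<in> I then \<gamma> s else \<sigma> s)"
    using eventually_nhds_in_open[OF I True] by eventually_elim simp
  then show ?thesis by (rule icurve_at_cong) (rule \<gamma>[OF True])
next
  case False
  then have tJ: "t \<in> J" using t by blast
  have "\<forall>\<^sub>F s in nhds t. \<sigma> s = (if s \<in> I then \<gamma> s else \<sigma> s)"
    using eventually_nhds_in_open[OF J tJ]
  proof eventually_elim
    case (elim s)
    then show ?case
      using icurve_unique[OF open_Int[OF I J] conn t0, of s \<gamma> \<sigma>] \<gamma> \<sigma> eq by auto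
  qed
  then show ?thesis by (rule icurve_at_cong) (rule \<sigma>[OF tJ])
qed

text \<open>The flow is not yet available as a function, so continuous dependence is expressed by comparing two
  integral curves.\<close>

lemma local_flow_box_chart:
  assumes c: "c \<in> A" "p \<in> fst c"
  obtains V \<delta> where "open V" "p \<in> V" "V \<subseteq> fst c" "\<delta> > 0"
    "\<And>q. q \<in> V \<Longrightarrow> \<exists>\<gamma>. \<gamma> 0 = q \<and> (\<forall>t\<in>{-\<delta>..\<delta>}. icurve_at t \<gamma> \<and> \<gamma> t \<in> fst c)"
    "\<And>q q' t \<gamma> \<sigma>. q \<in> V \<Longrightarrow> q' \<in> V \<Longrightarrow> \<gamma> 0 = q \<Longrightarrow> \<sigma> 0 = q' \<Longrightarrow> \<forall>t\<in>{-\<delta>..\<delta>}. icurve_at t \<gamma> \<Longrightarrow>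
      \<forall>t\<in>{-\<delta>..\<delta>}. icurve_at t \<sigma> \<Longrightarrow> \<bar>t\<bar> < \<delta> \<Longrightarrow> norm (snd c (\<gamma> t) - snd c (\<sigma> t)) \<le> 2 * norm (snd c q - snd c q')"
proof -
  note ch = chart[OF c(1)]
  obtain r \<delta> where r: "r > 0" "\<delta> > 0" "ball (snd c p) r \<subseteq> crange c"
    and ex: "\<And>y. y \<in> ball (snd c p) (r/2) \<Longrightarrow> \<exists>u. u 0 = y \<and> solution_in_ball (X c) (snd c p) r \<delta> u"
    and stab: "\<And>u v \<epsilon> t. \<epsilon> \<le> \<delta> \<Longrightarrow> solution_in_ball (X c) (snd c p) r \<epsilon> u \<Longrightarrow>
      solution_in_ball (X c) (snd c p) r \<epsilon> v \<Longrightarrow> t \<in> {-\<epsilon>..\<epsilon>} \<Longrightarrow> norm (u t - v t) \<le> 2 * norm (u 0 - v 0)"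
    by (rule local_flow_box[OF open_crange[OF ch] vector_field_smooth[OF field c(1)] imageI[OF c(2)]])
      (rule that)
  define V where "V = fst c \<inter> snd c -` ball (snd c p) (r/2)"
  have V: "open V" "p \<in> V" "V \<subseteq> fst c"
    unfolding V_def using open_chart_preimage[OF ch] c r by auto
  have cur: "icurve_at t (\<lambda>s. cinv c (u s))" "cinv c (u t) \<in> fst c" "u t \<in> crange c"
    if "solution_in_ball (X c) (snd c p) r \<delta> u" "t \<in> {-\<delta>..\<delta>}" for u t
    using that r(3) unfolding solution_in_ball_def by (blast intro: icurve_in_chart[OF c(1)] cinv_in)+
  have ex': "\<exists>u. cinv c (u 0) = q \<and> u 0 = snd c q \<and> solution_in_ball (X c) (snd c p) r \<delta> u"
    if q: "q \<in> V" for q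
  proof -
    have "snd c q \<in> ball (snd c p) (r/2)" using q by (auto simp: V_def)
    then show ?thesis using ex[of "snd c q"] cinv_snd[OF ch, of q] q V(3) by (metis subsetD)
  qed
  show thesis
  proof (rule that[OF V r(2)])
    show "\<exists>\<gamma>. \<gamma> 0 = q \<and> (\<forall>t\<in>{-\<delta>..\<delta>}. icurve_at t \<gamma> \<and> \<gamma> t \<in> fst c)" if q: "q \<in> V" for q
    proof -
      obtain u where "cinv c (u 0) = q" "solution_in_ball (X c) (snd c p) r \<delta> u"
        using ex'[OF q] by blast
      then show ?thesis
        using cur[of u] by (intro exI[of _ "\<lambda>s. cinv c (u s)"]) simp
    qed
  next
    fix q q' t \<gamma> \<sigma>
    assume q: "q \<in> V" "q' \<in> V" "\<gamma> 0 = q" "\<sigma> 0 = q'"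
      and \<gamma>: "\<forall>t\<in>{-\<delta>..\<delta>}. icurve_at t \<gamma>" and \<sigma>: "\<forall>t\<in>{-\<delta>..\<delta>}. icurve_at t \<sigma>" and t: "\<bar>t\<bar> < \<delta>"
    obtain u where u: "cinv c (u 0) = q" "u 0 = snd c q" "solution_in_ball (X c) (snd c p) r \<delta> u"
      using ex'[OF q(1)] by blast
    obtain v where v: "cinv c (v 0) = q'" "v 0 = snd c q'" "solution_in_ball (X c) (snd c p) r \<delta> v"
      using ex'[OF q(2)] by blast
    have eqs: "\<kappa> t = cinv c (w t)"
      if "\<forall>t\<in>{-\<delta>..\<delta>}. icurve_at t \<kappa>" "\<kappa> 0 = cinv c (w 0)" "solution_in_ball (X c) (snd c p) r \<delta> w" for \<kappa> w
      by (rule icurve_unique[of "{-\<delta><..<\<delta>}" 0 t \<kappa> "\<lambda>s. cinv c (w s)"])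
        (use that cur[of w] t r in auto)
    have tt: "t \<in> {-\<delta>..\<delta>}" using t by auto
    have "snd c (\<gamma> t) = u t" "snd c (\<sigma> t) = v t"
      using eqs[OF \<gamma> _ u(3)] eqs[OF \<sigma> _ v(3)] u v q cur(3)[OF u(3) tt] cur(3)[OF v(3) tt] snd_cinv[of "u t" c] snd_cinv[of "v t" c]
      by simp_all
    then show "norm (snd c (\<gamma> t) - snd c (\<sigma> t)) \<le> 2 * norm (snd c q - snd c q')"
      using stab[OF order_refl u(3) v(3) tt] u(2) v(2) by simp
  qed
qed

text \<open>The minimum over a finite subcover.  This gives the common existence time of all integral curves, and
  the common time during which the flow preserves a foliation.\<close>

lemma uniform_on_manifold:
  fixes P :: "'m \<Rightarrow> real \<Rightarrow> bool"
  assumes local: "\<And>p. \<exists>V \<delta>. open V \<and> p \<in> V \<and> \<delta> > 0 \<and> (\<forall>q\<in>V. P q \<delta>)"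
    and mono: "\<And>q \<delta> \<delta>'. P q \<delta> \<Longrightarrow> \<delta>' \<le> \<delta> \<Longrightarrow> P q \<delta>'"
  obtains \<delta> where "\<delta> > 0" "\<And>q. P q \<delta>"
proof -
  obtain V \<delta> where V: "\<And>p. open (V p)" "\<And>p. p \<in> V p" and \<delta>: "\<And>p. \<delta> p > 0"
    and P: "\<And>p q. q \<in> V p \<Longrightarrow> P q (\<delta> p)"
    using local by metis
  obtain F where F: "finite F" "(\<Union>p\<in>F. V p) = UNIV"
    using compactE_image[OF compact_manifold, of UNIV V] V by (metis UNIV_I UN_iff subsetI top.extremum_unique)
  then have "F \<noteq> {}" by auto
  show thesis
  proof (rule that[of "Min (\<delta> ` F)"])
    show "Min (\<delta> ` F) > 0" using F \<open>F \<noteq> {}\<close> \<delta> by simp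
    fix q
    obtain p where p: "p \<in> F" "q \<in> V p" using F(2) by blast
    show "P q (Min (\<delta> ` F))"
      by (rule mono[OF P[OF p(2)]]) (use F p(1) in simp)
  qed
qed

lemma uniform_existence_time:
  obtains \<delta> where "\<delta> > 0" "\<And>p. \<exists>\<gamma>. \<gamma> 0 = p \<and> (\<forall>t\<in>{-\<delta>..\<delta>}. icurve_at t \<gamma>)"
proof (rule uniform_on_manifold[of "\<lambda>p \<delta>. \<exists>\<gamma>. \<gamma> 0 = p \<and> (\<forall>t\<in>{-\<delta>..\<delta>}. icurve_at t \<gamma>)"])
  fix p
  obtain c where c: "c \<in> A" "p \<in> fst c" using ex_chart by blast
  then show "\<exists>V \<delta>. open V \<and> p \<in> V \<and> \<delta> > 0 \<and> (\<forall>q\<in>V. \<exists>\<gamma>. \<gamma> 0 = q \<and> (\<forall>t\<in>{-\<delta>..\<delta>}. icurve_at t \<gamma>))"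
    by (rule local_flow_box_chart) blast
next
  show "\<exists>\<gamma>. \<gamma> 0 = q \<and> (\<forall>t\<in>{-\<delta>'..\<delta>'}. icurve_at t \<gamma>)"
    if "\<exists>\<gamma>. \<gamma> 0 = q \<and> (\<forall>t\<in>{-\<delta>..\<delta>}. icurve_at t \<gamma>)" "\<delta>' \<le> \<delta>" for q and \<delta> \<delta>' :: real
    using that by (metis atLeastAtMost_iff neg_le_iff_le order_trans)
qed (rule that)

text \<open>The curve is prolonged at both ends by the curves that start half way to the ends, at the times
  \<open>a/2\<close> and \<open>-a/2\<close>.\<close>

lemma existence_time_extend:
  assumes ex: "\<And>p. \<exists>\<gamma>. \<gamma> 0 = p \<and> (\<forall>t\<in>{-a<..<a}. icurve_at t \<gamma>)" and a: "a > 0"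
  shows "\<exists>\<gamma>. \<gamma> 0 = p \<and> (\<forall>t\<in>{-(3/2*a)<..<3/2*a}. icurve_at t \<gamma>)"
proof -
  obtain \<gamma> where \<gamma>: "\<gamma> 0 = p" "\<And>t. t \<in> {-a<..<a} \<Longrightarrow> icurve_at t \<gamma>" using ex by blast
  obtain \<sigma> where \<sigma>: "\<sigma> 0 = \<gamma> (a/2)" "\<And>t. t \<in> {-a<..<a} \<Longrightarrow> icurve_at t \<sigma>" using ex by blast
  obtain \<tau> where \<tau>: "\<tau> 0 = \<gamma> (-a/2)" "\<And>t. t \<in> {-a<..<a} \<Longrightarrow> icurve_at t \<tau>" using ex by blast
  have \<sigma>': "icurve_at t (\<lambda>t. \<sigma> (t + -a/2))" if "t \<in> {-a/2<..<3/2*a}" for t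
    by (rule icurve_at_shift, rule \<sigma>(2)) (use that in auto)
  have \<tau>': "icurve_at t (\<lambda>t. \<tau> (t + a/2))" if "t \<in> {-(3/2*a)<..<a/2}" for t
    by (rule icurve_at_shift, rule \<tau>(2)) (use that in auto)
  define \<mu> where "\<mu> t = (if t \<in> {-a<..<a} then \<gamma> t else \<sigma> (t + -a/2))" for t
  have \<mu>: "icurve_at t \<mu>" if "t \<in> {-a<..<3/2*a}" for t
    unfolding \<mu>_def
    by (rule icurve_glue[where J = "{-a/2<..<3/2*a}" and ?t0.0 = "a/2"])
      (use \<gamma> \<sigma>(1) \<sigma>' a that in \<open>auto simp: convex_connected convex_Int\<close>)
  have \<mu>0: "\<mu> (-a/2) = \<gamma> (-a/2)" using a by (simp add: \<mu>_def)
  define \<nu> where "\<nu> t = (if t \<in> {-a<..<3/2*a} then \<mu> t else \<tau> (t + a/2))" for t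
  have "icurve_at t \<nu>" if "t \<in> {-(3/2*a)<..<3/2*a}" for t
    unfolding \<nu>_def
    by (rule icurve_glue[where J = "{-(3/2*a)<..<a/2}" and ?t0.0 = "-a/2"])
      (use \<mu> \<mu>0 \<tau>(1) \<tau>' a that in \<open>auto simp: convex_connected convex_Int\<close>)
  moreover have "\<nu> 0 = p" using a \<gamma>(1) by (simp add: \<nu>_def \<mu>_def)
  ultimately show ?thesis by blast
qed

lemma integral_curve_exists: "\<exists>\<gamma>. integral_curve A X \<gamma> \<and> \<gamma> 0 = p"
proof -
  obtain \<delta> where \<delta>: "\<delta> > 0" "\<And>p. \<exists>\<gamma>. \<gamma> 0 = p \<and> (\<forall>t\<in>{-\<delta>..\<delta>}. icurve_at t \<gamma>)"
    using uniform_existence_time by blast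
  \<comment> \<open>Each prolongation multiplies the existence time by \<open>3/2\<close>.\<close>
  define a where "a n = (3/2) ^ n * \<delta>" for n :: nat
  have a: "a n > 0" for n using \<delta> by (simp add: a_def)
  have ex: "\<exists>\<gamma>. \<gamma> 0 = q \<and> (\<forall>t\<in>{-a n<..<a n}. icurve_at t \<gamma>)" for n q
  proof (induction n arbitrary: q)
    case 0
    show ?case using \<delta>(2)[of q] unfolding a_def by (metis greaterThanLessThan_subseteq_atLeastAtMost_iff
          mult_1 order_refl power_0 subsetD)
  next
    case (Suc n)
    show ?case using existence_time_extend[OF Suc.IH a, of q] by (simp add: a_def mult.assoc)
  qed
  then obtain g where g: "\<And>n. g n 0 = p" "\<And>n t. t \<in> {-a n<..<a n} \<Longrightarrow> icurve_at t (g n)" by metis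
  have big: "\<exists>n. \<bar>t\<bar> < a n" for t
  proof -
    obtain n where "\<bar>t\<bar> / \<delta> < (3/2) ^ n" using real_arch_pow[of "3/2" "\<bar>t\<bar> / \<delta>"] by auto
    then show ?thesis using \<delta> by (auto simp: a_def divide_less_eq)
  qed
  define \<gamma> where "\<gamma> t = g (LEAST n. \<bar>t\<bar> < a n) t" for t
  have \<gamma>: "\<gamma> t = g n t" if "\<bar>t\<bar> < a n" for n t
  proof -
    define m where "m = (LEAST n. \<bar>t\<bar> < a n)"
    have m: "\<bar>t\<bar> < a m" unfolding m_def by (rule LeastI[of _ n]) (rule that)
    have "g m t = g n t"
      by (rule icurve_unique[of "{- min (a m) (a n)<..<min (a m) (a n)}" 0])
        (use a that m g in \<open>auto\<close>)
    then show ?thesis by (simp add: \<gamma>_def m_def)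
  qed
  have "icurve_at t \<gamma>" for t
  proof -
    obtain n where n: "\<bar>t\<bar> < a n" using big by blast
    then have t: "t \<in> {-a n<..<a n}" by auto
    have "\<forall>\<^sub>F s in nhds t. g n s = \<gamma> s"
      using eventually_nhds_in_open[OF open_greaterThanLessThan t] by eventually_elim (rule \<gamma>[symmetric], auto)
    then show ?thesis by (rule icurve_at_cong) (rule g(2)[OF t])
  qed
  moreover have "\<gamma> 0 = p" using \<gamma>[of 0 0] a[of 0] g(1) by simp
  ultimately show ?thesis unfolding integral_curve_iff by blast
qed

lemma flow_eqI:
  assumes "integral_curve A X \<gamma>" "\<gamma> 0 = p"
  shows "flow A X t p = \<gamma> t"
  unfolding flow_def
proof (rule the_equality)
  show "\<exists>\<sigma>. integral_curve A X \<sigma> \<and> \<sigma> 0 = p \<and> \<sigma> t = \<gamma> t" using assms by blast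
  show "q = \<gamma> t" if "\<exists>\<sigma>. integral_curve A X \<sigma> \<and> \<sigma> 0 = p \<and> \<sigma> t = q" for q
  proof -
    from that obtain \<sigma> where \<sigma>: "integral_curve A X \<sigma>" "\<sigma> 0 = p" "\<sigma> t = q" by blast
    have "\<sigma> t = \<gamma> t"
      by (rule icurve_unique[of UNIV 0]) (use \<sigma> assms in \<open>auto simp: integral_curve_iff\<close>)
    then show ?thesis using \<sigma>(3) by simp
  qed
qed

lemma flow_curve: "integral_curve A X (\<lambda>t. flow A X t p)" and flow_0: "flow A X 0 p = p"
proof -
  obtain \<gamma> where \<gamma>: "integral_curve A X \<gamma>" "\<gamma> 0 = p" using integral_curve_exists by blast
  have "(\<lambda>t. flow A X t p) = \<gamma>" using flow_eqI[OF \<gamma>] by blast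
  then show "integral_curve A X (\<lambda>t. flow A X t p)" "flow A X 0 p = p" using \<gamma> by (auto dest: fun_cong)
qed

lemma flow_add: "flow A X (s + t) p = flow A X s (flow A X t p)"
proof -
  have "integral_curve A X (\<lambda>s. flow A X (s + t) p)"
    using flow_curve[of p] icurve_at_shift[of _ t "\<lambda>t. flow A X t p"] unfolding integral_curve_iff by blast
  from flow_eqI[OF this, of "flow A X t p" s] show ?thesis by simp
qed

lemma flow_velocity:
  assumes "c \<in> A" "flow A X t p \<in> fst c"
  shows "((\<lambda>s. snd c (flow A X s p)) has_vector_derivative X c (snd c (flow A X t p))) (at t)"
  using flow_curve[of p] assms unfolding integral_curve_def o_def by blast

lemma flow_box:
  assumes c: "c \<in> A" "p \<in> fst c"
  obtains V \<delta> where "open V" "p \<in> V" "V \<subseteq> fst c" "\<delta> > 0"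
    "\<And>q t. q \<in> V \<Longrightarrow> \<bar>t\<bar> < \<delta> \<Longrightarrow> flow A X t q \<in> fst c"
    "\<And>t. \<bar>t\<bar> < \<delta> \<Longrightarrow> continuous_on V (flow A X t)"
proof -
  note ch = chart[OF c(1)]
  obtain V \<delta> where V: "open V" "p \<in> V" "V \<subseteq> fst c" "\<delta> > 0"
    and ex: "\<And>q. q \<in> V \<Longrightarrow> \<exists>\<gamma>. \<gamma> 0 = q \<and> (\<forall>t\<in>{-\<delta>..\<delta>}. icurve_at t \<gamma> \<and> \<gamma> t \<in> fst c)"
    and stab: "\<And>q q' t \<gamma> \<sigma>. q \<in> V \<Longrightarrow> q' \<in> V \<Longrightarrow> \<gamma> 0 = q \<Longrightarrow> \<sigma> 0 = q' \<Longrightarrow>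
      \<forall>t\<in>{-\<delta>..\<delta>}. icurve_at t \<gamma> \<Longrightarrow> \<forall>t\<in>{-\<delta>..\<delta>}. icurve_at t \<sigma> \<Longrightarrow> \<bar>t\<bar> < \<delta> \<Longrightarrow>
      norm (snd c (\<gamma> t) - snd c (\<sigma> t)) \<le> 2 * norm (snd c q - snd c q')"
    by (rule local_flow_box_chart[OF c]) (rule that)
  have cur: "icurve_at t (\<lambda>t. flow A X t q)" for q t
    using flow_curve unfolding integral_curve_iff by blast
  have fc: "flow A X t q \<in> fst c" if q: "q \<in> V" and t: "\<bar>t\<bar> < \<delta>" for q t
  proof -
    obtain \<gamma> where \<gamma>: "\<gamma> 0 = q" "\<forall>t\<in>{-\<delta>..\<delta>}. icurve_at t \<gamma> \<and> \<gamma> t \<in> fst c" using ex[OF q] by blast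
    have "flow A X t q = \<gamma> t"
      by (rule icurve_unique[of "{-\<delta><..<\<delta>}" 0 _ "\<lambda>t. flow A X t q"])
        (use t \<gamma> cur flow_0 V(4) in auto)
    moreover have "\<gamma> t \<in> fst c" using \<gamma>(2)[rule_format, of t] t by (simp add: abs_less_iff)
    ultimately show ?thesis by simp
  qed
  show thesis
  proof (rule that[OF V fc])
    fix t assume t: "\<bar>t\<bar> < \<delta>"
    have lip: "norm (snd c (flow A X t q) - snd c (flow A X t q')) \<le> 2 * norm (snd c q - snd c q')"
      if "q \<in> V" "q' \<in> V" for q q'
      by (rule stab[OF that, of "\<lambda>t. flow A X t q" "\<lambda>t. flow A X t q'"]) (use cur flow_0 t in auto)
    have "continuous_on V (\<lambda>q. snd c (flow A X t q))"
      unfolding continuous_on_def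
    proof
      fix q assume q: "q \<in> V"
      have "((\<lambda>q'. 2 * norm (snd c q' - snd c q)) \<longlongrightarrow> 2 * norm (snd c q - snd c q)) (at q within V)"
        using continuous_on_subset[OF continuous_on_chart[OF ch] V(3)] q
        unfolding continuous_on_def by (intro tendsto_intros) auto
      then have lim: "((\<lambda>q'. 2 * norm (snd c q' - snd c q)) \<longlongrightarrow> 0) (at q within V)" by simp
      have ev: "\<forall>\<^sub>F q' in at q within V. norm (snd c (flow A X t q') - snd c (flow A X t q)) \<le> 2 * norm (snd c q' - snd c q)"
        unfolding eventually_at_topological using lip q by blast
      have "((\<lambda>q'. snd c (flow A X t q') - snd c (flow A X t q)) \<longlongrightarrow> 0) (at q within V)"
        by (rule Lim_null_comparison[OF ev lim])
      then show "((\<lambda>q'. snd c (flow A X t q')) \<longlongrightarrow> snd c (flow A X t q)) (at q within V)"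
        by (rule LIM_zero_cancel)
    qed
    then have "continuous_on V (\<lambda>q. cinv c (snd c (flow A X t q)))"
      by (rule continuous_on_compose2[OF continuous_on_cinv[OF ch]]) (use fc t in auto)
    then show "continuous_on V (flow A X t)"
      by (rule continuous_on_eq) (use fc t cinv_snd[OF ch] in auto)
  qed
qed

end

section \<open>Exterior derivatives of 1-forms\<close>

lemma length_2D: "length vs = 2 \<Longrightarrow> \<exists>u v. vs = [u, v]"
  by (auto simp: length_Suc_conv numeral_2_eq_2)

lemma diff_form_1_linear:
  assumes "diff_form A 1 \<alpha>" "c \<in> A" "x \<in> crange c"
  shows "linear (\<lambda>v. \<alpha> c x [v])"
proof -
  have "\<forall>c\<in>A. \<forall>x\<in>crange c. \<forall>vs i. length vs = 1 \<and> i < 1 \<longrightarrow> linear (\<lambda>v. \<alpha> c x (vs[i := v]))"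
    using assms(1) unfolding diff_form_def tensor_field_def by blast
  from this[rule_format, OF assms(2,3), of "[0]" 0] show ?thesis by simp
qed

lemma diff_form_1_smooth:
  assumes "diff_form A 1 \<alpha>" "c \<in> A"
  shows "smooth_on (crange c) (\<lambda>x. \<alpha> c x [v])"
proof -
  have "\<forall>c\<in>A. \<forall>vs. length vs = 1 \<longrightarrow> smooth_on (crange c) (\<lambda>x. \<alpha> c x vs)"
    using assms(1) unfolding diff_form_def tensor_field_def by blast
  from this[rule_format, OF assms(2), of "[v]"] show ?thesis by simp
qed

lemma diff_form_1_transition:
  assumes "diff_form A 1 \<alpha>" "c \<in> A" "c' \<in> A" "p \<in> fst c" "p \<in> fst c'"
  shows "\<alpha> c (snd c p) [v] = \<alpha> c' (snd c' p) [dtransition c c' p v]"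
proof -
  have "\<forall>c\<in>A. \<forall>c'\<in>A. \<forall>p\<in>fst c \<inter> fst c'. \<forall>vs. length vs = 1 \<longrightarrow>
      \<alpha> c (snd c p) vs = \<alpha> c' (snd c' p) (map (dtransition c c' p) vs)"
    using assms(1) unfolding diff_form_def tensor_field_def by blast
  from this[rule_format, OF assms(2,3) IntI[OF assms(4,5)], of "[v]"] show ?thesis by simp
qed

lemma diff_form_1_length: "diff_form A 1 \<alpha> \<Longrightarrow> length vs \<noteq> 1 \<Longrightarrow> \<alpha> c x vs = 0"
  unfolding diff_form_def tensor_field_def by blast

lemma diff_form_outside: "diff_form A k \<alpha> \<Longrightarrow> c \<notin> A \<or> x \<notin> crange c \<Longrightarrow> \<alpha> c x vs = 0"
  unfolding diff_form_def tensor_field_def by blast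

text \<open>Forms must vanish at meaningless arguments; this constructor takes care of it.\<close>

definition one_form :: "('m, 'e::euclidean_space) chart set \<Rightarrow> (('m, 'e) chart \<Rightarrow> 'e \<Rightarrow> 'e \<Rightarrow> real) \<Rightarrow> ('m, 'e) tensor" where
  "one_form A a = (\<lambda>c x vs. if c \<in> A \<and> x \<in> crange c \<and> length vs = 1 then a c x (hd vs) else 0)"

lemma one_form_apply: "c \<in> A \<Longrightarrow> x \<in> crange c \<Longrightarrow> one_form A a c x [v] = a c x v"
  by (simp add: one_form_def)

text \<open>The value of \<open>d\<alpha>\<close> on two constant vectors, without the lists.\<close>

definition curl :: "('m, 'e::euclidean_space) tensor \<Rightarrow> ('m, 'e) chart \<Rightarrow> 'e \<Rightarrow> 'e \<Rightarrow> 'e \<Rightarrow> real" where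
  "curl \<alpha> c x u v = Dt (\<lambda>y. \<alpha> c y [v]) x u - Dt (\<lambda>y. \<alpha> c y [u]) x v"

lemma ext_deriv_pair: "x \<in> crange c \<Longrightarrow> ext_deriv \<alpha> c x [u, v] = curl \<alpha> c x u v"
  by (simp add: ext_deriv_def curl_def numeral_2_eq_2)

lemma ext_deriv_zero_degree:
  assumes "\<And>c x vs. length vs \<noteq> k \<Longrightarrow> \<omega> c x vs = 0" "length vs \<noteq> Suc k"
  shows "ext_deriv \<omega> c x vs = 0"
proof -
  have "\<omega> c y (take i vs @ drop (Suc i) vs) = 0" if "i < length vs" for i y
    using assms that by auto
  then show ?thesis by (simp add: ext_deriv_def)
qed

lemma ext_deriv_zero_outside:
  assumes "\<And>x vs. \<omega> c x vs = 0"
  shows "ext_deriv \<omega> c x vs = 0"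
  using assms by (simp add: ext_deriv_def)

lemma ext_deriv_1_degree: "diff_form A 1 \<alpha> \<Longrightarrow> length vs \<noteq> 2 \<Longrightarrow> ext_deriv \<alpha> c x vs = 0"
  by (rule ext_deriv_zero_degree[OF diff_form_1_length]) auto

lemma ext_deriv_outside: "diff_form A k \<alpha> \<Longrightarrow> c \<notin> A \<or> x \<notin> crange c \<Longrightarrow> ext_deriv \<alpha> c x vs = 0"
  using ext_deriv_zero_outside[of \<alpha> c x vs] diff_form_outside[of A k \<alpha> c]
  by (cases "x \<in> crange c") (auto simp: ext_deriv_def)

lemma ext_deriv_1_eq_0_iff:
  assumes "diff_form A 1 \<alpha>"
  shows "ext_deriv \<alpha> = 0 \<longleftrightarrow> (\<forall>c\<in>A. \<forall>x\<in>crange c. \<forall>u v. curl \<alpha> c x u v = 0)"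
proof
  show "ext_deriv \<alpha> = 0" if *: "\<forall>c\<in>A. \<forall>x\<in>crange c. \<forall>u v. curl \<alpha> c x u v = 0"
  proof (intro ext)
    fix c x vs
    show "ext_deriv \<alpha> c x vs = 0 c x vs"
    proof (cases "c \<in> A \<and> x \<in> crange c \<and> length vs = 2")
      case True
      then show ?thesis using * by (auto dest!: length_2D simp: ext_deriv_pair)
    next
      case False
      then show ?thesis using ext_deriv_1_degree[OF assms, of vs c x] ext_deriv_outside[OF assms, of c x vs] by auto
    qed
  qed
qed (auto simp: ext_deriv_pair[symmetric])

lemma int_prod_ext_deriv_eq_0_iff:
  assumes "diff_form A 1 \<alpha>"
  shows "int_prod X (ext_deriv \<alpha>) = 0 \<longleftrightarrow> (\<forall>c\<in>A. \<forall>x\<in>crange c. \<forall>v. curl \<alpha> c x (X c x) v = 0)"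
proof
  show "int_prod X (ext_deriv \<alpha>) = 0" if *: "\<forall>c\<in>A. \<forall>x\<in>crange c. \<forall>v. curl \<alpha> c x (X c x) v = 0"
  proof (intro ext)
    fix c x vs
    show "int_prod X (ext_deriv \<alpha>) c x vs = 0 c x vs"
    proof (cases "c \<in> A \<and> x \<in> crange c \<and> length vs = 1")
      case True
      then show ?thesis using * by (auto simp: int_prod_def length_Suc_conv ext_deriv_pair)
    next
      case False
      then have "length (X c x # vs) \<noteq> 2 \<or> c \<notin> A \<or> x \<notin> crange c" by auto
      then show ?thesis
        using ext_deriv_1_degree[OF assms, of "X c x # vs" c x] ext_deriv_outside[OF assms, of c x "X c x # vs"]
        unfolding int_prod_def by auto
    qed
  qed
next
  assume 0: "int_prod X (ext_deriv \<alpha>) = 0"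
  show "\<forall>c\<in>A. \<forall>x\<in>crange c. \<forall>v. curl \<alpha> c x (X c x) v = 0"
  proof (intro ballI allI)
    fix c x v assume "c \<in> A" "x \<in> crange c"
    then show "curl \<alpha> c x (X c x) v = 0"
      using fun_cong[OF fun_cong[OF fun_cong[OF 0]], of c x "[v]"]
      unfolding int_prod_def by (simp add: ext_deriv_pair)
  qed
qed

context smooth_manifold
begin

lemma diff_form_one_form:
  assumes lin: "\<And>c x. c \<in> A \<Longrightarrow> x \<in> crange c \<Longrightarrow> linear (a c x)"
    and smooth: "\<And>c v. c \<in> A \<Longrightarrow> smooth_on (crange c) (\<lambda>x. a c x v)"
    and trans: "\<And>c c' p v. c \<in> A \<Longrightarrow> c' \<in> A \<Longrightarrow> p \<in> fst c \<Longrightarrow> p \<in> fst c' \<Longrightarrow>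
      a c (snd c p) v = a c' (snd c' p) (dtransition c c' p v)"
  shows "diff_form A 1 (one_form A a)"
  unfolding diff_form_def tensor_field_def
proof (intro conjI ballI allI impI)
  fix c x and vs :: "'e list" and i :: nat assume *: "c \<in> A" "x \<in> crange c" "length vs = 1 \<and> i < 1"
  then show "linear (\<lambda>v. one_form A a c x (vs[i := v]))"
    using lin[OF *(1,2)] by (auto simp: length_Suc_conv one_form_def cong: if_cong)
next
  fix c and vs :: "'e list" assume *: "c \<in> A" "length vs = 1"
  show "smooth_on (crange c) (\<lambda>x. one_form A a c x vs)"
    by (rule smooth_on_cong[OF open_crange[OF chart[OF *(1)]] _ smooth[OF *(1), of "hd vs"]])
      (use * in \<open>simp add: one_form_def\<close>)
next
  fix c c' p and vs :: "'e list" assume *: "c \<in> A" "c' \<in> A" "p \<in> fst c \<inter> fst c'" "length vs = 1"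
  then show "one_form A a c (snd c p) vs = one_form A a c' (snd c' p) (map (dtransition c c' p) vs)"
    using trans[OF *(1,2)] by (auto simp: one_form_def length_Suc_conv)
qed (auto simp: one_form_def)

lemma diff_form_1_differentiable:
  assumes "diff_form A 1 \<alpha>" "c \<in> A" "x \<in> crange c"
  shows "((\<lambda>x. \<alpha> c x [v]) has_derivative Dt (\<lambda>x. \<alpha> c x [v]) x) (at x)"
  by (rule smooth_on_has_derivative[OF diff_form_1_smooth[OF assms(1,2)] assms(3)])

lemma curl_linear:
  assumes "diff_form A 1 \<alpha>" "c \<in> A" "x \<in> crange c"
  shows "linear (\<lambda>u. curl \<alpha> c x u v)" "linear (\<lambda>v. curl \<alpha> c x u v)"
proof -
  have "linear (\<lambda>v. Dt (\<lambda>y. \<alpha> c y [v]) x u)" for u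
  proof -
    have "Dt (\<lambda>y. \<alpha> c y [v]) x u = (\<Sum>b\<in>Basis. (v \<bullet> b) * Dt (\<lambda>y. \<alpha> c y [b]) x u)" for v
      by (rule linear_family_Dt[where l = "\<lambda>y v. \<alpha> c y [v]", OF open_crange[OF chart[OF assms(2)]] _
            diff_form_1_smooth[OF assms(1,2)] assms(3)]) (rule diff_form_1_linear[OF assms(1,2)])
    then have eq: "(\<lambda>v. Dt (\<lambda>y. \<alpha> c y [v]) x u) = (\<lambda>v. \<Sum>b\<in>Basis. (v \<bullet> b) * Dt (\<lambda>y. \<alpha> c y [b]) x u)"
      by (rule ext)
    show ?thesis
      unfolding eq
      by (intro linear_compose_sum ballI linearI) (auto simp: algebra_simps inner_add_left)
  qed
  then show "linear (\<lambda>u. curl \<alpha> c x u v)" "linear (\<lambda>v. curl \<alpha> c x u v)"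
    unfolding curl_def using has_derivative_linear[OF diff_form_1_differentiable[OF assms]]
    by (auto intro!: linear_compose_sub)
qed

text \<open>In local coordinates the pullback of a form involves the derivative \<open>D\<tau>\<close> of the transition map, so
  its derivatives involve second derivatives of \<open>\<tau>\<close>; they are symmetric and cancel under
  antisymmetrisation.\<close>

lemma curl_transition:
  assumes \<alpha>: "diff_form A 1 \<alpha>" and c: "c \<in> A" "c' \<in> A" "p \<in> fst c" "p \<in> fst c'"
  shows "curl \<alpha> c (snd c p) u v = curl \<alpha> c' (snd c' p) (dtransition c c' p u) (dtransition c c' p v)"
proof -
  define \<tau> where "\<tau> = transition c c'"
  define S where "S = snd c ` (fst c \<inter> fst c')"
  define x where "x = snd c p"
  have S: "open S" "x \<in> S" unfolding S_def x_def using open_overlap[OF c(1,2)] c by auto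
  have \<tau>: "smooth_on S \<tau>" unfolding S_def \<tau>_def by (rule smooth_transition[OF c(1,2)])
  have \<tau>x: "\<tau> x = snd c' p" unfolding x_def \<tau>_def by (rule transition_apply[OF chart[OF c(1)] c(3)])
  have dt: "dtransition c c' p = Dt \<tau> x" by (simp add: dtransition_def \<tau>_def x_def)
  have im: "\<tau> y \<in> crange c'" if "y \<in> S" for y
    using that transition_apply[OF chart[OF c(1)], of _ c'] unfolding S_def \<tau>_def by auto
  have local: "\<alpha> c y [v] = \<alpha> c' (\<tau> y) [Dt \<tau> y v]" if "y \<in> S" for y v
  proof -
    obtain q where q: "q \<in> fst c" "q \<in> fst c'" "y = snd c q" using \<open>y \<in> S\<close> S_def by blast
    show ?thesis
      using diff_form_1_transition[OF \<alpha> c(1,2) q(1,2)] transition_apply[OF chart[OF c(1)] q(1), of c']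
      by (simp add: q(3) \<tau>_def dtransition_def)
  qed
  have sm: "smooth_on S (\<lambda>y. \<alpha> c' (\<tau> y) [w])" for w
    by (rule smooth_on_compose[OF S(1) open_crange[OF chart[OF c(2)]] im diff_form_1_smooth[OF \<alpha> c(2)] \<tau>])
  have D: "Dt (\<lambda>y. \<alpha> c y [v]) x u = Dt (\<lambda>y. \<alpha> c' y [Dt \<tau> x v]) (\<tau> x) (Dt \<tau> x u)
      + \<alpha> c' (\<tau> x) [Dt (\<lambda>y. Dt \<tau> y v) x u]" for u v
  proof -
    have "Dt (\<lambda>y. \<alpha> c y [v]) x u = Dt (\<lambda>y. \<alpha> c' (\<tau> y) [Dt \<tau> y v]) x u"
      by (rule fun_cong[OF Dt_cong[OF S local]])
    also have "\<dots> = Dt (\<lambda>y. \<alpha> c' (\<tau> y) [Dt \<tau> x v]) x u + \<alpha> c' (\<tau> x) [Dt (\<lambda>y. Dt \<tau> y v) x u]"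
      using linear_family_product_rule(2)[where l = "\<lambda>y w. \<alpha> c' (\<tau> y) [w]",
          OF S(1) diff_form_1_linear[OF \<alpha> c(2) im] sm smooth_on_Dt[OF \<tau>] S(2)] .
    also have "Dt (\<lambda>y. \<alpha> c' (\<tau> y) [Dt \<tau> x v]) x u = Dt (\<lambda>y. \<alpha> c' y [Dt \<tau> x v]) (\<tau> x) (Dt \<tau> x u)"
      by (rule fun_cong[OF Dt_eqI], rule has_derivative_compose[OF smooth_on_has_derivative[OF \<tau> S(2)]
            diff_form_1_differentiable[OF \<alpha> c(2) im[OF S(2)]]])
    finally show ?thesis .
  qed
  have comm: "Dt (\<lambda>y. Dt \<tau> y v) x u = Dt (\<lambda>y. Dt \<tau> y u) x v"
    by (rule Dt_Dt_commute[OF S(1) \<tau> S(2)])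
  have "curl \<alpha> c x u v = curl \<alpha> c' (\<tau> x) (Dt \<tau> x u) (Dt \<tau> x v)"
    unfolding curl_def D[of v u] D[of u v] comm by (rule add_diff_cancel_right)
  then show ?thesis unfolding dt \<tau>x by (simp only: x_def)
qed

lemma diff_form_ext_deriv:
  assumes \<alpha>: "diff_form A 1 \<alpha>"
  shows "diff_form A 2 (ext_deriv \<alpha>)"
  unfolding diff_form_def tensor_field_def
proof (intro conjI ballI allI impI)
  fix c x and vs :: "'e list" and i :: nat assume *: "c \<in> A" "x \<in> crange c" "length vs = 2 \<and> i < 2"
  obtain u v where vs: "vs = [u, v]" using *(3) length_2D by blast
  have "i = 0 \<or> i = 1" using * by auto
  then show "linear (\<lambda>v. ext_deriv \<alpha> c x (vs[i := v]))"
    using curl_linear[OF \<alpha> *(1,2)] by (auto simp: vs ext_deriv_pair[OF *(2)])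
next
  fix c and vs :: "'e list" assume *: "c \<in> A" "length vs = 2"
  obtain u v where vs: "vs = [u, v]" using *(2) length_2D by blast
  note op = open_crange[OF chart[OF *(1)]]
  have "smooth_on (crange c) (\<lambda>x. curl \<alpha> c x u v)"
    unfolding curl_def by (intro smooth_on_diff[OF op] smooth_on_Dt diff_form_1_smooth[OF \<alpha> *(1)])
  then show "smooth_on (crange c) (\<lambda>x. ext_deriv \<alpha> c x vs)"
    by (rule smooth_on_cong[OF op, rotated]) (simp add: vs ext_deriv_pair)
next
  fix c c' p and vs :: "'e list" assume *: "c \<in> A" "c' \<in> A" "p \<in> fst c \<inter> fst c'" "length vs = 2"
  obtain u v where vs: "vs = [u, v]" using *(4) length_2D by blast
  show "ext_deriv \<alpha> c (snd c p) vs = ext_deriv \<alpha> c' (snd c' p) (map (dtransition c c' p) vs)"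
    using * curl_transition[OF \<alpha> *(1,2), of p u v] by (simp add: vs ext_deriv_pair)
next
  fix c x i j and vs :: "'e list" assume *: "i < j \<and> j < length vs \<and> vs ! i = vs ! j"
  show "ext_deriv \<alpha> c x vs = 0"
  proof (cases "length vs = 2 \<and> x \<in> crange c")
    case True
    then obtain u v where vs: "vs = [u, v]" using length_2D by blast
    then have "u = v" using * by (auto simp: less_Suc_eq)
    then show ?thesis using True by (simp add: vs ext_deriv_pair curl_def)
  next
    case False
    then show ?thesis using ext_deriv_1_degree[OF \<alpha>] ext_deriv_outside[OF \<alpha>] by blast
  qed
qed (use ext_deriv_1_degree[OF \<alpha>] ext_deriv_outside[OF \<alpha>] in blast)+

lemma ext_deriv_ext_deriv:
  assumes \<alpha>: "diff_form A 1 \<alpha>"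
  shows "ext_deriv (ext_deriv \<alpha>) = 0"
proof (intro ext)
  fix c x and vs :: "'e list"
  show "ext_deriv (ext_deriv \<alpha>) c x vs = 0 c x vs"
  proof (cases "c \<in> A \<and> x \<in> crange c \<and> length vs = 3")
    case True
    then obtain u v w where vs: "vs = [u, v, w]"
      by (auto simp: length_Suc_conv numeral_3_eq_3)
    have c: "c \<in> A" "x \<in> crange c" using True by auto
    note op = open_crange[OF chart[OF c(1)]]
    have D: "Dt (\<lambda>y. ext_deriv \<alpha> c y [u, v]) x
        = (\<lambda>w. Dt (\<lambda>y. Dt (\<lambda>y. \<alpha> c y [v]) y u) x w - Dt (\<lambda>y. Dt (\<lambda>y. \<alpha> c y [u]) y v) x w)" for u v
    proof -
      have "Dt (\<lambda>y. ext_deriv \<alpha> c y [u, v]) x = Dt (\<lambda>y. curl \<alpha> c y u v) x"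
        by (rule Dt_cong[OF op c(2)]) (rule ext_deriv_pair)
      also have "\<dots> = (\<lambda>w. Dt (\<lambda>y. Dt (\<lambda>y. \<alpha> c y [v]) y u) x w - Dt (\<lambda>y. Dt (\<lambda>y. \<alpha> c y [u]) y v) x w)"
        unfolding curl_def
        by (intro Dt_eqI has_derivative_diff smooth_on_has_derivative[OF smooth_on_Dt[OF diff_form_1_smooth[OF \<alpha> c(1)]] c(2)])
      finally show ?thesis .
    qed
    have "ext_deriv (ext_deriv \<alpha>) c x vs = Dt (\<lambda>y. ext_deriv \<alpha> c y [v, w]) x u
        - Dt (\<lambda>y. ext_deriv \<alpha> c y [u, w]) x v + Dt (\<lambda>y. ext_deriv \<alpha> c y [u, v]) x w"
      using c(2) by (simp add: ext_deriv_def[of "ext_deriv \<alpha>"] vs numeral_2_eq_2)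
    also have "\<dots> = 0"
      unfolding D
      using Dt_Dt_commute[OF op diff_form_1_smooth[OF \<alpha> c(1)] c(2), of u v w]
        Dt_Dt_commute[OF op diff_form_1_smooth[OF \<alpha> c(1)] c(2), of v u w]
        Dt_Dt_commute[OF op diff_form_1_smooth[OF \<alpha> c(1)] c(2), of w u v] by linarith
    finally show ?thesis by simp
  next
    case False
    have "ext_deriv (ext_deriv \<alpha>) c x vs = 0" if "length vs \<noteq> Suc 2"
      by (rule ext_deriv_zero_degree[OF ext_deriv_1_degree[OF \<alpha>] that])
    moreover have "ext_deriv (ext_deriv \<alpha>) c x vs = 0" if "c \<notin> A \<or> x \<notin> crange c"
      by (rule ext_deriv_outside[OF diff_form_ext_deriv[OF \<alpha>] that])
    moreover have "length vs \<noteq> Suc 2 \<or> c \<notin> A \<or> x \<notin> crange c" using False by auto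
    ultimately have "ext_deriv (ext_deriv \<alpha>) c x vs = 0" by argo
    then show ?thesis by simp
  qed
qed

lemma diff_form_1_diff:
  assumes "diff_form A 1 \<alpha>" "diff_form A 1 \<beta>"
  shows "diff_form A 1 (\<alpha> - \<beta>)"
proof -
  have eq: "\<alpha> - \<beta> = one_form A (\<lambda>c x v. \<alpha> c x [v] - \<beta> c x [v])"
  proof (intro ext)
    fix c x and vs :: "'e list"
    show "(\<alpha> - \<beta>) c x vs = one_form A (\<lambda>c x v. \<alpha> c x [v] - \<beta> c x [v]) c x vs"
    proof (cases "c \<in> A \<and> x \<in> crange c \<and> length vs = 1")
      case True
      then show ?thesis by (auto simp: one_form_def length_Suc_conv)
    next
      case False
      then show ?thesis
        using diff_form_1_length[OF assms(1), of vs c x] diff_form_1_length[OF assms(2), of vs c x]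
          diff_form_outside[OF assms(1), of c x vs] diff_form_outside[OF assms(2), of c x vs]
        by (auto simp: one_form_def)
    qed
  qed
  have "diff_form A 1 (one_form A (\<lambda>c x v. \<alpha> c x [v] - \<beta> c x [v]))"
  proof (rule diff_form_one_form)
    fix c c' p v assume c: "c \<in> A" "c' \<in> A" "p \<in> fst c" "p \<in> fst c'"
    show "\<alpha> c (snd c p) [v] - \<beta> c (snd c p) [v]
        = \<alpha> c' (snd c' p) [dtransition c c' p v] - \<beta> c' (snd c' p) [dtransition c c' p v]"
      unfolding diff_form_1_transition[OF assms(1) c, of v] diff_form_1_transition[OF assms(2) c, of v] ..
  qed (intro linear_compose_sub smooth_on_diff diff_form_1_linear[OF assms(1)] diff_form_1_linear[OF assms(2)]
      diff_form_1_smooth[OF assms(1)] diff_form_1_smooth[OF assms(2)] open_crange chart; assumption)+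
  then show ?thesis by (simp only: eq)
qed

lemma curl_diff:
  assumes "diff_form A 1 \<alpha>" "diff_form A 1 \<beta>" "c \<in> A" "x \<in> crange c"
  shows "curl (\<alpha> - \<beta>) c x u v = curl \<alpha> c x u v - curl \<beta> c x u v"
proof -
  have "Dt (\<lambda>y. \<alpha> c y [v] - \<beta> c y [v]) x = (\<lambda>u. Dt (\<lambda>y. \<alpha> c y [v]) x u - Dt (\<lambda>y. \<beta> c y [v]) x u)" for v
    by (intro Dt_eqI has_derivative_diff diff_form_1_differentiable assms)
  then show ?thesis by (simp add: curl_def)
qed

lemma ext_deriv_diff:
  assumes "diff_form A 1 \<alpha>" "diff_form A 1 \<beta>"
  shows "ext_deriv (\<alpha> - \<beta>) = ext_deriv \<alpha> - ext_deriv \<beta>"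
proof (intro ext)
  fix c x and vs :: "'e list"
  show "ext_deriv (\<alpha> - \<beta>) c x vs = (ext_deriv \<alpha> - ext_deriv \<beta>) c x vs"
  proof (cases "c \<in> A \<and> x \<in> crange c \<and> length vs = 2")
    case True
    then show ?thesis using curl_diff[OF assms, of c x] by (auto dest!: length_2D simp: ext_deriv_pair)
  next
    case False
    have "ext_deriv \<gamma> c x vs = 0" if "diff_form A 1 \<gamma>" for \<gamma>
      using False ext_deriv_1_degree[OF that, of vs c x] ext_deriv_outside[OF that, of c x vs] by argo
    then show ?thesis using assms diff_form_1_diff[OF assms] by simp
  qed
qed

section \<open>The Euler class\<close>

lemma basic_1_iff: "\<eta> \<in> basic_forms A X 1 \<longleftrightarrow> diff_form A 1 \<eta> \<and>
    (\<forall>c\<in>A. \<forall>x\<in>crange c. \<eta> c x [X c x] = 0) \<and> int_prod X (ext_deriv \<eta>) = 0"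
proof -
  have "int_prod X \<eta> = 0 \<longleftrightarrow> (\<forall>c\<in>A. \<forall>x\<in>crange c. \<eta> c x [X c x] = 0)" if \<eta>: "diff_form A 1 \<eta>"
  proof
    assume 0: "int_prod X \<eta> = 0"
    have "\<eta> c x [X c x] = 0" for c x
      using fun_cong[OF fun_cong[OF fun_cong[OF 0]], of c x "[]"] by (simp add: int_prod_def)
    then show "\<forall>c\<in>A. \<forall>x\<in>crange c. \<eta> c x [X c x] = 0" by blast
  next
    assume *: "\<forall>c\<in>A. \<forall>x\<in>crange c. \<eta> c x [X c x] = 0"
    show "int_prod X \<eta> = 0"
    proof (intro ext)
      fix c x vs
      show "int_prod X \<eta> c x vs = 0 c x vs"
        using * diff_form_outside[OF \<eta>, of c x "X c x # vs"] diff_form_1_length[OF \<eta>, of "X c x # vs" c x]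
        by (cases "vs = []"; cases "c \<in> A \<and> x \<in> crange c") (auto simp: int_prod_def)
    qed
  qed
  then show ?thesis unfolding basic_forms_def by blast
qed

lemma int_prod_diff: "int_prod X (\<omega> - \<omega>') = int_prod X \<omega> - int_prod X \<omega>'"
  by (auto simp: int_prod_def fun_eq_iff)

lemma basic_1_diff:
  assumes "\<eta> \<in> basic_forms A X 1" "\<zeta> \<in> basic_forms A X 1"
  shows "\<eta> - \<zeta> \<in> basic_forms A X 1"
proof -
  have "diff_form A 1 \<eta>" "diff_form A 1 \<zeta>" using assms unfolding basic_1_iff by blast+
  then show ?thesis
    using assms diff_form_1_diff ext_deriv_diff unfolding basic_1_iff by (simp add: int_prod_diff)
qed

lemma characteristic_diff_basic:
  assumes "characteristic_form A X \<alpha>" "characteristic_form A X \<beta>"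
  shows "\<alpha> - \<beta> \<in> basic_forms A X 1"
proof -
  have "diff_form A 1 \<alpha>" "diff_form A 1 \<beta>" using assms unfolding characteristic_form_def by blast+
  then show ?thesis
    using assms diff_form_1_diff ext_deriv_diff unfolding basic_1_iff characteristic_form_def
    by (simp add: int_prod_diff)
qed

lemma exact_basic_2: "exact_basic A X 2 = insert 0 (ext_deriv ` basic_forms A X 1)"
  unfolding exact_basic_def by (auto simp: numeral_2_eq_2)

lemma ext_deriv_closed_basic:
  assumes "\<eta> \<in> basic_forms A X 1"
  shows "ext_deriv \<eta> \<in> closed_basic A X 2"
  using assms diff_form_ext_deriv[of \<eta>] ext_deriv_ext_deriv[of \<eta>]
  unfolding closed_basic_def basic_forms_def by (auto simp: int_prod_def fun_eq_iff)

lemma zero_closed_basic: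
  assumes "characteristic_form A X \<alpha>"
  shows "0 \<in> closed_basic A X 2"
proof -
  have \<alpha>: "diff_form A 1 \<alpha>" using assms unfolding characteristic_form_def by blast
  show ?thesis
    using ext_deriv_closed_basic[OF characteristic_diff_basic[OF assms assms]] ext_deriv_diff[OF \<alpha> \<alpha>]
    by simp
qed

text \<open>Two characteristic forms differ by a basic 1-form.  Hence \<open>d\<alpha>\<close> is the differential of a basic
  form \<open>\<eta>\<close> iff the characteristic form \<open>\<alpha> - \<eta>\<close> is closed.\<close>

lemma euler_class_zero_iff:
  assumes ex: "\<exists>\<alpha>. characteristic_form A X \<alpha>"
  shows "euler_class A X = basic_class A X 2 0 \<longleftrightarrow>
    (\<exists>\<alpha>. characteristic_form A X \<alpha> \<and> ext_deriv \<alpha> = 0)"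
proof -
  define \<beta> where "\<beta> = (SOME \<alpha>. characteristic_form A X \<alpha>)"
  have \<beta>: "characteristic_form A X \<beta>" unfolding \<beta>_def using ex by (rule someI_ex)
  then have \<beta>1: "diff_form A 1 \<beta>" unfolding characteristic_form_def by blast
  note zero = zero_closed_basic[OF \<beta>]
  show ?thesis
  proof
    assume "euler_class A X = basic_class A X 2 0"
    moreover have "0 \<in> basic_class A X 2 0"
      unfolding basic_class_def basic_cohomologous_def using zero by (auto simp: exact_basic_2)
    ultimately have "0 \<in> basic_class A X 2 (- ext_deriv \<beta>)"
      unfolding euler_class_def \<beta>_def by simp
    then have "ext_deriv \<beta> \<in> exact_basic A X 2"
      unfolding basic_class_def basic_cohomologous_def by simp
    then consider "ext_deriv \<beta> = 0" | \<eta> where "\<eta> \<in> basic_forms A X 1" "ext_deriv \<beta> = ext_deriv \<eta>"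
      unfolding exact_basic_2 by blast
    then show "\<exists>\<alpha>. characteristic_form A X \<alpha> \<and> ext_deriv \<alpha> = 0"
    proof cases
      case 1
      then show ?thesis using \<beta> by blast
    next
      case 2
      have \<eta>: "diff_form A 1 \<eta>" using 2(1) unfolding basic_1_iff by blast
      have "ext_deriv (\<beta> - \<eta>) = 0" using ext_deriv_diff[OF \<beta>1 \<eta>] 2(2) by simp
      moreover have "characteristic_form A X (\<beta> - \<eta>)"
        using 2(1) \<beta> diff_form_1_diff[OF \<beta>1 \<eta>] ext_deriv_diff[OF \<beta>1 \<eta>]
        unfolding characteristic_form_def basic_1_iff by (simp add: int_prod_diff)
      ultimately show ?thesis by blast
    qed
  next
    assume "\<exists>\<alpha>. characteristic_form A X \<alpha> \<and> ext_deriv \<alpha> = 0"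
    then obtain \<alpha> where \<alpha>: "characteristic_form A X \<alpha>" "ext_deriv \<alpha> = 0" by blast
    then have \<alpha>1: "diff_form A 1 \<alpha>" unfolding characteristic_form_def by blast
    define \<omega> where "\<omega> = - ext_deriv \<beta>"
    have \<omega>: "\<omega> = ext_deriv (\<alpha> - \<beta>)" and \<omega>': "- \<omega> = ext_deriv (\<beta> - \<alpha>)"
      unfolding \<omega>_def using ext_deriv_diff[OF \<alpha>1 \<beta>1] ext_deriv_diff[OF \<beta>1 \<alpha>1] \<alpha>(2) by simp_all
    note b1 = characteristic_diff_basic[OF \<alpha>(1) \<beta>] and b2 = characteristic_diff_basic[OF \<beta> \<alpha>(1)]
    have closed: "\<omega> \<in> closed_basic A X 2" unfolding \<omega> by (rule ext_deriv_closed_basic[OF b1])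
    have sub: "ext_deriv \<eta> - ext_deriv \<zeta> \<in> exact_basic A X 2"
      if "\<eta> \<in> basic_forms A X 1" "\<zeta> \<in> basic_forms A X 1" for \<eta> \<zeta>
      using basic_1_diff[OF that] ext_deriv_diff that unfolding exact_basic_2 basic_1_iff by (metis (no_types, lifting) image_eqI insertCI basic_1_iff)
    have "\<psi> - \<omega> \<in> exact_basic A X 2 \<longleftrightarrow> \<psi> \<in> exact_basic A X 2" for \<psi>
    proof
      assume "\<psi> \<in> exact_basic A X 2"
      then consider "\<psi> = 0" | \<eta> where "\<eta> \<in> basic_forms A X 1" "\<psi> = ext_deriv \<eta>"
        unfolding exact_basic_2 by blast
      then show "\<psi> - \<omega> \<in> exact_basic A X 2"
      proof cases
        case 1
        then show ?thesis using \<omega>' b2 unfolding exact_basic_2 by simp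
      next
        case 2
        then show ?thesis using sub[OF 2(1) b1] by (simp add: \<omega>)
      qed
    next
      assume "\<psi> - \<omega> \<in> exact_basic A X 2"
      then consider "\<psi> - \<omega> = 0" | \<eta> where "\<eta> \<in> basic_forms A X 1" "\<psi> - \<omega> = ext_deriv \<eta>"
        unfolding exact_basic_2 by blast
      then show "\<psi> \<in> exact_basic A X 2"
      proof cases
        case 1
        then show ?thesis using b1 unfolding exact_basic_2 by (simp add: \<omega>)
      next
        case 2
        then have "\<psi> = ext_deriv \<eta> - ext_deriv (\<beta> - \<alpha>)" by (simp add: \<omega>'[symmetric] algebra_simps)
        then show ?thesis using sub[OF 2(1) b2] by simp
      qed
    qed
    then have "basic_class A X 2 \<omega> = basic_class A X 2 0"
      unfolding basic_class_def basic_cohomologous_def using closed zero by auto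
    then show "euler_class A X = basic_class A X 2 0"
      unfolding euler_class_def \<omega>_def \<beta>_def .
  qed
qed

end

section \<open>The characteristic form of a geodesible field\<close>

lemma tensor_2_linear:
  assumes "tensor_field A 2 g" "c \<in> A" "x \<in> crange c"
  shows "linear (\<lambda>v. g c x [v, w])" "linear (\<lambda>w. g c x [v, w])"
proof -
  have *: "\<forall>c\<in>A. \<forall>x\<in>crange c. \<forall>vs i. length vs = 2 \<and> i < 2 \<longrightarrow> linear (\<lambda>v. g c x (vs[i := v]))"
    using assms(1) unfolding tensor_field_def by blast
  show "linear (\<lambda>v. g c x [v, w])" using *[rule_format, OF assms(2,3), of "[0, w]" 0] by simp
  show "linear (\<lambda>w. g c x [v, w])" using *[rule_format, OF assms(2,3), of "[v, 0]" 1] by simp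
qed

lemma tensor_2_smooth:
  assumes "tensor_field A 2 g" "c \<in> A"
  shows "smooth_on (crange c) (\<lambda>x. g c x [v, w])"
proof -
  have "\<forall>c\<in>A. \<forall>vs. length vs = 2 \<longrightarrow> smooth_on (crange c) (\<lambda>x. g c x vs)"
    using assms(1) unfolding tensor_field_def by blast
  from this[rule_format, OF assms(2), of "[v, w]"] show ?thesis by simp
qed

lemma tensor_2_transition:
  assumes "tensor_field A 2 g" "c \<in> A" "c' \<in> A" "p \<in> fst c" "p \<in> fst c'"
  shows "g c (snd c p) [v, w] = g c' (snd c' p) [dtransition c c' p v, dtransition c c' p w]"
proof -
  have "\<forall>c\<in>A. \<forall>c'\<in>A. \<forall>p\<in>fst c \<inter> fst c'. \<forall>vs. length vs = 2 \<longrightarrow>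
      g c (snd c p) vs = g c' (snd c' p) (map (dtransition c c' p) vs)"
    using assms(1) unfolding tensor_field_def by blast
  from this[rule_format, OF assms(2,3) IntI[OF assms(4,5)], of "[v, w]"] show ?thesis by simp
qed

context closed_manifold_field
begin

text \<open>An integral curve has the acceleration \<open>DX(X)\<close>, so the geodesic equation at time \<open>0\<close> becomes an
  equation for the field.\<close>

lemma geodesic_flow_equation:
  assumes geo: "geodesic A g (\<lambda>t. flow A X t p)" and c: "c \<in> A" "p \<in> fst c"
  shows "g c (snd c p) [Dt (X c) (snd c p) (X c (snd c p)), w]
    + christoffel g c (snd c p) (X c (snd c p)) (X c (snd c p)) w = 0"
proof -
  define \<gamma> where "\<gamma> t = flow A X t p" for t
  define x where "x = snd c p"
  have \<gamma>0: "\<gamma> 0 = p" by (simp add: \<gamma>_def flow_0)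
  have x: "x \<in> crange c" using c by (simp add: x_def)
  obtain u a where u: "\<forall>\<^sub>F s in nhds 0. ((snd c \<circ> \<gamma>) has_vector_derivative u s) (at s)"
    "(u has_vector_derivative a) (at 0)"
    and eq: "\<And>w. g c (snd c p) [a, w] + christoffel g c (snd c p) (u 0) (u 0) w = 0"
    using conjunct2[OF geo[unfolded geodesic_def], rule_format, OF c(1), of 0] c(2)
    unfolding \<gamma>_def[symmetric] \<gamma>0 by blast
  have "icurve_at 0 \<gamma>" using flow_curve unfolding integral_curve_iff \<gamma>_def by blast
  then have "isCont \<gamma> 0" unfolding icurve_at_def by blast
  then have "\<forall>\<^sub>F s in nhds 0. \<gamma> s \<in> fst c"
    using open_fst_chart[OF chart[OF c(1)]] c(2) \<gamma>0
    unfolding isCont_def tendsto_at_iff_tendsto_nhds by (metis topological_tendstoD)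
  then have ev: "\<forall>\<^sub>F s in nhds 0. u s = X c (snd c (\<gamma> s))"
    using u(1)
  proof eventually_elim
    case (elim s)
    have "((snd c \<circ> \<gamma>) has_vector_derivative X c (snd c (\<gamma> s))) (at s)"
      using flow_velocity[OF c(1), of s p] elim(1) unfolding \<gamma>_def o_def by blast
    then show ?case using elim(2) vector_derivative_unique_at by blast
  qed
  then have u0: "u 0 = X c x" using eventually_nhds_x_imp_x[OF ev] \<gamma>0 by (simp add: x_def)
  have "((snd c \<circ> \<gamma>) has_vector_derivative X c x) (at 0)"
    using flow_velocity[OF c(1), of 0 p] c(2) \<gamma>0 unfolding \<gamma>_def[symmetric] o_def x_def by simp
  then have sd: "((snd c \<circ> \<gamma>) has_derivative (\<lambda>r. r *\<^sub>R X c x)) (at 0)"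
    unfolding has_vector_derivative_def .
  have Xd: "(X c has_derivative Dt (X c) x) (at x)"
    by (rule smooth_on_has_derivative[OF vector_field_smooth[OF field c(1)] x])
  have "((\<lambda>s. X c ((snd c \<circ> \<gamma>) s)) has_derivative (\<lambda>r. Dt (X c) x (r *\<^sub>R X c x))) (at 0)"
    by (rule has_derivative_compose[OF sd]) (use Xd \<gamma>0 in \<open>simp add: x_def\<close>)
  then have "((\<lambda>s. X c ((snd c \<circ> \<gamma>) s)) has_vector_derivative Dt (X c) x (X c x)) (at 0)"
    unfolding has_vector_derivative_def linear_scale[OF has_derivative_linear[OF Xd]] .
  moreover obtain S where "open S" "0 \<in> S" "\<And>s. s \<in> S \<Longrightarrow> X c ((snd c \<circ> \<gamma>) s) = u s"
    using ev unfolding eventually_nhds by auto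
  ultimately have "(u has_vector_derivative Dt (X c) x (X c x)) (at 0)"
    by (rule has_vector_derivative_transform_within_open)
  then have "a = Dt (X c) x (X c x)" using u(2) vector_derivative_unique_at by blast
  then show ?thesis using eq[of w] u0 by (simp add: x_def)
qed

text \<open>The 1-form dual to the unit field \<open>X\<close> is characteristic: \<open>i\<^sub>X d\<alpha>\<close> is the geodesic equation with
  lowered index, because \<open>g(X, X) = 1\<close> gives \<open>2 g(D\<^sub>w X, X) = - (D\<^sub>w g)(X, X)\<close> in a chart.\<close>

lemma geodesible_characteristic_form:
  assumes geo: "geodesible A X"
  shows "\<exists>\<alpha>. characteristic_form A X \<alpha>"
proof -
  obtain g where g: "riemannian_metric A g"
    and unit: "\<And>c x. c \<in> A \<Longrightarrow> x \<in> crange c \<Longrightarrow> sqrt (g c x [X c x, X c x]) = 1"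
    and geod: "\<And>p. geodesic A g (\<lambda>t. flow A X t p)"
    using geo unfolding geodesible_def by blast
  have tg: "tensor_field A 2 g" using g unfolding riemannian_metric_def by blast
  have sym: "g c x [v, w] = g c x [w, v]" if "c \<in> A" "x \<in> crange c" for c x v w
    using g that unfolding riemannian_metric_def by blast
  have unit: "g c x [X c x, X c x] = 1" if "c \<in> A" "x \<in> crange c" for c x
    using unit[OF that] by simp
  define \<alpha> where "\<alpha> = one_form A (\<lambda>c x v. g c x [X c x, v])"
  have \<alpha>: "diff_form A 1 \<alpha>"
    unfolding \<alpha>_def
  proof (rule diff_form_one_form)
    fix c x assume "c \<in> A" "x \<in> crange c"
    then show "linear (\<lambda>v. g c x [X c x, v])" by (rule tensor_2_linear[OF tg])
  next
    fix c v assume c: "c \<in> A"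
    show "smooth_on (crange c) (\<lambda>x. g c x [X c x, v])"
      by (rule linear_family_product_rule(1)[OF open_crange[OF chart[OF c]], where l = "\<lambda>x u. g c x [u, v]"])
        (use c tensor_2_linear[OF tg c] tensor_2_smooth[OF tg c] vector_field_smooth[OF field c] in auto)
  next
    fix c c' p v assume c: "c \<in> A" "c' \<in> A" "p \<in> fst c" "p \<in> fst c'"
    show "g c (snd c p) [X c (snd c p), v] = g c' (snd c' p) [X c' (snd c' p), dtransition c c' p v]"
      unfolding vector_field_transition[OF field c] by (rule tensor_2_transition[OF tg c])
  qed
  have curl0: "curl \<alpha> c x (X c x) w = 0" if c: "c \<in> A" "x \<in> crange c" for c x w
  proof -
    note op = open_crange[OF chart[OF c(1)]]
    define a where "a = X c x"
    define \<Delta> where "\<Delta> u v w = Dt (\<lambda>y. g c y [u, v]) x w" for u v w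
    have rule1: "Dt (\<lambda>y. g c y [X c y, v]) x u = \<Delta> a v u + g c x [Dt (X c) x u, v]" for u v
      unfolding \<Delta>_def a_def
      by (rule linear_family_product_rule(2)[OF op, where l = "\<lambda>x u. g c x [u, v]"])
        (use c tensor_2_linear[OF tg c(1)] tensor_2_smooth[OF tg c(1)] vector_field_smooth[OF field c(1)] in auto)
    have smX: "smooth_on (crange c) (\<lambda>x. g c x [X c x, v])" for v
      by (rule smooth_on_cong[OF op _ diff_form_1_smooth[OF \<alpha> c(1)]]) (simp add: \<alpha>_def one_form_apply c(1))
    have rule2: "Dt (\<lambda>y. g c y [X c y, X c y]) x u = Dt (\<lambda>y. g c y [X c y, a]) x u + g c x [a, Dt (X c) x u]" for u
      unfolding a_def
      by (rule linear_family_product_rule(2)[OF op, where l = "\<lambda>x u. g c x [X c x, u]"])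
        (use c tensor_2_linear[OF tg c(1)] smX vector_field_smooth[OF field c(1)] in auto)
    have "Dt (\<lambda>y. g c y [X c y, X c y]) x = Dt (\<lambda>y. 1) x"
      by (rule Dt_cong[OF op c(2)]) (rule unit[OF c(1)])
    then have "Dt (\<lambda>y. g c y [X c y, X c y]) x w = 0" by simp
    then have unit': "\<Delta> a a w + 2 * g c x [Dt (X c) x w, a] = 0"
      unfolding rule2 rule1 using sym[OF c, of a "Dt (X c) x w"] by simp
    have curl: "curl \<alpha> c x a w = Dt (\<lambda>y. g c y [X c y, w]) x a - Dt (\<lambda>y. g c y [X c y, a]) x w"
    proof -
      have "Dt (\<lambda>y. \<alpha> c y [v]) x = Dt (\<lambda>y. g c y [X c y, v]) x" for v
        by (rule Dt_cong[OF op c(2)]) (simp add: \<alpha>_def one_form_apply c(1))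
      then show ?thesis by (simp add: curl_def)
    qed
    have p: "cinv c x \<in> fst c" "snd c (cinv c x) = x" using c(2) by (rule cinv_in, rule snd_cinv)
    have "g c x [Dt (X c) x a, w] + christoffel g c x a a w = 0"
      using geodesic_flow_equation[OF geod c(1) p(1), of w] unfolding p(2) a_def .
    then have "g c x [Dt (X c) x a, w] + \<Delta> a w a - \<Delta> a a w / 2 = 0"
      unfolding christoffel_def \<Delta>_def[symmetric] by argo
    with unit' show ?thesis
      unfolding a_def[symmetric] curl rule1 by linarith
  qed
  have "characteristic_form A X \<alpha>"
    unfolding characteristic_form_def int_prod_ext_deriv_eq_0_iff[OF \<alpha>]
    using \<alpha> curl0 unit by (simp add: \<alpha>_def one_form_apply)
  then show ?thesis by blast
qed

end

section \<open>Closed 1-forms are coordinate differentials\<close>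

text \<open>The Poincare lemma for 1-forms on a convex set.  The primitive \<open>f(x) = \<integral>\<^sub>0\<^sup>1 a(x\<^sub>0 + t(x - x\<^sub>0))(x - x\<^sub>0) dt\<close>
  can be differentiated under the integral, and closedness turns the integrand of \<open>Df(x)(u)\<close> into the
  derivative of \<open>t \<mapsto> t a(x\<^sub>0 + t(x - x\<^sub>0))(u)\<close>.\<close>

lemma closed_covector_field_primitive:
  fixes a :: "'e::euclidean_space \<Rightarrow> 'e \<Rightarrow> real"
  assumes U: "open U" "convex U"
    and lin: "\<And>y. y \<in> U \<Longrightarrow> linear (a y)" and sm: "\<And>v. smooth_on U (\<lambda>y. a y v)"
    and closed: "\<And>x u v. x \<in> U \<Longrightarrow> Dt (\<lambda>y. a y v) x u = Dt (\<lambda>y. a y u) x v"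
  shows "\<exists>f. \<forall>x\<in>U. (f has_derivative a x) (at x)"
proof (cases "U = {}")
  case False
  then obtain x0 where x0: "x0 \<in> U" by blast
  define z where "z x t = x0 + t *\<^sub>R (x - x0)" for x and t :: real
  have z: "z x t \<in> U" if "x \<in> U" "0 \<le> t" "t \<le> 1" for x t
    using convexD_alt[OF U(2) x0 that(1), of t] that by (simp add: z_def algebra_simps)
  define F where "F x t = a (z x t) (x - x0)" for x t
  define co where "co x t u = t * Dt (\<lambda>y. a y u) (z x t) (x - x0) + a (z x t) u" for x t u
  define fx where "fx x t = (\<Sum>b\<in>Basis. co x t b *\<^sub>R blinfun_inner_right b)" for x t
  have da: "((\<lambda>y. a y v) has_derivative Dt (\<lambda>y. a y v) x) (at x)" if "x \<in> U" for x v
    by (rule smooth_on_has_derivative[OF sm that])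
  have zx: "((\<lambda>x. z x t) has_derivative (\<lambda>u. t *\<^sub>R u)) (at x)" for x t
    unfolding z_def by (auto intro!: derivative_eq_intros)
  have dF: "((\<lambda>x. F x t) has_derivative co x t) (at x)" if x: "x \<in> U" and t: "0 \<le> t" "t \<le> 1" for x t
  proof -
    have smz: "smooth_on U (\<lambda>y. a (z y t) v)" for v
    proof (rule smooth_on_compose[OF U(1) U(1) _ sm])
      show "smooth_on U (\<lambda>y. z y t)"
        by (rule smooth_on_derivI[OF U(1) zx smooth_on_const])
    qed (use z t in auto)
    have smf: "smooth_on U (\<lambda>y. y - x0)"
      by (intro smooth_on_diff[OF U(1)] smooth_on_id[OF U(1)] smooth_on_const)
    have linz: "linear (a (z y t))" if "y \<in> U" for y by (rule lin[OF z[OF that t]])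
    have pr: "smooth_on U (\<lambda>y. a (z y t) (y - x0))"
      "Dt (\<lambda>y. a (z y t) (y - x0)) x u
        = Dt (\<lambda>y. a (z y t) (x - x0)) x u + a (z x t) (Dt (\<lambda>y. y - x0) x u)" for u
      using linear_family_product_rule[where l = "\<lambda>y. a (z y t)", OF U(1) linz smz smf] x by blast+
    have "Dt (\<lambda>x. F x t) x u = co x t u" for u
    proof -
      have 1: "Dt (\<lambda>y. y - x0) x = (\<lambda>u. u)"
        by (rule Dt_eqI) (auto intro!: derivative_eq_intros)
      have 2: "Dt (\<lambda>y. a (z y t) v) x = (\<lambda>u. Dt (\<lambda>y. a y v) (z x t) (t *\<^sub>R u))" for v
        by (rule Dt_eqI, rule has_derivative_compose[OF zx da[OF z[OF x t]]])
      have "Dt (\<lambda>x. F x t) x u = Dt (\<lambda>y. a y (x - x0)) (z x t) (t *\<^sub>R u) + a (z x t) u"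
        unfolding F_def pr(2) 1 2 ..
      also have "Dt (\<lambda>y. a y (x - x0)) (z x t) (t *\<^sub>R u) = t * Dt (\<lambda>y. a y (x - x0)) (z x t) u"
        unfolding linear_scale[OF has_derivative_linear[OF da[OF z[OF x t]]]] by simp
      also have "Dt (\<lambda>y. a y (x - x0)) (z x t) u = Dt (\<lambda>y. a y u) (z x t) (x - x0)"
        by (rule closed[OF z[OF x t]])
      finally show ?thesis unfolding co_def .
    qed
    then have "Dt (\<lambda>x. F x t) x = co x t" by blast
    then show ?thesis
      using smooth_on_has_derivative[OF pr(1) x] unfolding F_def by simp
  qed
  have fx: "blinfun_apply (fx x t) u = co x t u" if "x \<in> U" "0 \<le> t" "t \<le> 1" for x t u
  proof -
    have "co x t u = (\<Sum>b\<in>Basis. (u \<bullet> b) * co x t b)"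
      by (rule linear_family_sum[OF has_derivative_linear[OF dF[OF that]]])
    then show ?thesis
      unfolding fx_def by (simp add: blinfun.sum_left blinfun.scaleR_left inner_commute mult.commute)
  qed
  have contz: "continuous_on (U \<times> cbox 0 1) (\<lambda>p. z (fst p) (snd p))"
    unfolding z_def by (intro continuous_intros)
  have comp: "continuous_on (U \<times> cbox 0 1) (\<lambda>p. h (z (fst p) (snd p)))" if "continuous_on U h" for h :: "'e \<Rightarrow> real"
    by (rule continuous_on_compose2[OF that contz]) (use z in auto)
  have contco: "continuous_on (U \<times> cbox 0 1) (\<lambda>p. co (fst p) (snd p) b)" for b
  proof -
    have "continuous_on (U \<times> cbox 0 1) (\<lambda>p. snd p * (\<Sum>e\<in>Basis. ((fst p - x0) \<bullet> e) * Dt (\<lambda>y. a y b) (z (fst p) (snd p)) e)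
        + a (z (fst p) (snd p)) b)"
      by (intro continuous_intros comp smooth_on_continuous smooth_on_Dt sm)
    then show ?thesis
    proof (rule continuous_on_eq)
      fix p :: "'e \<times> real" assume p: "p \<in> U \<times> cbox 0 1"
      then have "z (fst p) (snd p) \<in> U" using z by auto
      from linear_family_sum[OF has_derivative_linear[OF da[OF this, of b]], of "fst p - x0"]
      show "snd p * (\<Sum>e\<in>Basis. ((fst p - x0) \<bullet> e) * Dt (\<lambda>y. a y b) (z (fst p) (snd p)) e)
        + a (z (fst p) (snd p)) b = co (fst p) (snd p) b"
        unfolding co_def by simp
    qed
  qed
  have contfx: "continuous_on (U \<times> cbox 0 1) (\<lambda>(x, t). fx x t)"
    unfolding fx_def split_beta by (intro continuous_intros contco)
  have contfx1: "continuous_on (cbox 0 1) (\<lambda>t. fx x t)" if "x \<in> U" for x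
  proof -
    have "continuous_on (cbox 0 1) (\<lambda>t::real. (x, t))" by (intro continuous_intros)
    from continuous_on_compose2[OF contfx this] that show ?thesis by auto
  qed
  have intF: "F x integrable_on cbox 0 1" if x: "x \<in> U" for x
  proof -
    have "continuous_on (cbox 0 1) (z x)" unfolding z_def by (intro continuous_intros)
    then have "continuous_on (cbox 0 1) (\<lambda>t. a (z x t) (x - x0))"
      by (rule continuous_on_compose2[OF smooth_on_continuous[OF sm]]) (use z x in auto)
    then show ?thesis unfolding F_def by (rule integrable_continuous)
  qed
  have "((\<lambda>x. integral (cbox 0 1) (F x)) has_derivative a x) (at x)" if x: "x \<in> U" for x
  proof -
    have "((\<lambda>x. integral (cbox 0 1) (F x)) has_derivative blinfun_apply (integral (cbox 0 1) (fx x))) (at x within U)"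
    proof (rule leibniz_rule[OF _ intF contfx x U(2)])
      fix x t assume xt: "x \<in> U" "t \<in> cbox (0::real) 1"
      then have "co x t = blinfun_apply (fx x t)" using fx by (auto simp: fun_eq_iff)
      then show "((\<lambda>x. F x t) has_derivative blinfun_apply (fx x t)) (at x within U)"
        using has_derivative_at_withinI[OF dF, of x t U] xt by auto
    qed
    moreover have "blinfun_apply (integral (cbox 0 1) (fx x)) u = a x u" for u
    proof -
      have "((\<lambda>t. co x t u) has_integral 1 * a (z x 1) u - 0 * a (z x 0) u) {0..1}"
      proof (rule fundamental_theorem_of_calculus)
        fix t :: real assume t: "t \<in> {0..1}"
        have zt: "(z x has_derivative (\<lambda>s. s *\<^sub>R (x - x0))) (at t within {0..1})"
          unfolding z_def by (auto intro!: derivative_eq_intros)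
        have zU: "z x t \<in> U" using z x t by auto
        have "((\<lambda>t. a (z x t) u) has_derivative (\<lambda>s. Dt (\<lambda>y. a y u) (z x t) (s *\<^sub>R (x - x0)))) (at t within {0..1})"
          by (rule has_derivative_compose[OF zt da[OF zU]])
        then have "((\<lambda>t. a (z x t) u) has_vector_derivative Dt (\<lambda>y. a y u) (z x t) (x - x0)) (at t within {0..1})"
          unfolding has_vector_derivative_def linear_scale[OF has_derivative_linear[OF da[OF zU]]] .
        then have "((\<lambda>t. t * a (z x t) u) has_vector_derivative t * Dt (\<lambda>y. a y u) (z x t) (x - x0) + 1 * a (z x t) u) (at t within {0..1})"
          by (intro has_vector_derivative_mult has_vector_derivative_id)
        then show "((\<lambda>t. t * a (z x t) u) has_vector_derivative co x t u) (at t within {0..1})"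
          unfolding co_def by simp
      qed simp
      then have "integral {0..1} (\<lambda>t. co x t u) = a x u"
        by (simp add: z_def integral_unique)
      moreover have "integral (cbox 0 1) (\<lambda>t. blinfun_apply (fx x t) u) = integral (cbox 0 1) (\<lambda>t. co x t u)"
        by (rule integral_cong) (use fx x in auto)
      ultimately show ?thesis
        using blinfun_apply_integral[OF integrable_continuous[OF contfx1[OF x]], of u] by simp
    qed
    then have "blinfun_apply (integral (cbox 0 1) (fx x)) = a x" by blast
    ultimately show ?thesis
      using at_within_open[OF x U(1)] by simp
  qed
  then show ?thesis by blast
qed auto

text \<open>A map whose derivative is a smooth function of its own values gains one derivative with each
  application of this relation.\<close>

lemma smooth_on_inverse_map:
  fixes g :: "'a::euclidean_space \<Rightarrow> 'b::euclidean_space"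
  assumes W: "open W" "open V" "\<And>y. y \<in> W \<Longrightarrow> g y \<in> V"
    and der: "\<And>y. y \<in> W \<Longrightarrow> (g has_derivative M (g y)) (at y)"
    and sm: "\<And>w. smooth_on V (\<lambda>x. M x w)"
  shows "smooth_on W g"
  unfolding smooth_on_def
proof
  show "Ck_on n W g" for n
  proof (induction n)
    case 0
    have "isCont g y" if "y \<in> W" for y
      using der[OF that] has_derivative_continuous by blast
    then show ?case by (simp add: continuous_at_imp_continuous_on)
  next
    case (Suc n)
    show ?case
    proof (rule Ck_on_SucI[OF W(1) der])
      show "Ck_on n W (\<lambda>y. M (g y) v)" for v
        by (rule Ck_on_compose[OF W _ Suc.IH]) (use sm in \<open>auto simp: smooth_on_def\<close>)
    qed
  qed
qed

text \<open>If \<open>\<partial>\<^sub>i f\<close> does not vanish, then \<open>f\<close> may replace the coordinate \<open>x \<bullet> i\<close>: the map \<open>\<Phi>\<close> below is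
  injective by the mean value theorem along lines parallel to \<open>i\<close>, and its derivative has an explicit
  inverse.\<close>

lemma replace_coordinate:
  fixes f :: "'e::euclidean_space \<Rightarrow> real"
  assumes V: "open V" "convex V" and i: "i \<in> Basis" and f: "smooth_on V f"
    and nz: "\<And>x. x \<in> V \<Longrightarrow> Dt f x i \<noteq> 0"
  defines "\<Phi> \<equiv> \<lambda>x. x + (f x - x \<bullet> i) *\<^sub>R i"
  shows "smooth_on V \<Phi>" "open (\<Phi> ` V)" "inj_on \<Phi> V" "smooth_on (\<Phi> ` V) (inv_into V \<Phi>)"
proof -
  have ii: "i \<bullet> i = 1" using i by simp
  have df: "(f has_derivative Dt f x) (at x)" if "x \<in> V" for x
    by (rule smooth_on_has_derivative[OF f that])
  show smooth: "smooth_on V \<Phi>"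
    unfolding \<Phi>_def
    by (intro smooth_on_add[OF V(1)] smooth_on_scaleR[OF V(1)] smooth_on_diff[OF V(1)] f
        smooth_on_inner_left[OF V(1)] smooth_on_id[OF V(1)] smooth_on_const)
  show inj: "inj_on \<Phi> V"
  proof (rule inj_onI)
    fix x y assume xy: "x \<in> V" "y \<in> V" "\<Phi> x = \<Phi> y"
    have fi: "\<Phi> x \<bullet> i = f x" for x by (simp add: \<Phi>_def inner_add_left ii)
    then have fxy: "f x = f y" using xy(3) by metis
    define s where "s = y \<bullet> i - x \<bullet> i"
    have y: "y = x + s *\<^sub>R i"
      using xy(3) fxy by (simp add: \<Phi>_def s_def algebra_simps)
    have seg: "x + t *\<^sub>R (s *\<^sub>R i) \<in> V" if "0 \<le> t" "t \<le> 1" for t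
      using convexD_alt[OF V(2) xy(1,2), of t] that unfolding y by (simp add: algebra_simps)
    have "((\<lambda>t. f (x + t *\<^sub>R (s *\<^sub>R i))) has_real_derivative s * Dt f (x + t *\<^sub>R (s *\<^sub>R i)) i) (at t)"
      if "0 \<le> t" "t \<le> 1" for t
    proof -
      have d: "((\<lambda>t. x + t *\<^sub>R (s *\<^sub>R i)) has_derivative (\<lambda>r. r *\<^sub>R (s *\<^sub>R i))) (at t)"
        by (auto intro!: derivative_eq_intros)
      have "Dt f (x + t *\<^sub>R (s *\<^sub>R i)) (r *\<^sub>R (s *\<^sub>R i)) = (s * Dt f (x + t *\<^sub>R (s *\<^sub>R i)) i) * r" for r
        unfolding linear_scale[OF has_derivative_linear[OF df[OF seg[OF that]]]] by simp
      then show ?thesis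
        using has_derivative_compose[OF d df[OF seg[OF that]]]
        unfolding has_field_derivative_def by simp
    qed
    then obtain t where t: "0 < t" "t < 1"
      "f (x + 1 *\<^sub>R (s *\<^sub>R i)) - f (x + 0 *\<^sub>R (s *\<^sub>R i)) = (1 - 0) * (s * Dt f (x + t *\<^sub>R (s *\<^sub>R i)) i)"
      using MVT2[of 0 1 "\<lambda>t. f (x + t *\<^sub>R (s *\<^sub>R i))" "\<lambda>t. s * Dt f (x + t *\<^sub>R (s *\<^sub>R i)) i"] by auto
    then have "s * Dt f (x + t *\<^sub>R (s *\<^sub>R i)) i = 0" using fxy y by simp
    then have "s = 0" using nz[OF seg[of t]] t by simp
    then show "x = y" using y by simp
  qed
  have cont: "continuous_on V \<Phi>" by (rule smooth_on_continuous[OF smooth])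
  show opn: "open (\<Phi> ` V)" by (rule invariance_of_domain[OF cont V(1) inj])
  define g where "g = inv_into V \<Phi>"
  have gV: "g y \<in> V" and \<Phi>g: "\<Phi> (g y) = y" if "y \<in> \<Phi> ` V" for y
    unfolding g_def using that by (rule inv_into_into, rule f_inv_into_f)
  \<comment> \<open>The inverse of \<open>D\<Phi>(x)\<close>: solve \<open>v + (Df(x)(v) - v \<bullet> i) i = w\<close> with the ansatz \<open>v = w + s i\<close>.\<close>
  define M where "M x w = w + ((w \<bullet> i - Dt f x w) * inverse (Dt f x i)) *\<^sub>R i" for x w
  have linM: "bounded_linear (M x)" if "x \<in> V" for x
  proof -
    have lin: "linear (Dt f x)" using df[OF that] has_derivative_linear by blast
    have "linear (M x)"
      by (rule linearI) (simp_all add: M_def linear_add[OF lin] linear_scale[OF lin] inner_add_left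
          algebra_simps)
    then show ?thesis by (rule linear_conv_bounded_linear[THEN iffD1])
  qed
  have "smooth_on (\<Phi> ` V) g"
  proof (rule smooth_on_inverse_map[OF opn V(1) gV])
    fix y assume y: "y \<in> \<Phi> ` V"
    note x = gV[OF y]
    let ?x = "g y"
    have lin: "linear (Dt f ?x)" using df[OF x] has_derivative_linear by blast
    show "(g has_derivative M ?x) (at y)"
    proof (rule has_derivative_inverse_basic[where f = \<Phi> and T = "\<Phi> ` V"])
      show "(\<Phi> has_derivative (\<lambda>v. v + (Dt f ?x v - v \<bullet> i) *\<^sub>R i)) (at ?x)"
        unfolding \<Phi>_def using df[OF x] by (auto intro!: derivative_eq_intros)
      show "M ?x \<circ> (\<lambda>v. v + (Dt f ?x v - v \<bullet> i) *\<^sub>R i) = id"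
      proof
        fix v
        have "Dt f ?x (v + (Dt f ?x v - v \<bullet> i) *\<^sub>R i) = Dt f ?x v + (Dt f ?x v - v \<bullet> i) * Dt f ?x i"
          by (simp add: linear_add[OF lin] linear_scale[OF lin])
        then have eq: "((v + (Dt f ?x v - v \<bullet> i) *\<^sub>R i) \<bullet> i - Dt f ?x (v + (Dt f ?x v - v \<bullet> i) *\<^sub>R i))
            * inverse (Dt f ?x i) = - (Dt f ?x v - v \<bullet> i)"
          using nz[OF x] by (simp add: inner_add_left ii mult.assoc)
        show "(M ?x \<circ> (\<lambda>v. v + (Dt f ?x v - v \<bullet> i) *\<^sub>R i)) v = id v"
          unfolding M_def o_def eq by (simp flip: scaleR_left_distrib)
      qed
      have "continuous_on (\<Phi> ` V) g"
        by (rule continuous_on_inverse_open[OF V(1) cont]) (auto simp: g_def inv_into_f_f[OF inj])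
      then show "continuous (at y) g"
        using opn y continuous_on_eq_continuous_at by blast
    qed (use linM[OF x] opn y \<Phi>g in auto)
  next
    show "smooth_on V (\<lambda>x. M x w)" for w
      unfolding M_def
      by (intro smooth_on_add[OF V(1)] smooth_on_scaleR[OF V(1)] smooth_on_mult[OF V(1)]
          smooth_on_diff[OF V(1)] smooth_on_inverse[OF V(1)] smooth_on_Dt f smooth_on_const nz)
  qed
  then show "smooth_on (\<Phi> ` V) (inv_into V \<Phi>)" unfolding g_def .
qed

context smooth_manifold
begin

text \<open>The differential is computed in \<open>c\<close>, where the coordinate of \<open>c'\<close> is a component of the transition map,
  and is transported to \<open>c'\<close> by the transformation rule for forms.\<close>

lemma form_is_coordinate_differential:
  assumes \<alpha>: "diff_form A 1 \<alpha>" and c: "c \<in> A" "c' \<in> A" "p \<in> fst c" "p \<in> fst c'"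
    and der: "((\<lambda>x. transition c c' x \<bullet> b) has_derivative (\<lambda>w. \<alpha> c (snd c p) [w])) (at (snd c p))"
  shows "\<alpha> c' (snd c' p) [v] = v \<bullet> b"
proof -
  have "((\<lambda>x. transition c c' x \<bullet> b) has_derivative (\<lambda>w. dtransition c c' p w \<bullet> b)) (at (snd c p))"
    by (intro has_derivative_inner_left has_derivative_transition c)
  then have eq: "(\<lambda>w. \<alpha> c (snd c p) [w]) = (\<lambda>w. dtransition c c' p w \<bullet> b)"
    by (rule has_derivative_unique[OF der])
  have "\<alpha> c' (snd c' p) [v] = \<alpha> c (snd c p) [dtransition c' c p v]"
    by (rule diff_form_1_transition[OF \<alpha> c(2,1,4,3)])
  also have "\<dots> = dtransition c c' p (dtransition c' c p v) \<bullet> b" using fun_cong[OF eq] .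
  finally show ?thesis by (simp add: dtransition_inverse c)
qed

text \<open>A primitive of \<open>\<alpha>\<close> replaces a coordinate \<open>i\<close> with \<open>\<alpha>(i) \<noteq> 0\<close>, which depends on the point.  A permutation of
  the axes then moves it to the prescribed position \<open>b\<close>, as the transverse coordinate of a foliation must
  be the same in all charts.\<close>

lemma closed_form_adapted_chart:
  assumes \<alpha>: "diff_form A 1 \<alpha>" and closed: "ext_deriv \<alpha> = 0" and b: "b \<in> Basis"
    and c: "c \<in> A" "p \<in> fst c" and nz: "\<alpha> c (snd c p) [u] \<noteq> 0"
  shows "\<exists>c'\<in>A. p \<in> fst c' \<and> (\<forall>x\<in>crange c'. \<forall>v. \<alpha> c' x [v] = v \<bullet> b)"
proof -
  note ch = chart[OF c(1)]
  have pc: "snd c p \<in> crange c" using c by simp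
  obtain i where i: "i \<in> Basis" "\<alpha> c (snd c p) [i] \<noteq> 0"
  proof (rule ccontr)
    assume "\<not> thesis"
    then have "\<forall>i\<in>Basis. \<alpha> c (snd c p) [i] = 0" using that by blast
    then show False using nz linear_family_sum[OF diff_form_1_linear[OF \<alpha> c(1) pc], of u] by simp
  qed
  have cont: "continuous_on (crange c) (\<lambda>x. \<alpha> c x [i])"
    by (rule smooth_on_continuous[OF diff_form_1_smooth[OF \<alpha> c(1)]])
  have "open (crange c \<inter> (\<lambda>x. \<alpha> c x [i]) -` (- {0}))"
    by (rule continuous_open_preimage[OF cont open_crange[OF ch]]) auto
  then obtain r where r: "r > 0" "ball (snd c p) r \<subseteq> crange c \<inter> (\<lambda>x. \<alpha> c x [i]) -` (- {0})"
    using i(2) pc by (metis (no_types, lifting) ComplI IntI openE singletonD vimageI)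
  define V where "V = ball (snd c p) r"
  have V: "open V" "convex V" "V \<subseteq> crange c" "snd c p \<in> V" "\<And>x. x \<in> V \<Longrightarrow> \<alpha> c x [i] \<noteq> 0"
    unfolding V_def using r by auto
  obtain f where f: "\<And>x. x \<in> V \<Longrightarrow> (f has_derivative (\<lambda>v. \<alpha> c x [v])) (at x)"
  proof -
    have "\<exists>f. \<forall>x\<in>V. (f has_derivative (\<lambda>v. \<alpha> c x [v])) (at x)"
    proof (rule closed_covector_field_primitive[OF V(1,2)])
      show "linear (\<lambda>v. \<alpha> c y [v])" if "y \<in> V" for y
        using diff_form_1_linear[OF \<alpha> c(1)] that V(3) by blast
      show "smooth_on V (\<lambda>y. \<alpha> c y [v])" for v
        by (rule smooth_on_subset[OF diff_form_1_smooth[OF \<alpha> c(1)] V(3)])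
      show "Dt (\<lambda>y. \<alpha> c y [v]) x u = Dt (\<lambda>y. \<alpha> c y [u]) x v" if x: "x \<in> V" for x u v
      proof -
        have "curl \<alpha> c x u v = 0" using closed ext_deriv_1_eq_0_iff[OF \<alpha>] c(1) x V(3) by blast
        then show ?thesis by (simp add: curl_def)
      qed
    qed
    then show thesis using that by blast
  qed
  have Df: "Dt f x = (\<lambda>v. \<alpha> c x [v])" if "x \<in> V" for x by (rule Dt_eqI[OF f[OF that]])
  have smf: "smooth_on V f"
    by (rule smooth_on_derivI[OF V(1) f], assumption) (rule smooth_on_subset[OF diff_form_1_smooth[OF \<alpha> c(1)] V(3)])
  define \<Phi> where "\<Phi> x = x + (f x - x \<bullet> i) *\<^sub>R i" for x
  have nzf: "Dt f x i \<noteq> 0" if "x \<in> V" for x using V(5)[OF that] Df[OF that] by simp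
  have rc: "smooth_on V \<Phi>" "open (\<Phi> ` V)" "inj_on \<Phi> V" "smooth_on (\<Phi> ` V) (inv_into V \<Phi>)"
    using replace_coordinate[OF V(1,2) i(1) smf] nzf unfolding \<Phi>_def by blast+
  define c1 where "c1 = (fst c \<inter> snd c -` V, \<Phi> \<circ> snd c)"
  have c1: "c1 \<in> A"
    unfolding c1_def
    by (rule change_coordinates[OF c(1) V(1,3) rc(1,4,2)]) (rule inv_into_f_f[OF rc(3)])
  have \<alpha>1: "\<alpha> c1 (snd c1 q) [v] = v \<bullet> i" if q: "q \<in> fst c1" for q v
  proof (rule form_is_coordinate_differential[OF \<alpha> c(1) c1 _ q])
    have qc: "q \<in> fst c" "snd c q \<in> V" using q by (auto simp: c1_def)
    show "q \<in> fst c" by (rule qc)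
    show "((\<lambda>x. transition c c1 x \<bullet> i) has_derivative (\<lambda>w. \<alpha> c (snd c q) [w])) (at (snd c q))"
    proof (rule has_derivative_transform_within_open[OF f[OF qc(2)] V(1) qc(2)])
      fix x assume x: "x \<in> V"
      then have "transition c c1 (snd c (cinv c x)) = snd c1 (cinv c x)"
        using V(3) by (intro transition_apply[OF ch] cinv_in) auto
      then have "transition c c1 x = \<Phi> x" using snd_cinv[of x c] x V(3) by (auto simp: c1_def)
      then show "f x = transition c c1 x \<bullet> i" using i(1) by (simp add: \<Phi>_def inner_add_left)
    qed
  qed
  \<comment> \<open>The reflection exchanging the coordinate axes \<open>b\<close> and \<open>i\<close>; it is the identity if they agree.\<close>
  define L where "L x = x - ((b - i) \<bullet> x) *\<^sub>R (b - i)" for x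
  have Lb: "L x \<bullet> b = x \<bullet> i" for x
    using b i(1) by (cases "b = i") (auto simp: L_def inner_diff_left inner_diff_right inner_Basis inner_commute)
  have LL: "L (L x) = x" for x
    using b i(1)
    by (cases "b = i") (auto simp: L_def inner_diff_left inner_diff_right inner_Basis inner_commute algebra_simps)
  have smL: "smooth_on S L" if "open S" for S
  proof -
    have "bounded_linear L"
      unfolding L_def by (intro bounded_linear_sub bounded_linear_ident bounded_linear_scaleR_const bounded_linear_inner_right)
    then show ?thesis by (rule smooth_on_bounded_linear[OF _ that smooth_on_id[OF that]])
  qed
  note ch1 = chart[OF c1]
  have opL: "open (L ` crange c1)"
  proof -
    have "L ` crange c1 = L -` crange c1" by (rule set_eqI) (metis LL imageE imageI vimage_eq)
    moreover have "continuous_on UNIV L" by (rule smooth_on_continuous[OF smL]) simp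
    ultimately show ?thesis using open_vimage open_crange[OF ch1] by metis
  qed
  define c2 where "c2 = (fst c1 \<inter> snd c1 -` crange c1, L \<circ> snd c1)"
  have c2: "c2 \<in> A"
    unfolding c2_def
    by (rule change_coordinates[OF c1 open_crange[OF ch1] order_refl smL smL opL LL])
      (use open_crange[OF ch1] opL in auto)
  have \<alpha>2: "\<alpha> c2 (snd c2 q) [v] = v \<bullet> b" if q: "q \<in> fst c2" for q v
  proof (rule form_is_coordinate_differential[OF \<alpha> c1 c2 _ q])
    show q1: "q \<in> fst c1" using q by (simp add: c2_def)
    have "((\<lambda>x. x \<bullet> i) has_derivative (\<lambda>w. w \<bullet> i)) (at (snd c1 q))"
      by (auto intro!: derivative_eq_intros)
    then show "((\<lambda>x. transition c1 c2 x \<bullet> b) has_derivative (\<lambda>w. \<alpha> c1 (snd c1 q) [w])) (at (snd c1 q))"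
      unfolding \<alpha>1[OF q1]
    proof (rule has_derivative_transform_within_open[OF _ open_crange[OF ch1]])
      show "snd c1 q \<in> crange c1" using q1 by simp
      show "x \<bullet> i = transition c1 c2 x \<bullet> b" if "x \<in> crange c1" for x
        using that transition_apply[OF ch1, of _ c2] Lb by (auto simp: c2_def)
    qed
  qed
  have "p \<in> fst c2" using c(2) V(4) by (auto simp: c2_def c1_def)
  then show ?thesis using c2 \<alpha>2 by (intro bexI[of _ c2]) auto
qed

end

section \<open>The foliation defined by a closed characteristic form\<close>

lemma same_plaque_singleton: "same_plaque {b} u v \<longleftrightarrow> u \<bullet> b = v \<bullet> b"
  by (simp add: same_plaque_def)

abbreviation same_plaques_on :: "'e::euclidean_space set \<Rightarrow> ('m, 'e) chart \<Rightarrow> ('m, 'e) chart \<Rightarrow> 'm set \<Rightarrow> bool" where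
  "same_plaques_on Q c c' W \<equiv>
     \<forall>q\<in>W. \<forall>r\<in>W. same_plaque Q (snd c q) (snd c r) \<longleftrightarrow> same_plaque Q (snd c' q) (snd c' r)"

lemma foliated_compatibleE:
  assumes "foliated_compatible Q c c'" "p \<in> fst c" "p \<in> fst c'"
  obtains W where "open W" "p \<in> W" "W \<subseteq> fst c \<inter> fst c'" "same_plaques_on Q c c' W"
  using assms(1)[unfolded foliated_compatible_def, rule_format, OF IntI[OF assms(2,3)]] that by blast

lemma span_hyperplane_insert:
  fixes b w :: "'e::euclidean_space"
  assumes "b \<in> Basis"
  shows "span (insert w {v. v \<bullet> b = 0}) = UNIV \<longleftrightarrow> w \<bullet> b \<noteq> 0"
proof
  assume span: "span (insert w {v. v \<bullet> b = 0}) = UNIV"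
  show "w \<bullet> b \<noteq> 0"
  proof
    assume "w \<bullet> b = 0"
    then have "insert w {v. v \<bullet> b = 0} \<subseteq> {v. v \<bullet> b = 0}" by auto
    moreover have "subspace {v. v \<bullet> b = 0}"
      by (auto simp: subspace_def inner_add_left)
    ultimately have "span (insert w {v. v \<bullet> b = 0}) \<subseteq> {v. v \<bullet> b = 0}"
      by (rule span_minimal)
    then have "b \<in> {v. v \<bullet> b = 0}" using span by blast
    then show False using assms by simp
  qed
next
  assume w: "w \<bullet> b \<noteq> 0"
  have "v \<in> span (insert w {v. v \<bullet> b = 0})" for v
  proof -
    have "v - (v \<bullet> b / (w \<bullet> b)) *\<^sub>R w \<in> span (insert w {v. v \<bullet> b = 0})"
      by (rule span_base) (use w in \<open>simp add: inner_diff_left\<close>)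
    moreover have "(v \<bullet> b / (w \<bullet> b)) *\<^sub>R w \<in> span (insert w {v. v \<bullet> b = 0})"
      by (intro span_scale span_base) simp
    ultimately show ?thesis using span_add by fastforce
  qed
  then show "span (insert w {v. v \<bullet> b = 0}) = UNIV" by blast
qed

text \<open>By the mean value theorem \<open>h y - h x\<close> is a nonzero multiple of \<open>(y - x) \<bullet> b\<close>.\<close>

lemma level_sets_hyperplanes:
  fixes h :: "'e::euclidean_space \<Rightarrow> real"
  assumes U: "convex U" and der: "\<And>x. x \<in> U \<Longrightarrow> (h has_derivative (\<lambda>v. \<mu> x * (v \<bullet> b))) (at x)"
    and nz: "\<And>x. x \<in> U \<Longrightarrow> \<mu> x \<noteq> 0" and xy: "x \<in> U" "y \<in> U"
  shows "h x = h y \<longleftrightarrow> x \<bullet> b = y \<bullet> b"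
proof -
  have seg: "x + t *\<^sub>R (y - x) \<in> U" if "0 \<le> t" "t \<le> 1" for t
    using convexD_alt[OF U xy, of t] that by (simp add: algebra_simps)
  have "((\<lambda>t. h (x + t *\<^sub>R (y - x))) has_real_derivative \<mu> (x + t *\<^sub>R (y - x)) * ((y - x) \<bullet> b)) (at t)"
    if "0 \<le> t" "t \<le> 1" for t
  proof -
    have d: "((\<lambda>t. x + t *\<^sub>R (y - x)) has_derivative (\<lambda>r. r *\<^sub>R (y - x))) (at t)"
      by (auto intro!: derivative_eq_intros)
    have "\<mu> z * (r *\<^sub>R (y - x) \<bullet> b) = (\<mu> z * ((y - x) \<bullet> b)) * r" for z r by simp
    then show ?thesis
      using has_derivative_compose[OF d der[OF seg[OF that]]]
      unfolding has_field_derivative_def by (simp only:)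
  qed
  then obtain t where t: "0 < t" "t < 1"
    "h (x + 1 *\<^sub>R (y - x)) - h (x + 0 *\<^sub>R (y - x)) = (1 - 0) * (\<mu> (x + t *\<^sub>R (y - x)) * ((y - x) \<bullet> b))"
    using MVT2[of 0 1 "\<lambda>t. h (x + t *\<^sub>R (y - x))" "\<lambda>t. \<mu> (x + t *\<^sub>R (y - x)) * ((y - x) \<bullet> b)"] by auto
  then have "h y - h x = \<mu> (x + t *\<^sub>R (y - x)) * (y \<bullet> b - x \<bullet> b)" by (simp add: inner_diff_left)
  then show ?thesis using nz[OF seg[of t]] t by auto
qed

lemma derivative_zero_along_hyperplane:
  fixes h :: "'e::euclidean_space \<Rightarrow> real"
  assumes hd: "(h has_derivative h') (at x)" and N: "open N" "x \<in> N"
    and const: "\<And>y. y \<in> N \<Longrightarrow> y \<bullet> b = x \<bullet> b \<Longrightarrow> h y = h x" and v: "v \<bullet> b = 0"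
  shows "h' v = 0"
proof -
  have line: "((\<lambda>s. x + s *\<^sub>R v) has_derivative (\<lambda>r. r *\<^sub>R v)) (at 0)"
    by (auto intro!: derivative_eq_intros)
  have "((\<lambda>s. h (x + s *\<^sub>R v)) has_derivative (\<lambda>r. h' (r *\<^sub>R v))) (at 0)"
    by (rule has_derivative_compose[OF line]) (use hd in simp)
  moreover have "((\<lambda>s. h (x + s *\<^sub>R v)) has_derivative (\<lambda>r. 0)) (at 0)"
  proof (rule has_derivative_transform_within_open[OF has_derivative_const[of "h x"]])
    have "continuous_on UNIV (\<lambda>s. x + s *\<^sub>R v)" by (intro continuous_intros)
    then show "open ((\<lambda>s. x + s *\<^sub>R v) -` N)" by (rule open_vimage[OF N(1)])
    show "0 \<in> (\<lambda>s. x + s *\<^sub>R v) -` N" using N(2) by simp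
    show "h x = h (x + s *\<^sub>R v)" if "s \<in> (\<lambda>s. x + s *\<^sub>R v) -` N" for s
      using const[of "x + s *\<^sub>R v"] that v by (simp add: inner_add_left)
  qed
  ultimately have "(\<lambda>r. h' (r *\<^sub>R v)) = (\<lambda>r. 0)"
    by (rule has_derivative_unique)
  from fun_cong[OF this, of 1] show ?thesis by simp
qed

text \<open>Along a line in a plaque of \<open>c\<close> the transverse coordinate of \<open>c'\<close> is constant.\<close>

lemma (in smooth_manifold) foliated_compatible_derivative:
  assumes c: "c \<in> A" "c' \<in> A" "p \<in> fst c" "p \<in> fst c'" and fc: "foliated_compatible {b} c c'"
    and v: "v \<bullet> b = 0"
  shows "dtransition c c' p v \<bullet> b = 0"
proof -
  note ch = chart[OF c(1)]
  obtain W where W: "open W" "p \<in> W" "W \<subseteq> fst c \<inter> fst c'"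
    and eq: "same_plaques_on {b} c c' W"
    by (rule foliated_compatibleE[OF fc c(3,4)]) (rule that)
  define N where "N = snd c ` (fst c \<inter> W)"
  define x where "x = snd c p"
  have N: "open N" "x \<in> N" unfolding N_def x_def using open_chart_image[OF ch W(1)] c W by auto
  define h where "h y = transition c c' y \<bullet> b" for y
  have hd: "(h has_derivative (\<lambda>w. dtransition c c' p w \<bullet> b)) (at x)"
    unfolding h_def x_def by (intro has_derivative_inner_left has_derivative_transition c)
  have const: "h y = h x" if y: "y \<in> N" "y \<bullet> b = x \<bullet> b" for y
  proof -
    obtain q where q: "q \<in> fst c" "q \<in> W" "y = snd c q" using y(1) N_def by blast
    have "same_plaque {b} (snd c' q) (snd c' p)"
      using eq[rule_format, OF q(2) W(2)] y(2) by (simp add: same_plaque_singleton q(3) x_def)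
    then show ?thesis
      using transition_apply[OF ch q(1), of c'] transition_apply[OF ch c(3), of c']
      by (simp add: h_def q(3) x_def same_plaque_singleton)
  qed
  show ?thesis
    by (rule derivative_zero_along_hyperplane[OF hd N const v])
qed

context closed_manifold_field
begin

text \<open>The charts whose plaques have the kernel of \<open>\<alpha>\<close> as tangent spaces.\<close>

definition kernel_atlas :: "('m, 'e) tensor \<Rightarrow> 'e \<Rightarrow> ('m, 'e) chart set" where
  "kernel_atlas \<alpha> b = {c \<in> A. \<forall>x\<in>crange c. \<forall>v. v \<bullet> b = 0 \<longrightarrow> \<alpha> c x [v] = 0}"

context
  fixes \<alpha> :: "('m, 'e) tensor" and b :: 'e
  assumes \<alpha>: "diff_form A 1 \<alpha>" and \<alpha>X: "\<And>c x. c \<in> A \<Longrightarrow> x \<in> crange c \<Longrightarrow> \<alpha> c x [X c x] = 1"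
    and b: "b \<in> Basis"
begin

lemma kernel_atlas_in: "c \<in> kernel_atlas \<alpha> b \<Longrightarrow> c \<in> A"
  by (simp add: kernel_atlas_def)

lemma kernel_atlas_form:
  assumes c: "c \<in> kernel_atlas \<alpha> b" "x \<in> crange c"
  shows "\<alpha> c x [v] = \<alpha> c x [b] * (v \<bullet> b)" and "\<alpha> c x [b] \<noteq> 0" and "X c x \<bullet> b \<noteq> 0"
proof -
  have cA: "c \<in> A" using c kernel_atlas_in by blast
  note lin = diff_form_1_linear[OF \<alpha> cA c(2)]
  show eq: "\<alpha> c x [v] = \<alpha> c x [b] * (v \<bullet> b)" for v
  proof -
    have "\<alpha> c x [v - (v \<bullet> b) *\<^sub>R b] = 0"
    proof -
      have "(v - (v \<bullet> b) *\<^sub>R b) \<bullet> b = 0" using b by (simp add: inner_diff_left)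
      then show ?thesis using c unfolding kernel_atlas_def by blast
    qed
    then show ?thesis unfolding linear_diff[OF lin] linear_scale[OF lin] by simp
  qed
  have "\<alpha> c x [b] * (X c x \<bullet> b) = 1" using eq[of "X c x"] \<alpha>X[OF cA c(2)] by simp
  then show "\<alpha> c x [b] \<noteq> 0" "X c x \<bullet> b \<noteq> 0" by auto
qed

text \<open>In both charts the kernel of \<open>\<alpha>\<close> is the hyperplane orthogonal to \<open>b\<close>, so the differential of the
  transverse coordinate of one chart is a nowhere zero multiple of that of the other.\<close>

lemma kernel_atlas_compatible:
  assumes c: "c \<in> kernel_atlas \<alpha> b" "c' \<in> kernel_atlas \<alpha> b"
  shows "foliated_compatible {b} c c'"
  unfolding foliated_compatible_def
proof
  fix p assume p: "p \<in> fst c \<inter> fst c'"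
  have cA: "c \<in> A" "c' \<in> A" using c kernel_atlas_in by blast+
  note ch = chart[OF cA(1)]
  let ?O = "snd c ` (fst c \<inter> fst c')"
  obtain r where r: "r > 0" "ball (snd c p) r \<subseteq> ?O"
    using open_overlap[OF cA] p by (meson imageI openE)
  define W where "W = fst c \<inter> snd c -` ball (snd c p) r"
  have W: "open W" "p \<in> W" unfolding W_def using open_chart_preimage[OF ch] p r by auto
  have W': "q \<in> fst c \<and> q \<in> fst c' \<and> snd c q \<in> ball (snd c p) r" if q: "q \<in> W" for q
  proof -
    have "snd c q \<in> ?O" using q r(2) W_def by blast
    then obtain q' where "q' \<in> fst c \<inter> fst c'" "snd c q = snd c q'" by blast
    then have "q = q'" using inj_onD[OF inj_on_chart[OF ch], of q q'] q W_def by blast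
    then show ?thesis using q \<open>q' \<in> _\<close> W_def by blast
  qed
  define h where "h y = transition c c' y \<bullet> b" for y
  define \<mu> where "\<mu> y = \<alpha> c y [b] / \<alpha> c' (transition c c' y) [b]" for y
  have level: "h x = h y \<longleftrightarrow> x \<bullet> b = y \<bullet> b" if xy: "x \<in> ball (snd c p) r" "y \<in> ball (snd c p) r" for x y
  proof (rule level_sets_hyperplanes[OF convex_ball _ _ xy])
    fix y assume "y \<in> ball (snd c p) r"
    then obtain q where q: "q \<in> fst c" "q \<in> fst c'" "y = snd c q" using r(2) by blast
    note tq = transition_apply[OF ch q(1), of c']
    have cr: "snd c q \<in> crange c" "snd c' q \<in> crange c'" using q by auto
    have "\<mu> y * (v \<bullet> b) = dtransition c c' q v \<bullet> b" for v
    proof -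
      have "\<alpha> c (snd c q) [b] * (v \<bullet> b) = \<alpha> c' (snd c' q) [b] * (dtransition c c' q v \<bullet> b)"
        using diff_form_1_transition[OF \<alpha> cA q(1,2), of v] kernel_atlas_form(1)[OF c(1) cr(1), of v]
          kernel_atlas_form(1)[OF c(2) cr(2), of "dtransition c c' q v"] by argo
      then show ?thesis
        using kernel_atlas_form(2)[OF c(2) cr(2)] by (simp add: \<mu>_def q(3) tq field_simps)
    qed
    then have eq: "(\<lambda>v. \<mu> y * (v \<bullet> b)) = (\<lambda>v. dtransition c c' q v \<bullet> b)" by blast
    show "(h has_derivative (\<lambda>v. \<mu> y * (v \<bullet> b))) (at y)"
      unfolding eq unfolding h_def q(3) by (intro has_derivative_inner_left has_derivative_transition cA q)
    show "\<mu> y \<noteq> 0"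
      using kernel_atlas_form(2)[OF c(1) cr(1)] kernel_atlas_form(2)[OF c(2) cr(2)]
      by (simp add: \<mu>_def q(3) tq)
  qed
  have "same_plaque {b} (snd c q) (snd c r) \<longleftrightarrow> same_plaque {b} (snd c' q) (snd c' r)"
    if "q \<in> W" "r \<in> W" for q r
    using level[of "snd c q" "snd c r"] W'[OF that(1)] W'[OF that(2)]
      transition_apply[OF ch, of q c'] transition_apply[OF ch, of r c']
    by (simp add: h_def same_plaque_singleton)
  then show "\<exists>W. open W \<and> p \<in> W \<and> W \<subseteq> fst c \<inter> fst c' \<and> same_plaques_on {b} c c' W"
    using W W' by (intro exI[of _ W]) auto
qed

lemma adapted_chart_in_kernel_atlas:
  assumes closed: "ext_deriv \<alpha> = 0"
  shows "\<exists>c\<in>kernel_atlas \<alpha> b. p \<in> fst c \<and> (\<forall>x\<in>crange c. \<forall>v. \<alpha> c x [v] = v \<bullet> b)"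
proof -
  obtain c where c: "c \<in> A" "p \<in> fst c" using ex_chart by blast
  have "\<alpha> c (snd c p) [X c (snd c p)] \<noteq> 0" using \<alpha>X[OF c(1)] c(2) by simp
  then obtain c' where "c' \<in> A" "p \<in> fst c'" "\<forall>x\<in>crange c'. \<forall>v. \<alpha> c' x [v] = v \<bullet> b"
    using closed_form_adapted_chart[OF \<alpha> closed b c] by blast
  then show ?thesis unfolding kernel_atlas_def by (intro bexI[of _ c']) auto
qed

text \<open>Adapted charts cover the manifold because \<open>\<alpha>\<close> is closed.  The atlas is maximal because compatibility
  with an adapted chart already determines the tangent spaces of the plaques.\<close>

lemma kernel_atlas_foliation:
  assumes closed: "ext_deriv \<alpha> = 0"
  shows "foliation A {b} (kernel_atlas \<alpha> b)"
  unfolding foliation_def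
proof (intro conjI ballI impI)
  show "{b} \<subseteq> Basis" using b by simp
  show "kernel_atlas \<alpha> b \<subseteq> A" using kernel_atlas_in by blast
  show "(\<Union>c\<in>kernel_atlas \<alpha> b. fst c) = UNIV"
    using adapted_chart_in_kernel_atlas[OF closed] by blast
  show "foliated_compatible {b} c c'" if "c \<in> kernel_atlas \<alpha> b" "c' \<in> kernel_atlas \<alpha> b" for c c'
    using that by (rule kernel_atlas_compatible)
next
  fix c assume c: "c \<in> A" and fc: "\<forall>c'\<in>kernel_atlas \<alpha> b. foliated_compatible {b} c c'"
  have "\<alpha> c x [v] = 0" if x: "x \<in> crange c" and v: "v \<bullet> b = 0" for x v
  proof -
    obtain p where p: "p \<in> fst c" "x = snd c p" using x by blast
    obtain c' where c': "c' \<in> kernel_atlas \<alpha> b" "p \<in> fst c'"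
      using adapted_chart_in_kernel_atlas[OF closed] by blast
    have c'A: "c' \<in> A" using c'(1) kernel_atlas_in by blast
    have "\<alpha> c x [v] = \<alpha> c' (snd c' p) [dtransition c c' p v]"
      unfolding p(2) by (rule diff_form_1_transition[OF \<alpha> c c'A p(1) c'(2)])
    also have "\<dots> = \<alpha> c' (snd c' p) [b] * (dtransition c c' p v \<bullet> b)"
      by (rule kernel_atlas_form(1)[OF c'(1)]) (use c'(2) in simp)
    also have "dtransition c c' p v \<bullet> b = 0"
      by (rule foliated_compatible_derivative[OF c c'A p(1) c'(2) _ v]) (use fc c'(1) in blast)
    finally show ?thesis by simp
  qed
  then show "c \<in> kernel_atlas \<alpha> b" unfolding kernel_atlas_def using c by blast
qed

lemma kernel_atlas_transverse: "transverse_foliation X {b} (kernel_atlas \<alpha> b)"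
  unfolding transverse_foliation_def
  by (simp add: span_hyperplane_insert[OF b] kernel_atlas_form(3))

text \<open>Continuity is included since the neighbourhoods that witness compatibility are pulled back by the
  flow.\<close>

definition preserved :: "real \<Rightarrow> bool" where
  "preserved t \<longleftrightarrow> continuous_on UNIV (flow A X t) \<and> (\<forall>c\<in>kernel_atlas \<alpha> b. \<forall>c'\<in>kernel_atlas \<alpha> b.
     foliated_compatible {b} (pullback_chart (flow A X t) c) c')"

text \<open>In a chart with \<open>\<alpha>(v) = v \<bullet> b\<close> the flow moves the transverse coordinate at unit speed, so for small
  times it maps plaques to plaques.\<close>

lemma adapted_flow_box:
  assumes closed: "ext_deriv \<alpha> = 0"
  shows "\<exists>V \<delta> c. open V \<and> p \<in> V \<and> \<delta> > 0 \<and> c \<in> kernel_atlas \<alpha> b \<and> V \<subseteq> fst c \<and>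
    (\<forall>t. \<bar>t\<bar> < \<delta> \<longrightarrow> continuous_on V (flow A X t) \<and>
      (\<forall>q\<in>V. flow A X t q \<in> fst c \<and> snd c (flow A X t q) \<bullet> b = snd c q \<bullet> b + t))"
proof -
  obtain c where c: "c \<in> kernel_atlas \<alpha> b" "p \<in> fst c"
    and ad: "\<And>x v. x \<in> crange c \<Longrightarrow> \<alpha> c x [v] = v \<bullet> b"
    using adapted_chart_in_kernel_atlas[OF closed] by blast
  have cA: "c \<in> A" using c(1) kernel_atlas_in by blast
  obtain V \<delta> where V: "open V" "p \<in> V" "V \<subseteq> fst c" "\<delta> > 0"
    "\<And>q t. q \<in> V \<Longrightarrow> \<bar>t\<bar> < \<delta> \<Longrightarrow> flow A X t q \<in> fst c"
    "\<And>t. \<bar>t\<bar> < \<delta> \<Longrightarrow> continuous_on V (flow A X t)"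
    by (rule flow_box[OF cA c(2)]) (rule that)
  have "snd c (flow A X t q) \<bullet> b = snd c q \<bullet> b + t" if q: "q \<in> V" and t: "\<bar>t\<bar> < \<delta>" for q t
  proof -
    define k where "k s = snd c (flow A X s q) \<bullet> b - s" for s
    have k': "(k has_derivative (\<lambda>h. 0)) (at s within {-\<delta><..<\<delta>})" if s: "s \<in> {-\<delta><..<\<delta>}" for s
    proof -
      have fs: "flow A X s q \<in> fst c" using V(5)[OF q] s by (simp add: abs_less_iff)
      have "X c (snd c (flow A X s q)) \<bullet> b = 1"
        using ad[of "snd c (flow A X s q)" "X c (snd c (flow A X s q))"]
          \<alpha>X[OF cA, of "snd c (flow A X s q)"] fs by simp
      moreover have "((\<lambda>s. snd c (flow A X s q)) has_derivative (\<lambda>r. r *\<^sub>R X c (snd c (flow A X s q)))) (at s)"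
        using flow_velocity[OF cA fs] unfolding has_vector_derivative_def .
      ultimately have "(k has_derivative (\<lambda>h. 0)) (at s)"
        unfolding k_def
        by (intro has_derivative_eq_rhs[OF has_derivative_diff[OF has_derivative_inner_left has_derivative_ident]])
          (auto simp: fun_eq_iff)
      then show ?thesis by (rule has_derivative_at_withinI)
    qed
    have "k t = k 0"
    proof (rule has_derivative_zero_unique[OF _ k'])
      show "convex {-\<delta><..<\<delta>}" by simp
      show "t \<in> {-\<delta><..<\<delta>}" "0 \<in> {-\<delta><..<\<delta>}" using t V(4) by auto
    qed
    then show ?thesis by (simp add: k_def flow_0)
  qed
  then show ?thesis
    by (intro exI[of _ V] exI[of _ \<delta>] exI[of _ c] conjI allI impI ballI V c(1))
qed

lemma preserved_small:
  assumes closed: "ext_deriv \<alpha> = 0"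
  obtains \<delta> where "\<delta> > 0" "\<And>t. \<bar>t\<bar> < \<delta> \<Longrightarrow> preserved t"
proof -
  define moved where "moved V c t \<longleftrightarrow> open V \<and> c \<in> kernel_atlas \<alpha> b \<and> V \<subseteq> fst c \<and> continuous_on V (flow A X t) \<and>
    (\<forall>q\<in>V. flow A X t q \<in> fst c \<and> snd c (flow A X t q) \<bullet> b = snd c q \<bullet> b + t)"
    for V :: "'m set" and c :: "('m, 'e) chart" and t :: real
  obtain \<delta> where \<delta>: "\<delta> > 0" "\<And>p. \<forall>t. \<bar>t\<bar> < \<delta> \<longrightarrow> (\<exists>V c. p \<in> V \<and> moved V c t)"
  proof (rule uniform_on_manifold[of "\<lambda>p \<delta>. \<forall>t. \<bar>t\<bar> < \<delta> \<longrightarrow> (\<exists>V c. p \<in> V \<and> moved V c t)"])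
    fix p
    show "\<exists>V \<delta>. open V \<and> p \<in> V \<and> \<delta> > 0 \<and> (\<forall>q\<in>V. \<forall>t. \<bar>t\<bar> < \<delta> \<longrightarrow> (\<exists>V c. q \<in> V \<and> moved V c t))"
    proof -
      obtain V \<delta> c where V: "open V" "p \<in> V" "\<delta> > 0" "c \<in> kernel_atlas \<alpha> b" "V \<subseteq> fst c"
        and fl: "\<forall>t. \<bar>t\<bar> < \<delta> \<longrightarrow> continuous_on V (flow A X t) \<and>
          (\<forall>q\<in>V. flow A X t q \<in> fst c \<and> snd c (flow A X t q) \<bullet> b = snd c q \<bullet> b + t)"
        using adapted_flow_box[OF closed, of p] by (elim exE conjE)
      have "moved V c t" if "\<bar>t\<bar> < \<delta>" for t
        unfolding moved_def using V(1,4,5) fl that by simp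
      then show ?thesis using V(1-3) by metis
    qed
  next
    show "\<forall>t. \<bar>t\<bar> < \<delta>' \<longrightarrow> (\<exists>V c. q \<in> V \<and> moved V c t)"
      if "\<forall>t. \<bar>t\<bar> < \<delta> \<longrightarrow> (\<exists>V c. q \<in> V \<and> moved V c t)" "\<delta>' \<le> \<delta>" for q and \<delta> \<delta>' :: real
      using that by (meson less_le_trans)
  qed (rule that)
  have "preserved t" if t: "\<bar>t\<bar> < \<delta>" for t
  proof -
    have "isCont (flow A X t) p" for p
    proof -
      obtain V c where "p \<in> V" "moved V c t" using \<delta>(2)[of p] t by blast
      then show ?thesis unfolding moved_def by (metis continuous_on_eq_continuous_at)
    qed
    then have cont: "continuous_on UNIV (flow A X t)" by (simp add: continuous_at_imp_continuous_on)
    have "foliated_compatible {b} (pullback_chart (flow A X t) c1) c2"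
      if c12: "c1 \<in> kernel_atlas \<alpha> b" "c2 \<in> kernel_atlas \<alpha> b" for c1 c2
      unfolding foliated_compatible_def
    proof
      fix p assume "p \<in> fst (pullback_chart (flow A X t) c1) \<inter> fst c2"
      then have p: "flow A X t p \<in> fst c1" "p \<in> fst c2" by (auto simp: pullback_chart_def)
      obtain V c where pV: "p \<in> V" and V: "open V" "V \<subseteq> fst c" and c: "c \<in> kernel_atlas \<alpha> b"
        and fl: "\<And>q. q \<in> V \<Longrightarrow> flow A X t q \<in> fst c"
          "\<And>q. q \<in> V \<Longrightarrow> snd c (flow A X t q) \<bullet> b = snd c q \<bullet> b + t"
      proof -
        obtain V c where "p \<in> V" "moved V c t" using \<delta>(2)[of p] t by blast
        then show thesis using that[of V c] unfolding moved_def by (elim conjE) simp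
      qed
      obtain W1 where W1: "open W1" "flow A X t p \<in> W1" "W1 \<subseteq> fst c \<inter> fst c1" "same_plaques_on {b} c c1 W1"
        by (rule foliated_compatibleE[OF kernel_atlas_compatible[OF c c12(1)] fl(1)[OF pV] p(1)])
      obtain W2 where W2: "open W2" "p \<in> W2" "W2 \<subseteq> fst c \<inter> fst c2" "same_plaques_on {b} c c2 W2"
        by (rule foliated_compatibleE[OF kernel_atlas_compatible[OF c c12(2)] subsetD[OF V(2) pV] p(2)])
      define W where "W = V \<inter> W2 \<inter> flow A X t -` W1"
      have "open W" unfolding W_def using V(1) W2(1) open_vimage[OF W1(1) cont] by (intro open_Int)
      moreover have "p \<in> W" unfolding W_def using pV W2(2) W1(2) by simp
      moreover have "W \<subseteq> fst (pullback_chart (flow A X t) c1) \<inter> fst c2"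
        unfolding W_def pullback_chart_def using W1(3) W2(3) by auto
      moreover have "same_plaques_on {b} (pullback_chart (flow A X t) c1) c2 W"
      proof (intro ballI)
        fix q r assume "q \<in> W" "r \<in> W"
        then have qr: "q \<in> V" "q \<in> W2" "flow A X t q \<in> W1" "r \<in> V" "r \<in> W2" "flow A X t r \<in> W1"
          by (auto simp: W_def)
        show "same_plaque {b} (snd (pullback_chart (flow A X t) c1) q) (snd (pullback_chart (flow A X t) c1) r)
            \<longleftrightarrow> same_plaque {b} (snd c2 q) (snd c2 r)"
          using W1(4)[rule_format, OF qr(3,6)] W2(4)[rule_format, OF qr(2,5)] fl(2)[OF qr(1)] fl(2)[OF qr(4)]
          by (simp add: pullback_chart_def same_plaque_singleton)
      qed
      ultimately show "\<exists>W. open W \<and> p \<in> W \<and> W \<subseteq> fst (pullback_chart (flow A X t) c1) \<inter> fst c2 \<and>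
          same_plaques_on {b} (pullback_chart (flow A X t) c1) c2 W"
        by (intro exI[of _ W] conjI)
    qed
    then show ?thesis using cont unfolding preserved_def by blast
  qed
  then show thesis by (rule that[OF \<delta>(1)])
qed

lemma preserved_add:
  assumes closed: "ext_deriv \<alpha> = 0" and s: "preserved s" and t: "preserved t"
  shows "preserved (s + t)"
  unfolding preserved_def
proof (intro conjI ballI)
  have comp: "flow A X (s + t) = flow A X s \<circ> flow A X t" by (auto simp: flow_add)
  have cont: "continuous_on UNIV (flow A X s)" "continuous_on UNIV (flow A X t)"
    using s t unfolding preserved_def by blast+
  show "continuous_on UNIV (flow A X (s + t))"
    unfolding comp using cont continuous_on_compose continuous_on_subset by blast
  fix c1 c2 assume c12: "c1 \<in> kernel_atlas \<alpha> b" "c2 \<in> kernel_atlas \<alpha> b"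
  show "foliated_compatible {b} (pullback_chart (flow A X (s + t)) c1) c2"
    unfolding foliated_compatible_def
  proof
    fix p assume "p \<in> fst (pullback_chart (flow A X (s + t)) c1) \<inter> fst c2"
    then have p: "flow A X s (flow A X t p) \<in> fst c1" "p \<in> fst c2" by (auto simp: pullback_chart_def comp)
    obtain c where c: "c \<in> kernel_atlas \<alpha> b" "flow A X t p \<in> fst c"
      using adapted_chart_in_kernel_atlas[OF closed] by blast
    have fc: "foliated_compatible {b} (pullback_chart (flow A X s) c1) c"
      "foliated_compatible {b} (pullback_chart (flow A X t) c) c2"
      using s t c12 c(1) unfolding preserved_def by blast+
    obtain W1 where W1: "open W1" "flow A X t p \<in> W1" "W1 \<subseteq> fst (pullback_chart (flow A X s) c1) \<inter> fst c"
      "same_plaques_on {b} (pullback_chart (flow A X s) c1) c W1"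
      by (rule foliated_compatibleE[OF fc(1) _ c(2)]) (use p in \<open>simp add: pullback_chart_def\<close>)
    obtain W2 where W2: "open W2" "p \<in> W2" "W2 \<subseteq> fst (pullback_chart (flow A X t) c) \<inter> fst c2"
      "same_plaques_on {b} (pullback_chart (flow A X t) c) c2 W2"
      by (rule foliated_compatibleE[OF fc(2) _ p(2)]) (use c in \<open>simp add: pullback_chart_def\<close>)
    define W where "W = W2 \<inter> flow A X t -` W1"
    have "open W" unfolding W_def using W2(1) open_vimage[OF W1(1) cont(2)] by (intro open_Int)
    moreover have "p \<in> W" unfolding W_def using W2(2) W1(2) by simp
    moreover have "W \<subseteq> fst (pullback_chart (flow A X (s + t)) c1) \<inter> fst c2"
      using W1(3) W2(3) unfolding W_def pullback_chart_def comp by auto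
    moreover have "same_plaques_on {b} (pullback_chart (flow A X (s + t)) c1) c2 W"
    proof (intro ballI)
      fix q r assume "q \<in> W" "r \<in> W"
      then have qr: "q \<in> W2" "flow A X t q \<in> W1" "r \<in> W2" "flow A X t r \<in> W1"
        by (auto simp: W_def)
      show "same_plaque {b} (snd (pullback_chart (flow A X (s + t)) c1) q)
          (snd (pullback_chart (flow A X (s + t)) c1) r) \<longleftrightarrow> same_plaque {b} (snd c2 q) (snd c2 r)"
        using W1(4)[rule_format, OF qr(2,4)] W2(4)[rule_format, OF qr(1,3)]
        by (simp add: pullback_chart_def comp)
    qed
    ultimately show "\<exists>W. open W \<and> p \<in> W \<and> W \<subseteq> fst (pullback_chart (flow A X (s + t)) c1) \<inter> fst c2 \<and>
        same_plaques_on {b} (pullback_chart (flow A X (s + t)) c1) c2 W"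
      by (intro exI[of _ W] conjI)
  qed
qed

lemma kernel_atlas_flow_invariant:
  assumes closed: "ext_deriv \<alpha> = 0"
  shows "flow_invariant A X {b} (kernel_atlas \<alpha> b)"
proof -
  obtain \<delta> where \<delta>: "\<delta> > 0" "\<And>t. \<bar>t\<bar> < \<delta> \<Longrightarrow> preserved t"
    using preserved_small[OF closed] by blast
  have mult: "preserved (real n * s)" if s: "\<bar>s\<bar> < \<delta>" for n s
  proof (induction n)
    case 0
    then show ?case using \<delta> by simp
  next
    case (Suc n)
    have "real (Suc n) * s = s + real n * s" by (simp add: algebra_simps)
    then show ?case using preserved_add[OF closed \<delta>(2)[OF s] Suc.IH] by simp
  qed
  have "preserved t" for t
  proof -
    obtain n where n: "\<bar>t\<bar> / \<delta> < real n" using reals_Archimedean2 by blast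
    then have n0: "real n > 0" using \<delta>(1) by (meson abs_ge_zero divide_nonneg_pos le_less_trans)
    have "\<bar>t / real n\<bar> < \<delta>" using n n0 \<delta>(1) by (simp add: field_simps)
    from mult[OF this, of n] show ?thesis using n0 by simp
  qed
  then show ?thesis unfolding flow_invariant_def preserved_def by blast
qed

end

end

section \<open>The closed form defined by an invariant transverse foliation\<close>

context closed_manifold_field
begin

context
  fixes T :: "('m, 'e) chart set" and b :: 'e
  assumes fol: "foliation A {b} T" and trans: "transverse_foliation X {b} T"
    and inv: "flow_invariant A X {b} T"
begin

lemma foliation_normal: "b \<in> Basis"
  using fol unfolding foliation_def by blast

lemma foliation_in: "c \<in> T \<Longrightarrow> c \<in> A"
  using fol unfolding foliation_def by blast

lemma ex_foliation_chart: "\<exists>c\<in>T. p \<in> fst c"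
  using fol unfolding foliation_def by blast

lemma foliation_compatible: "c \<in> T \<Longrightarrow> c' \<in> T \<Longrightarrow> foliated_compatible {b} c c'"
  using fol unfolding foliation_def by blast

lemma foliation_transverse: "c \<in> T \<Longrightarrow> x \<in> crange c \<Longrightarrow> X c x \<bullet> b \<noteq> 0"
  using trans span_hyperplane_insert[OF foliation_normal, of "X c x"] unfolding transverse_foliation_def by auto

text \<open>For small \<open>t\<close> the flow maps the points of a plaque to points with equal transverse coordinate: this
  holds near each point by invariance, hence on the whole plaque by connectedness.  The neighbourhood
  given by invariance may shrink with \<open>t\<close>, but the plaque does not depend on \<open>t\<close>, so one may
  differentiate at \<open>t = 0\<close>.\<close>

lemma transverse_speed_constant_on_plaques:
  assumes c: "c \<in> T" "p \<in> fst c"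
  obtains r where "r > 0" "ball (snd c p) r \<subseteq> crange c"
    "\<And>y. y \<in> ball (snd c p) r \<Longrightarrow> y \<bullet> b = snd c p \<bullet> b \<Longrightarrow> X c y \<bullet> b = X c (snd c p) \<bullet> b"
proof -
  have cA: "c \<in> A" using c(1) foliation_in by blast
  note ch = chart[OF cA]
  define x where "x = snd c p"
  obtain V \<delta> where V: "open V" "p \<in> V" "V \<subseteq> fst c" "\<delta> > 0"
    "\<And>q t. q \<in> V \<Longrightarrow> \<bar>t\<bar> < \<delta> \<Longrightarrow> flow A X t q \<in> fst c"
    "\<And>t. \<bar>t\<bar> < \<delta> \<Longrightarrow> continuous_on V (flow A X t)"
    by (rule flow_box[OF cA c(2)]) (rule that)
  define N where "N = snd c ` (fst c \<inter> V)"
  have N: "open N" "x \<in> N" unfolding N_def x_def using open_chart_image[OF ch V(1)] c V(2) by auto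
  obtain r where r: "r > 0" "ball x r \<subseteq> N" using N openE by blast
  have Nc: "N \<subseteq> crange c" unfolding N_def by blast
  have q: "cinv c y \<in> V" "cinv c y \<in> fst c" "snd c (cinv c y) = y" if "y \<in> N" for y
  proof -
    obtain q where "q \<in> fst c" "q \<in> V" "y = snd c q" using \<open>y \<in> N\<close> N_def by blast
    then show "cinv c y \<in> V" "cinv c y \<in> fst c" "snd c (cinv c y) = y" using cinv_snd[OF ch] by auto
  qed
  define D where "D = ball x r \<inter> {y. b \<bullet> y = b \<bullet> x}"
  have DN: "y \<in> N" if "y \<in> D" for y using that r(2) D_def by blast
  have "convex D" unfolding D_def by (intro convex_Int convex_ball convex_hyperplane)
  then have conn: "connected D" by (rule convex_connected)
  have xD: "x \<in> D" using r(1) by (simp add: D_def)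
  define k where "k t y = snd c (flow A X t (cinv c y)) \<bullet> b" for t y
  have kconst: "k t x = k t y" if t: "\<bar>t\<bar> < \<delta>" and y: "y \<in> D" for t y
  proof (rule connected_local_const[OF conn xD y], rule ballI)
    fix z assume z: "z \<in> D"
    note qz = q[OF DN[OF z]]
    have "foliated_compatible {b} (pullback_chart (flow A X t) c) c"
      using inv c(1) unfolding flow_invariant_def by blast
    moreover have "cinv c z \<in> fst (pullback_chart (flow A X t) c)"
      using V(5)[OF qz(1) t] by (simp add: pullback_chart_def)
    ultimately obtain W where W: "open W" "cinv c z \<in> W" "W \<subseteq> fst (pullback_chart (flow A X t) c) \<inter> fst c"
      "same_plaques_on {b} (pullback_chart (flow A X t) c) c W"
      by (rule foliated_compatibleE[OF _ _ qz(2)]) (rule that)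
    define Z where "Z = snd c ` (fst c \<inter> W)"
    have Z: "open Z" "z \<in> Z" unfolding Z_def
      by (rule open_chart_image[OF ch W(1)], metis IntI imageI qz(2,3) W(2))
    have "k t z = k t z'" if z': "z' \<in> Z" "z' \<in> D" for z'
    proof -
      obtain q' where q': "q' \<in> fst c" "q' \<in> W" "z' = snd c q'" using z'(1) Z_def by blast
      have "cinv c z' = q'" using q' cinv_snd[OF ch] by simp
      moreover have "z \<bullet> b = z' \<bullet> b" using z z'(2) by (simp add: D_def inner_commute)
      ultimately show ?thesis
        using W(4)[rule_format, OF W(2) q'(2)] qz(3) q'(3) by (simp add: k_def pullback_chart_def same_plaque_singleton)
    qed
    then show "\<forall>\<^sub>F z' in at z within D. k t z = k t z'"
      unfolding eventually_at_topological using Z by blast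
  qed
  have kder: "((\<lambda>t. k t y) has_vector_derivative X c y \<bullet> b) (at 0)" if y: "y \<in> D" for y
  proof -
    note qy = q[OF DN[OF y]]
    have "flow A X 0 (cinv c y) \<in> fst c" using qy(2) by (simp add: flow_0)
    from flow_velocity[OF cA this] show ?thesis
      unfolding k_def by (intro bounded_linear.has_vector_derivative[OF bounded_linear_inner_left])
        (simp add: flow_0 qy(3))
  qed
  show thesis
  proof (rule that[of r])
    show "r > 0" by (rule r)
    show "ball (snd c p) r \<subseteq> crange c" using r(2) Nc by (simp add: x_def)
    fix y assume "y \<in> ball (snd c p) r" "y \<bullet> b = snd c p \<bullet> b"
    then have y: "y \<in> D" by (simp add: D_def x_def inner_commute)
    have "((\<lambda>t. k t x) has_vector_derivative X c y \<bullet> b) (at 0)"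
    proof (rule has_vector_derivative_transform_within_open[OF kder[OF y], where S = "{-\<delta><..<\<delta>}"])
      show "k t y = k t x" if "t \<in> {-\<delta><..<\<delta>}" for t
        using kconst[OF _ y, of t] that by (simp add: abs_less_iff)
    qed (use V(4) in auto)
    then show "X c y \<bullet> b = X c (snd c p) \<bullet> b"
      using kder[OF xD] unfolding x_def by (rule vector_derivative_unique_at)
  qed
qed

definition foliation_covector :: "('m, 'e) chart \<Rightarrow> 'e \<Rightarrow> 'e \<Rightarrow> real" where
  "foliation_covector c x v = (let p = cinv c x; c' = (SOME c'. c' \<in> T \<and> p \<in> fst c')
     in (dtransition c c' p v \<bullet> b) / (X c' (snd c' p) \<bullet> b))"

text \<open>The covector is the one with kernel the tangent space of the leaf and value \<open>1\<close> on \<open>X\<close>, so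
  every foliated chart computes it.\<close>

lemma foliation_covector_eq:
  assumes c: "c \<in> A" "p \<in> fst c" and c': "c' \<in> T" "p \<in> fst c'"
  shows "foliation_covector c (snd c p) v = (dtransition c c' p v \<bullet> b) / (X c' (snd c' p) \<bullet> b)"
proof -
  define c'' where "c'' = (SOME c'. c' \<in> T \<and> p \<in> fst c')"
  have "c'' \<in> T \<and> p \<in> fst c''" unfolding c''_def by (rule someI[of _ c']) (use c' in blast)
  then have c'': "c'' \<in> T" "p \<in> fst c''" by auto
  have A: "c' \<in> A" "c'' \<in> A" using c' c'' foliation_in by blast+
  define l where "l w = dtransition c' c'' p w \<bullet> b" for w
  have lin: "linear l"
    unfolding l_def using linear_dtransition[OF A c'(2) c''(2)]
    by (auto intro!: linearI simp: linear_add linear_scale inner_add_left)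
  have l: "l w = l b * (w \<bullet> b)" for w
  proof -
    have "l (w - (w \<bullet> b) *\<^sub>R b) = 0"
      unfolding l_def
      by (rule foliated_compatible_derivative[OF A c'(2) c''(2) foliation_compatible[OF c'(1) c''(1)]])
        (use foliation_normal in \<open>simp add: inner_diff_left\<close>)
    then show ?thesis unfolding linear_diff[OF lin] linear_scale[OF lin] by simp
  qed
  have nz: "X c' (snd c' p) \<bullet> b \<noteq> 0" "X c'' (snd c'' p) \<bullet> b \<noteq> 0"
    using foliation_transverse c' c'' by blast+
  have lX: "X c'' (snd c'' p) \<bullet> b = l b * (X c' (snd c' p) \<bullet> b)"
    using l[of "X c' (snd c' p)"] vector_field_transition[OF field A c'(2) c''(2)] by (simp add: l_def)
  have lv: "dtransition c c'' p v \<bullet> b = l b * (dtransition c c' p v \<bullet> b)"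
    using l[of "dtransition c c' p v"] dtransition_cocycle[OF c(1) A c(2) c'(2) c''(2), of v] by (simp add: l_def)
  have "foliation_covector c (snd c p) v = (dtransition c c'' p v \<bullet> b) / (X c'' (snd c'' p) \<bullet> b)"
    unfolding foliation_covector_def cinv_snd[OF chart[OF c(1)] c(2)] Let_def c''_def ..
  also have "\<dots> = (dtransition c c' p v \<bullet> b) / (X c' (snd c' p) \<bullet> b)"
    using nz unfolding lX lv by simp
  finally show ?thesis .
qed

lemma foliation_form: "diff_form A 1 (one_form A foliation_covector)"
proof (rule diff_form_one_form)
  fix c x assume c: "c \<in> A" "x \<in> crange c"
  obtain p where p: "p \<in> fst c" "x = snd c p" using c(2) by blast
  obtain c' where c': "c' \<in> T" "p \<in> fst c'" using ex_foliation_chart by blast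
  have c'A: "c' \<in> A" using c' foliation_in by blast
  have eq: "foliation_covector c x = (\<lambda>v. (dtransition c c' p v \<bullet> b) / (X c' (snd c' p) \<bullet> b))"
    unfolding p(2) using foliation_covector_eq[OF c(1) p(1) c'] by blast
  show "linear (foliation_covector c x)"
    unfolding eq using linear_dtransition[OF c(1) c'A p(1) c'(2)]
    by (auto intro!: linearI simp: linear_add linear_scale inner_add_left add_divide_distrib)
next
  fix c v assume c: "c \<in> A"
  note ch = chart[OF c]
  show "smooth_on (crange c) (\<lambda>x. foliation_covector c x v)"
  proof (rule smooth_on_local)
    fix x assume "x \<in> crange c"
    then obtain p where p: "p \<in> fst c" "x = snd c p" by blast
    obtain c' where c': "c' \<in> T" "p \<in> fst c'" using ex_foliation_chart by blast
    have c'A: "c' \<in> A" using c' foliation_in by blast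
    define S where "S = snd c ` (fst c \<inter> fst c')"
    have S: "open S" "x \<in> S" unfolding S_def using open_overlap[OF c c'A] p c' by auto
    have sm: "smooth_on S (transition c c')" unfolding S_def by (rule smooth_transition[OF c c'A])
    have im: "transition c c' y \<in> crange c'" if "y \<in> S" for y
      using that transition_apply[OF ch, of _ c'] unfolding S_def by auto
    have smX: "smooth_on S (\<lambda>y. X c' (transition c c' y))"
      by (rule smooth_on_compose[OF S(1) open_crange[OF chart[OF c'A]] im vector_field_smooth[OF field c'A] sm])
    have "smooth_on S (\<lambda>y. (Dt (transition c c') y v \<bullet> b) * inverse (X c' (transition c c' y) \<bullet> b))"
    proof (intro smooth_on_mult[OF S(1)] smooth_on_inverse[OF S(1)] smooth_on_inner_left[OF S(1)] smooth_on_Dt sm smX)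
      show "X c' (transition c c' y) \<bullet> b \<noteq> 0" if "y \<in> S" for y
        using foliation_transverse[OF c'(1) im[OF that]] .
    qed
    then have "smooth_on S (\<lambda>x. foliation_covector c x v)"
    proof (rule smooth_on_cong[OF S(1), rotated])
      fix y assume "y \<in> S"
      then obtain q where q: "q \<in> fst c" "q \<in> fst c'" "y = snd c q" unfolding S_def by blast
      show "(Dt (transition c c') y v \<bullet> b) * inverse (X c' (transition c c' y) \<bullet> b) = foliation_covector c y v"
        unfolding q(3) foliation_covector_eq[OF c q(1) c'(1) q(2)] transition_apply[OF ch q(1)]
          dtransition_def divide_inverse ..
    qed
    then show "\<exists>U. open U \<and> x \<in> U \<and> smooth_on U (\<lambda>x. foliation_covector c x v)" using S by blast
  qed
next
  fix c c' p v assume c: "c \<in> A" "c' \<in> A" "p \<in> fst c" "p \<in> fst c'"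
  obtain c'' where c'': "c'' \<in> T" "p \<in> fst c''" using ex_foliation_chart by blast
  have c''A: "c'' \<in> A" using c'' foliation_in by blast
  show "foliation_covector c (snd c p) v = foliation_covector c' (snd c' p) (dtransition c c' p v)"
    unfolding foliation_covector_eq[OF c(1,3) c''] foliation_covector_eq[OF c(2,4) c'']
      dtransition_cocycle[OF c(1,2) c''A c(3,4) c''(2)] ..
qed

lemma foliation_form_field:
  assumes "c \<in> A" "x \<in> crange c"
  shows "one_form A foliation_covector c x [X c x] = 1"
proof -
  obtain p where p: "p \<in> fst c" "x = snd c p" using assms(2) by blast
  obtain c' where c': "c' \<in> T" "p \<in> fst c'" using ex_foliation_chart by blast
  have c'A: "c' \<in> A" using c' foliation_in by blast
  have "X c' (snd c' p) \<bullet> b \<noteq> 0" using foliation_transverse c' by blast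
  then show ?thesis
    unfolding one_form_apply[OF assms] unfolding p(2) foliation_covector_eq[OF assms(1) p(1) c']
      vector_field_transition[OF field assms(1) c'A p(1) c'(2), symmetric] by simp
qed

text \<open>In a foliated chart \<open>\<alpha>(v) = m (v \<bullet> b)\<close> with \<open>m = 1 / (X \<bullet> b)\<close> constant along plaques.  Hence \<open>Dm(v)\<close> is a
  multiple of \<open>v \<bullet> b\<close>, and \<open>d\<alpha>\<close> vanishes by symmetry.\<close>

lemma foliation_form_closed: "ext_deriv (one_form A foliation_covector) = 0"
  unfolding ext_deriv_1_eq_0_iff[OF foliation_form]
proof (intro ballI allI)
  let ?\<alpha> = "one_form A foliation_covector"
  fix c0 x0 u0 v0 assume c0: "c0 \<in> A" "x0 \<in> crange c0"
  obtain p where p: "p \<in> fst c0" "x0 = snd c0 p" using c0(2) by blast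
  obtain c where c: "c \<in> T" "p \<in> fst c" using ex_foliation_chart by blast
  have cA: "c \<in> A" using c foliation_in by blast
  note op = open_crange[OF chart[OF cA]]
  define x where "x = snd c p"
  have x: "x \<in> crange c" using c by (simp add: x_def)
  define m where "m y = inverse (X c y \<bullet> b)" for y
  have m: "smooth_on (crange c) m"
    unfolding m_def using foliation_transverse[OF c(1)]
    by (intro smooth_on_inverse[OF op] smooth_on_inner_left[OF op] vector_field_smooth[OF field cA])
  have md: "(m has_derivative Dt m x) (at x)" by (rule smooth_on_has_derivative[OF m x])
  have \<alpha>c: "?\<alpha> c y [v] = (v \<bullet> b) * m y" if y: "y \<in> crange c" for y v
  proof -
    obtain q where q: "q \<in> fst c" "y = snd c q" using y by blast
    show ?thesis
      unfolding one_form_apply[OF cA y] unfolding q(2) foliation_covector_eq[OF cA q(1) c(1) q(1)]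
      by (simp add: dtransition_self[OF cA q(1)] m_def divide_inverse)
  qed
  have D: "Dt (\<lambda>y. ?\<alpha> c y [v]) x u = (v \<bullet> b) * Dt m x u" for u v
  proof -
    have "Dt (\<lambda>y. ?\<alpha> c y [v]) x = Dt (\<lambda>y. (v \<bullet> b) * m y) x"
      by (rule Dt_cong[OF op x]) (rule \<alpha>c)
    also have "\<dots> = (\<lambda>u. (v \<bullet> b) * Dt m x u)"
      by (intro Dt_eqI has_derivative_mult_right md)
    finally show ?thesis by (rule fun_cong)
  qed
  obtain r where r: "r > 0" "ball (snd c p) r \<subseteq> crange c"
    "\<And>y. y \<in> ball (snd c p) r \<Longrightarrow> y \<bullet> b = snd c p \<bullet> b \<Longrightarrow> X c y \<bullet> b = X c (snd c p) \<bullet> b"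
    by (rule transverse_speed_constant_on_plaques[OF c]) (rule that)
  have zero: "Dt m x v = 0" if "v \<bullet> b = 0" for v
  proof (rule derivative_zero_along_hyperplane[OF md _ _ _ that])
    show "open (ball x r)" "x \<in> ball x r" using r(1) by auto
    show "m y = m x" if "y \<in> ball x r" "y \<bullet> b = x \<bullet> b" for y
      using r(3) that unfolding m_def x_def by simp
  qed
  have lin: "linear (Dt m x)" using md has_derivative_linear by blast
  have mb: "Dt m x v = (v \<bullet> b) * Dt m x b" for v
  proof -
    have "Dt m x (v - (v \<bullet> b) *\<^sub>R b) = 0"
      by (rule zero) (use foliation_normal in \<open>simp add: inner_diff_left\<close>)
    then show ?thesis unfolding linear_diff[OF lin] linear_scale[OF lin] by simp
  qed
  have "curl ?\<alpha> c x u v = 0" for u v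
    unfolding curl_def D mb[of u] mb[of v] by simp
  then show "curl ?\<alpha> c0 x0 u0 v0 = 0"
    unfolding p(2) curl_transition[OF foliation_form c0(1) cA p(1) c(2)] x_def by blast
qed

end

lemma closed_characteristic_form_iff_foliation:
  "(\<exists>\<alpha>. characteristic_form A X \<alpha> \<and> ext_deriv \<alpha> = 0) \<longleftrightarrow>
    (\<exists>Q T. foliation A Q T \<and> card Q = 1 \<and> transverse_foliation X Q T \<and> flow_invariant A X Q T)"
proof
  assume "\<exists>\<alpha>. characteristic_form A X \<alpha> \<and> ext_deriv \<alpha> = 0"
  then obtain \<alpha> where \<alpha>: "diff_form A 1 \<alpha>" "\<And>c x. c \<in> A \<Longrightarrow> x \<in> crange c \<Longrightarrow> \<alpha> c x [X c x] = 1"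
    and closed: "ext_deriv \<alpha> = 0"
    unfolding characteristic_form_def by blast
  obtain b :: 'e where b: "b \<in> Basis" using nonempty_Basis by blast
  have "foliation A {b} (kernel_atlas \<alpha> b)" "transverse_foliation X {b} (kernel_atlas \<alpha> b)"
    "flow_invariant A X {b} (kernel_atlas \<alpha> b)"
    using kernel_atlas_foliation[OF \<alpha> b closed] kernel_atlas_transverse[OF \<alpha> b]
      kernel_atlas_flow_invariant[OF \<alpha> b closed] by blast+
  then show "\<exists>Q T. foliation A Q T \<and> card Q = 1 \<and> transverse_foliation X Q T \<and> flow_invariant A X Q T"
    by (intro exI[of _ "{b}"] exI[of _ "kernel_atlas \<alpha> b"]) simp
next
  assume "\<exists>Q T. foliation A Q T \<and> card Q = 1 \<and> transverse_foliation X Q T \<and> flow_invariant A X Q T"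
  then obtain T b where T: "foliation A {b} T" "transverse_foliation X {b} T" "flow_invariant A X {b} T"
    by (auto simp: card_1_singleton_iff)
  let ?\<alpha> = "one_form A (foliation_covector T b)"
  have "characteristic_form A X ?\<alpha>"
    unfolding characteristic_form_def foliation_form_closed[OF T]
    using foliation_form[OF T] foliation_form_field[OF T] by (auto simp: int_prod_def fun_eq_iff)
  then show "\<exists>\<alpha>. characteristic_form A X \<alpha> \<and> ext_deriv \<alpha> = 0"
    using foliation_form_closed[OF T] by blast
qed

end

theorem theorem5p7:
  fixes A :: "('m::{t2_space, second_countable_topology}, 'e::euclidean_space) chart set"
    and X :: "('m, 'e) vfield"
  assumes "closed_manifold A"
    and "geodesible A X"
  shows "euler_class A X = basic_class A X 2 0 \<longleftrightarrow>
    (\<exists>Q T. foliation A Q T \<and> card Q = 1 \<and> transverse_foliation X Q T \<and> flow_invariant A X Q T)"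
proof -
  interpret closed_manifold_field A X
    using assms by unfold_locales (auto simp: closed_manifold_def geodesible_def)
  show ?thesis
    unfolding euler_class_zero_iff[OF geodesible_characteristic_form[OF assms(2)]]
    by (rule closed_characteristic_form_iff_foliation)
qed

end
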